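(* Let $\mathcal X^\star\in\mathbb R^{d_1\times\cdots\times d_N}$ be a tensor with tensor train ranks $\mathbf r=(r_1,\dots,r_{N-1})$, $\overline r=\max_i r_i$, with left-orthogonal factors $\{\mathbf X_i^\star\}$; let $\mathbf s\in\mathbb R^m$ be an outlier vector with fraction of nonzero entries $p_s=\|\mathbf s\|_0/m$, $\mathcal A(\mathcal X)=(\langle\mathcal A_k,\mathcal X\rangle)_{k=1}^m$ a linear map $\mathbb R^{d_1\times\cdots\times d_N}\to\mathbb R^m$, and $\mathbf y=\mathcal A(\mathcal X^\star)+\mathbf s$. Assume $\mathcal A$ obeys the $\ell_1/\ell_2$-RIP and sharpness (as defined in the context) with a constant $\delta_{(N+1)\overline r}\le(1-2p_s)\sqrt{2/\pi}$. Let $F(\mathbf X_1,\dots,\mathbf X_N)=\frac1m\|\mathcal A([\mathbf X_1,\dots,\mathbf X_N])-\mathbf y\|_1$ and consider the factorized Riemannian subgradient method (FRSubGM) $$L(\mathbf X_i^{(t+1)})=\operatorname{Retr}_{L(\mathbf X_i^{(t)})}\left(L(\mathbf X_i^{(t)})-\frac{\mu_t}{\overline\sigma^2(\mathcal X^\star)}\mathcal P_{\mathrm T_{L(\mathbf X_i^{(t)})}\mathrm{St}}\left(\partial_{L(\mathbf X_i)}F(\mathbf X_1^{(t)},\dots,\mathbf X_N^{(t)})\right)\right),\quad i\in[N-1],$$ $$L(\mathbf X_N^{(t+1)})=L(\mathbf X_N^{(t)})-\mu_t\,\partial_{L(\mathbf X_N)}F(\mathbf X_1^{(t)},\dots,\mathbf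 X_N^{(t)}),$$ initialized with $\mathcal X^{(0)}=[\mathbf X_1^{(0)},\dots,\mathbf X_N^{(0)}]$ in tensor train format with ranks $\mathbf r$ and left-orthogonal factors, satisfying $\|\mathcal X^{(0)}-\mathcal X^\star\|_F^2\le b$, where $$b=\frac{\underline\sigma^4(\mathcal X^\star)\left((1-2p_s)\sqrt{2/\pi}-\delta_{(N+1)\overline r}\right)^2}{144(2N^2-2N+1)\left(N+1+\sum_{i=2}^{N-1}r_i\right)^2(\sqrt{2/\pi}+\delta_{(N+1)\overline r})^2\,\overline\sigma^2(\mathcal X^\star)},$$ and with step sizes $\mu_t=\lambda q^t$, where $$\lambda=\frac{(1-2p_s)\sqrt{2/\pi}-\delta_{(N+1)\overline r}}{\sqrt{2\left(N+1+\sum_{i=2}^{N-1}r_i\right)}\,(9N-5)(\sqrt{2/\pi}+\delta_{(N+1)\overline r})^2\,\kappa(\mathcal X^\star)}\operatorname{dist}(\{\mathbf X_i^{(0)}\},\{\mathbf X_i^\star\}),$$ $$q=\sqrt{1-\frac{\left((1-2p_s)\sqrt{2/\pi}-\delta_{(N+1)\overline r}\right)^2}{8\left(N+1+\sum_{i=2}^{N-1}r_i\right)(9N-5)(\sqrt{2/\pi}+\delta_{(N+1)\overline r})^2\,\kappa^2(\mathcal X^\star)}}.$$ Then for all $t\ge0$, $$\operatorname{dist}^2(\{\mathbf X_i^{(t)}\},\{\mathbf X_i^\star\})\le q^{2t}\,\operatorname{dist}^2(\{\mathbf X_i^{(0)}\},\{\mathbf X_i^\star\}).$$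
   Context: TT format: for factors $\mathbf X_i\in\mathbb R^{r_{i-1}\times d_i\times r_i}$, $i=1,\dots,N$ ($N\ge2$, $r_0=r_N=1$), $[\mathbf X_1,\dots,\mathbf X_N]$ is the tensor $\mathcal X\in\mathbb R^{d_1\times\cdots\times d_N}$ with $\mathcal X(s_1,\dots,s_N)=\mathbf X_1(s_1)\cdots\mathbf X_N(s_N)$, $\mathbf X_i(s_i)=\mathbf X_i(:,s_i,:)\in\mathbb R^{r_{i-1}\times r_i}$; such $\mathcal X$ is said to be in TT format with ranks $\mathbf r$. The left unfolding $L(\mathbf X_i)\in\mathbb R^{d_ir_{i-1}\times r_i}$ stacks $\mathbf X_i(1),\dots,\mathbf X_i(d_i)$ vertically. Factors are left-orthogonal if $L(\mathbf X_i)^\top L(\mathbf X_i)=\mathbf I_{r_i}$ for $i=1,\dots,N-1$. The $i$-th unfolding $\mathcal X^{\langle i\rangle}$ groups the first $i$ indices as rows and the rest as columns; the TT ranks of $\mathcal X^\star$ are $r_i=\operatorname{rank}\mathcal X^{\star\langle i\rangle}$. $\underline\sigma(\mathcal X^\star)=\min_{i\le N-1}\sigma_{r_i}(\mathcal X^{\star\langle i\rangle})$, $\overline\sigma(\mathcal X^\star)=\max_{i\le N-1}\sigma_1(\mathcal X^{\star\langle i\rangle})$, $\kappa(\mathcal X^\star)=\overline\sigma(\mathcal X^\star)/\underline\sigma(\mathcal X^\star)$. Distance: for orthogonal matrices $\mathbf R_i\in\mathbb R^{r_i\times r_i}$, $i\in[N-1]$, and $\mathbf R_0=\mathbf R_N=1$,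 $L_{\mathbf R}(\mathbf X_i^\star)$ stacks $\mathbf R_{i-1}^\top\mathbf X_i^\star(s)\mathbf R_i$, $s=1,\dots,d_i$, vertically, and $$\operatorname{dist}^2(\{\mathbf X_i\},\{\mathbf X_i^\star\})=\min_{\mathbf R_1,\dots,\mathbf R_{N-1}}\sum_{i=1}^{N-1}\overline\sigma^2(\mathcal X^\star)\|L(\mathbf X_i)-L_{\mathbf R}(\mathbf X_i^\star)\|_F^2+\|L(\mathbf X_N)-L_{\mathbf R}(\mathbf X_N^\star)\|_2^2.$$ Subgradient: $\partial_{L(\mathbf X_i)}F$ stacks vertically, over $s_i=1,\dots,d_i$, the matrices $$\partial_{\mathbf X_i(s_i)}F=\frac1m\sum_{k=1}^m\operatorname{sign}(\langle\mathcal A_k,\mathcal X\rangle-y_k)\sum_{s_j,\,j\ne i}\mathcal A_k(s_1,\dots,s_N)\,\mathbf X_{i-1}^\top(s_{i-1})\cdots\mathbf X_1^\top(s_1)\,\mathbf X_N^\top(s_N)\cdots\mathbf X_{i+1}^\top(s_{i+1}),$$ with $\mathcal X=[\mathbf X_1,\dots,\mathbf X_N]$ and $\operatorname{sign}(x)=-1,0,1$ for $x<0,x=0,x>0$. $\mathcal P_{\mathrm T_{L(\mathbf X_i)}\mathrm{St}}(\mathbf U)=\mathbf U-\frac12L(\mathbf X_i)\left(\mathbf U^\top L(\mathbf X_i)+L(\mathbf X_i)^\top\mathbf U\right)$ is the projection onto the tangent space of the Stiefel manifold at $L(\mathbf X_i)$, and the polar retraction is $\operatorname{Retr}_{L(\mathbf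 X_i)}(\mathbf G)=\mathbf G(\mathbf G^\top\mathbf G)^{-1/2}$. $\ell_1/\ell_2$-RIP with constant $\delta_{(N+1)\overline r}\in(0,\sqrt{2/\pi})$: $(\sqrt{2/\pi}-\delta_{(N+1)\overline r})\|\mathcal X\|_F\le\frac1m\|\mathcal A(\mathcal X)\|_1\le(\sqrt{2/\pi}+\delta_{(N+1)\overline r})\|\mathcal X\|_F$ for all $\mathcal X$ in TT format with all ranks at most $(N+1)\overline r$. Sharpness with this constant: $\frac1m\|\mathcal A(\mathcal X-\mathcal X^\star)-\mathbf s\|_1-\frac1m\|\mathbf s\|_1\ge((1-2p_s)\sqrt{2/\pi}-\delta_{(N+1)\overline r})\|\mathcal X-\mathcal X^\star\|_F$ for all $\mathcal X$ in TT format with ranks $\mathbf r$. *)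

theory Defs
  imports Complex_Main
    "Jordan_Normal_Form.Char_Poly"
    "Jordan_Normal_Form.DL_Rank"
begin

section \<open>Matrix notions\<close>

definition fro_norm :: "real mat \<Rightarrow> real" where
  "fro_norm A = sqrt (\<Sum>a<dim_row A. \<Sum>b<dim_col A. (A $$ (a, b))\<^sup>2)"

definition l1_norm :: "real vec \<Rightarrow> real" where
  "l1_norm v = (\<Sum>k<dim_vec v. \<bar>v $ k\<bar>)"

definition mat_rank :: "real mat \<Rightarrow> nat" where
  "mat_rank A = vec_space.rank (dim_row A) A"

text \<open>
  \<open>\<sigma>\<^sub>k(A)\<close>, with \<open>k\<close> counted from 1: the square root of the \<open>k\<close>-th largest eigenvalue of
  \<open>A\<^sup>T A\<close>, eigenvalues being listed with multiplicity. Meaningful for \<open>1 \<le> k \<le> dim_col A\<close>.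
\<close>

definition singular_value :: "real mat \<Rightarrow> nat \<Rightarrow> real" where
  "singular_value A k =
     sqrt (rev (sorted_list_of_multiset (proots (char_poly (transpose_mat A * A)))) ! (k - 1))"

definition pos_def_mat :: "real mat \<Rightarrow> bool" where
  "pos_def_mat S \<longleftrightarrow> square_mat S \<and> transpose_mat S = S \<and>
     (\<forall>x\<in>carrier_vec (dim_row S). x \<noteq> 0\<^sub>v (dim_row S) \<longrightarrow> 0 < x \<bullet> (S *\<^sub>v x))"

text \<open>\<open>M\<^sup>-\<^sup>1\<^sup>/\<^sup>2\<close>, for positive definite \<open>M\<close>: the unique positive definite \<open>S\<close> with \<open>S\<^sup>2 = M\<^sup>-\<^sup>1\<close>.\<close>

definition mat_inv_sqrt :: "real mat \<Rightarrow> real mat" where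
  "mat_inv_sqrt M = (THE S. S \<in> carrier_mat (dim_row M) (dim_row M) \<and> pos_def_mat S \<and>
     inverts_mat (S * S) M)"

text \<open>The formula of the polar retraction does not involve its base point.\<close>

definition polar_retr :: "real mat \<Rightarrow> real mat" where
  "polar_retr G = G * mat_inv_sqrt (transpose_mat G * G)"

definition stiefel_proj :: "real mat \<Rightarrow> real mat \<Rightarrow> real mat" where
  "stiefel_proj L U =
     U - (1/2 :: real) \<cdot>\<^sub>m (L * (transpose_mat U * L + transpose_mat L * U))"


section \<open>Tensors and the tensor train format\<close>

text \<open>
  An order-\<open>N\<close> tensor of size \<open>d 1 \<times> \<dots> \<times> d N\<close> is a function on multi-indices of length \<open>N\<close>.
  The modes are numbered \<open>1, \<dots>, N\<close>, but the values of each index start at 0, so that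
  \<open>s\<^sub>i = s ! (i - 1) < d i\<close>. Only the values on \<open>multi_idx d 1 N\<close> matter.
\<close>

type_synonym tensor = "nat list \<Rightarrow> real"

definition multi_idx_list :: "(nat \<Rightarrow> nat) \<Rightarrow> nat \<Rightarrow> nat \<Rightarrow> nat list list" where
  "multi_idx_list d a b = product_lists (map (\<lambda>i. [0..<d i]) [a..<Suc b])"

definition multi_idx :: "(nat \<Rightarrow> nat) \<Rightarrow> nat \<Rightarrow> nat \<Rightarrow> nat list set" where
  "multi_idx d a b = set (multi_idx_list d a b)"

definition tensor_inner :: "nat \<Rightarrow> (nat \<Rightarrow> nat) \<Rightarrow> tensor \<Rightarrow> tensor \<Rightarrow> real" where
  "tensor_inner N d X Y = (\<Sum>s\<in>multi_idx d 1 N. X s * Y s)"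

definition tensor_norm :: "nat \<Rightarrow> (nat \<Rightarrow> nat) \<Rightarrow> tensor \<Rightarrow> real" where
  "tensor_norm N d X = sqrt (\<Sum>s\<in>multi_idx d 1 N. (X s)\<^sup>2)"

text \<open>
  \<open>\<X>\<^sup>\<langle>\<^sup>i\<^sup>\<rangle>\<close>: rows and columns are indexed by the first \<open>i\<close> and the last \<open>N - i\<close> indices, in
  lexicographic order (rank and singular values do not depend on the order chosen).
\<close>

definition tensor_unfold :: "nat \<Rightarrow> (nat \<Rightarrow> nat) \<Rightarrow> nat \<Rightarrow> tensor \<Rightarrow> real mat" where
  "tensor_unfold N d i X =
     (let rs = multi_idx_list d 1 i; cs = multi_idx_list d (Suc i) N
      in mat (length rs) (length cs) (\<lambda>(a, b). X (rs ! a @ cs ! b)))"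

definition tt_rank :: "nat \<Rightarrow> (nat \<Rightarrow> nat) \<Rightarrow> tensor \<Rightarrow> nat \<Rightarrow> nat" where
  "tt_rank N d X i = mat_rank (tensor_unfold N d i X)"

definition sigma_min :: "nat \<Rightarrow> (nat \<Rightarrow> nat) \<Rightarrow> tensor \<Rightarrow> real" where
  "sigma_min N d X =
     Min ((\<lambda>i. singular_value (tensor_unfold N d i X) (tt_rank N d X i)) ` {1..N - 1})"

definition sigma_max :: "nat \<Rightarrow> (nat \<Rightarrow> nat) \<Rightarrow> tensor \<Rightarrow> real" where
  "sigma_max N d X = Max ((\<lambda>i. singular_value (tensor_unfold N d i X) 1) ` {1..N - 1})"

definition cond_num :: "nat \<Rightarrow> (nat \<Rightarrow> nat) \<Rightarrow> tensor \<Rightarrow> real" where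
  "cond_num N d X = sigma_max N d X / sigma_min N d X"

text \<open>For a family of factors \<open>X\<close>, the slice \<open>\<^bold>X\<^sub>i(s)\<close> is \<open>X i s\<close>, of size \<open>r (i - 1) \<times> r i\<close>.\<close>

type_synonym factors = "nat \<Rightarrow> nat \<Rightarrow> real mat"

definition tt_factors :: "nat \<Rightarrow> (nat \<Rightarrow> nat) \<Rightarrow> (nat \<Rightarrow> nat) \<Rightarrow> factors \<Rightarrow> bool" where
  "tt_factors N d r X \<longleftrightarrow> (\<forall>i\<in>{1..N}. \<forall>s<d i. X i s \<in> carrier_mat (r (i - 1)) (r i))"

text \<open>
  \<open>[\<^bold>X\<^sub>1, \<dots>, \<^bold>X\<^sub>N]\<close>: the entries are the \<open>1 \<times> 1\<close> matrices \<open>\<^bold>X\<^sub>1(s\<^sub>1) \<dots> \<^bold>X\<^sub>N(s\<^sub>N)\<close>. The value 0 off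
  the index set makes the tensor determined by its entries.
\<close>

definition tt_tensor :: "nat \<Rightarrow> (nat \<Rightarrow> nat) \<Rightarrow> factors \<Rightarrow> tensor" where
  "tt_tensor N d X s =
     (if s \<in> multi_idx d 1 N
      then foldr (\<lambda>i M. X i (s ! (i - 1)) * M) [1..<Suc N] (1\<^sub>m 1) $$ (0, 0) else 0)"

definition has_tt_format :: "nat \<Rightarrow> (nat \<Rightarrow> nat) \<Rightarrow> (nat \<Rightarrow> nat) \<Rightarrow> tensor \<Rightarrow> bool" where
  "has_tt_format N d r X \<longleftrightarrow> r 0 = 1 \<and> r N = 1 \<and>
     (\<exists>Xf. tt_factors N d r Xf \<and> X = tt_tensor N d Xf)"

text \<open>
  The vertical stack of \<open>X i 0, \<dots>, X i (d i - 1)\<close>; this is \<open>L(\<^bold>X\<^sub>i)\<close> when \<open>X\<close> is a family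
  of factors.
\<close>

definition left_unfold :: "(nat \<Rightarrow> nat) \<Rightarrow> (nat \<Rightarrow> nat) \<Rightarrow> factors \<Rightarrow> nat \<Rightarrow> real mat" where
  "left_unfold d r X i =
     mat (d i * r (i - 1)) (r i) (\<lambda>(a, b). X i (a div r (i - 1)) $$ (a mod r (i - 1), b))"

definition left_orthogonal :: "nat \<Rightarrow> (nat \<Rightarrow> nat) \<Rightarrow> (nat \<Rightarrow> nat) \<Rightarrow> factors \<Rightarrow> bool" where
  "left_orthogonal N d r X \<longleftrightarrow>
     (\<forall>i\<in>{1..N - 1}. transpose_mat (left_unfold d r X i) * left_unfold d r X i = 1\<^sub>m (r i))"


section \<open>Distance between factor families\<close>

definition orth_families :: "nat \<Rightarrow> (nat \<Rightarrow> nat) \<Rightarrow> (nat \<Rightarrow> real mat) set" where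
  "orth_families N r = {R. R 0 = 1\<^sub>m 1 \<and> R N = 1\<^sub>m 1 \<and>
     (\<forall>i\<in>{1..N - 1}. R i \<in> carrier_mat (r i) (r i) \<and> transpose_mat (R i) * R i = 1\<^sub>m (r i))}"

definition rotate_factors :: "(nat \<Rightarrow> real mat) \<Rightarrow> factors \<Rightarrow> factors" where
  "rotate_factors R X = (\<lambda>i s. transpose_mat (R (i - 1)) * X i s * R i)"

text \<open>
  The minimum over the compact set of orthogonal families is written as an infimum. Since
  \<open>r N = 1\<close>, the last difference is a single column, whose Euclidean norm is its Frobenius norm.
\<close>

definition tt_dist2 ::
  "nat \<Rightarrow> (nat \<Rightarrow> nat) \<Rightarrow> (nat \<Rightarrow> nat) \<Rightarrow> factors \<Rightarrow> factors \<Rightarrow> real" where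
  "tt_dist2 N d r X Xs =
     (INF R\<in>orth_families N r.
        (\<Sum>i = 1..N - 1. (sigma_max N d (tt_tensor N d Xs))\<^sup>2 *
           (fro_norm (left_unfold d r X i - left_unfold d r (rotate_factors R Xs) i))\<^sup>2) +
        (fro_norm (left_unfold d r X N - left_unfold d r (rotate_factors R Xs) N))\<^sup>2)"

definition tt_dist ::
  "nat \<Rightarrow> (nat \<Rightarrow> nat) \<Rightarrow> (nat \<Rightarrow> nat) \<Rightarrow> factors \<Rightarrow> factors \<Rightarrow> real" where
  "tt_dist N d r X Xs = sqrt (tt_dist2 N d r X Xs)"


section \<open>Measurements, loss and subgradient\<close>

definition measure_op ::
  "nat \<Rightarrow> (nat \<Rightarrow> nat) \<Rightarrow> nat \<Rightarrow> (nat \<Rightarrow> tensor) \<Rightarrow> tensor \<Rightarrow> real vec" where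
  "measure_op N d m A X = vec m (\<lambda>k. tensor_inner N d (A k) X)"

definition nonzero_frac :: "real vec \<Rightarrow> real" where
  "nonzero_frac v = real (card {k. k < dim_vec v \<and> v $ k \<noteq> 0}) / real (dim_vec v)"

definition l1l2_rip ::
  "nat \<Rightarrow> (nat \<Rightarrow> nat) \<Rightarrow> nat \<Rightarrow> (nat \<Rightarrow> tensor) \<Rightarrow> nat \<Rightarrow> real \<Rightarrow> bool" where
  "l1l2_rip N d m A K \<delta> \<longleftrightarrow> 0 < \<delta> \<and> \<delta> < sqrt (2 / pi) \<and>
     (\<forall>r X. (\<forall>i\<in>{1..N - 1}. r i \<le> K) \<longrightarrow> has_tt_format N d r X \<longrightarrow>
        (sqrt (2 / pi) - \<delta>) * tensor_norm N d X \<le> 1 / real m * l1_norm (measure_op N d m A X) \<and>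
        1 / real m * l1_norm (measure_op N d m A X) \<le> (sqrt (2 / pi) + \<delta>) * tensor_norm N d X)"

definition sharpness ::
  "nat \<Rightarrow> (nat \<Rightarrow> nat) \<Rightarrow> (nat \<Rightarrow> nat) \<Rightarrow> nat \<Rightarrow> (nat \<Rightarrow> tensor) \<Rightarrow> tensor \<Rightarrow> real vec \<Rightarrow> real \<Rightarrow> bool"
  where
  "sharpness N d r m A X\<^sub>0 sv \<delta> \<longleftrightarrow>
     (\<forall>X. has_tt_format N d r X \<longrightarrow>
        1 / real m * l1_norm (measure_op N d m A (\<lambda>s. X s - X\<^sub>0 s) - sv) - 1 / real m * l1_norm sv
        \<ge> ((1 - 2 * nonzero_frac sv) * sqrt (2 / pi) - \<delta>) * tensor_norm N d (\<lambda>s. X s - X\<^sub>0 s))"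

definition tt_loss ::
  "nat \<Rightarrow> (nat \<Rightarrow> nat) \<Rightarrow> nat \<Rightarrow> (nat \<Rightarrow> tensor) \<Rightarrow> real vec \<Rightarrow> factors \<Rightarrow> real" where
  "tt_loss N d m A y X = 1 / real m * l1_norm (measure_op N d m A (tt_tensor N d X) - y)"

text \<open>
  The subgradient of \<open>tt_loss\<close> in the slice \<open>\<^bold>X\<^sub>i(\<tau>)\<close>, obtained by the chain rule with \<open>sgn 0\<close> as
  the subgradient of \<open>\<bar>\<cdot>\<bar>\<close> at 0. The sum of matrices is written entrywise; \<open>grad_prod r X N i s\<close> is
  \<open>\<^bold>X\<^sub>i\<^sub>-\<^sub>1(s\<^sub>i\<^sub>-\<^sub>1)\<^sup>T \<dots> \<^bold>X\<^sub>1(s\<^sub>1)\<^sup>T \<^bold>X\<^sub>N(s\<^sub>N)\<^sup>T \<dots> \<^bold>X\<^sub>i\<^sub>+\<^sub>1(s\<^sub>i\<^sub>+\<^sub>1)\<^sup>T\<close>, in which the left or right group is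
  empty for \<open>i = 1\<close> or \<open>i = N\<close>.
\<close>

definition grad_prod :: "(nat \<Rightarrow> nat) \<Rightarrow> factors \<Rightarrow> nat \<Rightarrow> nat \<Rightarrow> nat list \<Rightarrow> real mat" where
  "grad_prod r X N i s =
     foldr (\<lambda>j M. transpose_mat (X j (s ! (j - 1))) * M)
       (rev [1..<i] @ rev [Suc i..<Suc N]) (1\<^sub>m (r i))"

definition tt_subgrad ::
  "nat \<Rightarrow> (nat \<Rightarrow> nat) \<Rightarrow> (nat \<Rightarrow> nat) \<Rightarrow> nat \<Rightarrow> (nat \<Rightarrow> tensor) \<Rightarrow> real vec \<Rightarrow> factors \<Rightarrow> factors"
  where
  "tt_subgrad N d r m A y X = (\<lambda>i \<tau>. mat (r (i - 1)) (r i) (\<lambda>ab.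
     1 / real m * (\<Sum>k<m. sgn (tensor_inner N d (A k) (tt_tensor N d X) - y $ k) *
       (\<Sum>s | s \<in> multi_idx d 1 N \<and> s ! (i - 1) = \<tau>. A k s * grad_prod r X N i s $$ ab))))"

end

theory Submission
  imports Defs
begin

text \<open>
  Fix orthogonal matrices \<open>R\<close>, rotate the factors of \<open>X\<^sup>*\<close> by them, and let \<open>\<Delta>\<^sub>i\<close> be the difference of the
  \<open>i\<close>-th factors of \<open>X\<close> and \<open>X\<^sup>*\<close>. The polar retraction of a tangent step does not increase the distance to
  points of the Stiefel manifold, so a step changes the objective of the distance at \<open>R\<close> by
  \<open>-2 \<mu> \<Sum>\<^sub>i \<langle>\<partial>\<^sub>iF, P \<Delta>\<^sub>i\<rangle>\<close> plus \<open>\<mu>\<^sup>2\<close> times the squared gradients. By multilinearity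
  \<open>\<Sum>\<^sub>i [X\<^sub>1, \<dots>, \<Delta>\<^sub>i, \<dots>, X\<^sub>N]\<close> is \<open>X - X\<^sup>*\<close> plus tensors with two factors \<open>\<Delta>\<^sub>i, \<Delta>\<^sub>j\<close>, and the normal component of
  \<open>\<Delta>\<^sub>i\<close> is quadratic in \<open>\<Delta>\<^sub>i\<close>. Sharpness bounds the first term below by \<open>\<alpha> \<parallel>X - X\<^sup>*\<parallel>\<close>; the RIP, applied to
  each of the others separately (all have ranks \<open>r\<close>), bounds them by a multiple of the squared distance.

  In turn \<open>\<parallel>X - X\<^sup>*\<parallel>\<close> controls the distance: aligning the left interfaces of \<open>X\<close> and \<open>X\<^sup>*\<close> by orthogonal
  matrices costs at most \<open>2 \<parallel>X - X\<^sup>*\<parallel> / \<sigma>\<close>, and the slices are recovered from consecutive interfaces.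
  Since the estimates hold for every \<open>R\<close>, the infimum over \<open>R\<close> never has to be attained.
\<close>


text \<open>The weights of the distance match the interfaces. With left-orthogonal factors the left
  interfaces are isometries and \<open>smax\<close> bounds the right interfaces of the target, so a
  tensor with one factor replaced is bounded by the weighted norm of the replacement. Near the
  target the right interfaces of an iterate grow by at most 3/2; this bounds the squared gradients
  by 9/4 \<beta>^2 for each of the N - 1 scaled blocks and by \<beta>^2 for the last, together (9 N
  - 5)/4.

  With x the distance, a step gives x'^2 \<le> x^2 - 2 \<mu> (\<alpha> w x - c x^2) + \<mu>^2
  \<beta>^2 (9 N - 5)/4, where w x bounds the error from below. The radius \<open>b\<close> makes
  the curvature term c x^2 at most half of the linear one. The value of \<open>lam\<close> minimises
  what is left at x = u, for the scheduled bound u = q^t dist(0), and the minimal value of the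
  change is (q^2 - 1) u^2.

  The obstacle is that the step length follows u and not x. When x is smaller than u, the step may
  be too long and no decrease is guaranteed. Only the bound x \<le> u is inductive, and
  \<open>quadratic_contraction\<close> shows that it survives for every x below u.\<close>

section \<open>Spectral theorem for real symmetric matrices\<close>

text \<open>Over the complex numbers the characteristic polynomial splits anyway; a real symmetric
  matrix is Hermitian, so every root is real and the factorization descends to the reals.\<close>

lemma symmetric_char_poly_splits:
  fixes A :: "real mat"
  assumes A: "A \<in> carrier_mat n n" and sym: "A\<^sup>T = A"
  shows "\<exists>es. char_poly A = (\<Prod>e\<leftarrow>es. [:- e, 1:])"
proof -
  define C where "C = map_mat complex_of_real A"
  have C: "C \<in> carrier_mat n n" using A by (simp add: C_def)
  obtain as where as: "char_poly C = (\<Prod>a\<leftarrow>as. [:- a, 1:])"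
    using char_poly_factorized[OF C] by auto
  have Csym: "C $$ (i, j) = C $$ (j, i)" "cnj (C $$ (i, j)) = C $$ (i, j)" if "i < n" "j < n" for i j
  proof -
    have "A $$ (i, j) = A\<^sup>T $$ (i, j)" using sym by simp
    then show "C $$ (i, j) = C $$ (j, i)" using A that by (simp add: C_def)
    show "cnj (C $$ (i, j)) = C $$ (i, j)" using A that by (simp add: C_def)
  qed
  have real_root: "complex_of_real (Re a) = a" if "a \<in> set as" for a
  proof -
    have "poly (char_poly C) a = 0" unfolding as poly_prod_list
      using that by (auto simp: prod_list_zero_iff)
    then have "eigenvalue C a" using eigenvalue_root_char_poly[OF C] by simp
    then obtain v where v: "v \<in> carrier_vec n" "v \<noteq> 0\<^sub>v n" "C *\<^sub>v v = a \<cdot>\<^sub>v v"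
      unfolding eigenvalue_def eigenvector_def using C by auto
    have Cv: "(\<Sum>j<n. C $$ (i, j) * v $ j) = a * v $ i" if "i < n" for i
    proof -
      have "(C *\<^sub>v v) $ i = (\<Sum>j<n. C $$ (i, j) * v $ j)"
        using that v(1) C by (auto simp: scalar_prod_def lessThan_atLeast0 intro!: sum.cong)
      then show ?thesis using v that by simp
    qed
    define V where "V = (\<Sum>i<n. v $ i * cnj (v $ i))"
    have V: "V = complex_of_real (\<Sum>i<n. (cmod (v $ i))\<^sup>2)"
      by (simp add: V_def complex_mult_cnj cmod_power2)
    \<comment> \<open>The Hermitian form of the eigenvector \<open>v\<close> is evaluated from both
      sides; moving \<open>C\<close> across yields \<open>a * V = cnj a * V\<close> with
      \<open>V\<close> the squared norm of \<open>v\<close>.\<close>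
    have "a * V = (\<Sum>i<n. (\<Sum>j<n. C $$ (i, j) * v $ j) * cnj (v $ i))"
      by (simp add: V_def sum_distrib_left Cv mult.assoc)
    also have "\<dots> = (\<Sum>i<n. \<Sum>j<n. C $$ (i, j) * v $ j * cnj (v $ i))"
      by (simp add: sum_distrib_right)
    also have "\<dots> = (\<Sum>j<n. \<Sum>i<n. C $$ (i, j) * v $ j * cnj (v $ i))"
      by (rule sum.swap)
    also have "\<dots> = (\<Sum>j<n. v $ j * cnj (\<Sum>i<n. C $$ (j, i) * v $ i))"
      by (simp add: sum_distrib_left Csym) (intro sum.cong refl, simp add: Csym mult_ac)
    also have "\<dots> = (\<Sum>j<n. v $ j * cnj (a * v $ j))" by (simp add: Cv)
    also have "\<dots> = cnj a * V" by (simp add: V_def sum_distrib_left mult_ac)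
    finally have eq: "a * V = cnj a * V" .
    obtain i where i: "i < n" "v $ i \<noteq> 0" using v by (metis carrier_vecD eq_vecI index_zero_vec)
    have "(cmod (v $ i))\<^sup>2 \<le> (\<Sum>i<n. (cmod (v $ i))\<^sup>2)"
      using i by (intro member_le_sum) auto
    moreover have "0 < (cmod (v $ i))\<^sup>2" using i by simp
    ultimately have "V \<noteq> 0" unfolding V of_real_eq_0_iff by linarith
    then have "a = cnj a" using eq by simp
    then show ?thesis by (simp add: complex_eq_iff)
  qed
  interpret h: map_poly_inj_comm_ring_hom "complex_of_real" ..
  have "map_poly complex_of_real (char_poly A) = char_poly C"
    unfolding C_def by (rule of_real_hom.char_poly_hom[OF A, symmetric])
  also have "\<dots> = (\<Prod>a\<leftarrow>as. map_poly complex_of_real [:- Re a, 1:])"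
    unfolding as using real_root by (intro arg_cong[of _ _ prod_list] map_cong) auto
  also have "\<dots> = map_poly complex_of_real (\<Prod>e\<leftarrow>map Re as. [:- e, 1:])"
    by (simp add: h.hom_prod_list o_def)
  finally have "char_poly A = (\<Prod>e\<leftarrow>map Re as. [:- e, 1:])" by simp
  then show ?thesis by blast
qed

text \<open>Householder reflection that exchanges \<open>v\<close> and the first unit vector: with
  \<open>w\<close> their difference, the squared norm of \<open>w\<close> is \<open>2 * c\<close>,
  so \<open>H\<close> is the identity minus twice the projection onto \<open>w\<close>. The
  degenerate case \<open>w = 0\<close> is served by the identity.\<close>

lemma unit_vec_reflection:
  fixes v :: "real vec"
  assumes v: "v \<in> carrier_vec n" and n: "0 < n" and unit: "v \<bullet> v = 1"
  obtains H where "H \<in> carrier_mat n n" "H\<^sup>T = H" "H * H = 1\<^sub>m n" "col H 0 = v"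
proof (cases "v = unit_vec n 0")
  case True
  then show ?thesis using that[of "1\<^sub>m n"] n by auto
next
  case False
  define w where "w = (\<lambda>i. v $ i - (if i = 0 then 1 else 0))"
  define c where "c = 1 - v $ 0"
  have vv: "(\<Sum>i<n. (v $ i)\<^sup>2) = 1"
    using unit v by (simp add: scalar_prod_def lessThan_atLeast0 power2_eq_square)
  have split: "(\<Sum>i<n. f i) = f 0 + (\<Sum>i\<in>{1..<n}. f i)" for f :: "nat \<Rightarrow> real"
    using n by (simp add: lessThan_atLeast0 sum.atLeast_Suc_lessThan)
  have rest: "(\<Sum>i\<in>{1..<n}. (v $ i)\<^sup>2) = 1 - (v $ 0)\<^sup>2" using vv split[of "\<lambda>i. (v $ i)\<^sup>2"] by simp
  have w2: "(\<Sum>i<n. (w i)\<^sup>2) = 2 * c"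
    unfolding split w_def c_def using rest
    by (simp add: power2_eq_square algebra_simps)
  have c0: "c \<noteq> 0"
  proof
    assume "c = 0"
    then have "(\<Sum>i<n. (w i)\<^sup>2) = 0" using w2 by simp
    then have "\<forall>i<n. w i = 0" by (simp add: sum_nonneg_eq_0_iff)
    then have "v = unit_vec n 0" using v by (intro eq_vecI) (auto simp: w_def unit_vec_def)
    then show False using False by simp
  qed
  define H where "H = mat n n (\<lambda>(i, j). (if i = j then 1 else 0) - w i * w j / c)"
  have HH: "H * H = 1\<^sub>m n"
  proof (rule eq_matI)
    fix i j assume ij: "i < dim_row (1\<^sub>m n :: real mat)" "j < dim_col (1\<^sub>m n :: real mat)"
    then have "(H * H) $$ (i, j) =
      (\<Sum>k<n. ((if i = k then 1 else 0) - w i * w k / c) * ((if k = j then 1 else 0) - w k * w j / c))"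
      by (simp add: H_def scalar_prod_def lessThan_atLeast0)
    also have "\<dots> = (\<Sum>k<n. (if i = k then (if i = j then 1 else 0) - w i * w j / c else 0)
        - (if k = j then w i * w k / c else 0) + (w i * w j / c\<^sup>2) * (w k)\<^sup>2)"
      by (intro sum.cong refl) (auto simp: power2_eq_square algebra_simps)
    also have "\<dots> = (if i = j then 1 else 0) - w i * w j / c - w i * w j / c + (w i * w j / c\<^sup>2) * (2 * c)"
      using ij by (simp add: sum.distrib sum_subtractf w2[symmetric] sum_distrib_left)
    also have "\<dots> = (if i = j then 1 else 0)" using c0 by (simp add: power2_eq_square)
    finally show "(H * H) $$ (i, j) = 1\<^sub>m n $$ (i, j)" using ij by simp
  qed (auto simp: H_def)
  have "col H 0 = v"
    using v n c0 by (intro eq_vecI) (auto simp: H_def w_def c_def divide_simps algebra_simps)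
  moreover have "H\<^sup>T = H" by (auto simp: H_def intro!: eq_matI)
  ultimately show ?thesis using that[of H] HH by (simp add: H_def)
qed

lemma real_eigenvector_unit:
  fixes A :: "real mat"
  assumes A: "A \<in> carrier_mat n n" and "poly (char_poly A) e = 0"
  obtains v where "v \<in> carrier_vec n" "A *\<^sub>v v = e \<cdot>\<^sub>v v" "v \<bullet> v = 1"
proof -
  have "eigenvalue A e" using eigenvalue_root_char_poly[OF A] assms(2) by simp
  then obtain v where v: "v \<in> carrier_vec n" "v \<noteq> 0\<^sub>v n" "A *\<^sub>v v = e \<cdot>\<^sub>v v"
    unfolding eigenvalue_def eigenvector_def using A by auto
  have pos: "v \<bullet> v > 0"
  proof -
    obtain i where i: "i < n" "v $ i \<noteq> 0" using v by (metis carrier_vecD eq_vecI index_zero_vec)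
    have "v $ i * v $ i \<le> (\<Sum>i<n. v $ i * v $ i)" using i by (intro member_le_sum) auto
    moreover have "0 < v $ i * v $ i" using i by (metis not_real_square_gt_zero)
    ultimately show ?thesis using v by (simp add: scalar_prod_def lessThan_atLeast0)
  qed
  show ?thesis
  proof (rule that[of "(1 / sqrt (v \<bullet> v)) \<cdot>\<^sub>v v"])
    show "A *\<^sub>v ((1 / sqrt (v \<bullet> v)) \<cdot>\<^sub>v v) = e \<cdot>\<^sub>v ((1 / sqrt (v \<bullet> v)) \<cdot>\<^sub>v v)"
      using v A by (simp add: mult_mat_vec smult_smult_assoc mult.commute)
    show "((1 / sqrt (v \<bullet> v)) \<cdot>\<^sub>v v) \<bullet> ((1 / sqrt (v \<bullet> v)) \<cdot>\<^sub>v v) = 1"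
      using v pos by simp
  qed (use v in auto)
qed

text \<open>Deflation: a reflection that takes the first unit vector to an eigenvector for
  \<open>e\<close> makes the conjugated matrix block diagonal, and the induction hypothesis handles
  the remaining block. The diagonal follows the list \<open>es\<close> in the order given, so that a
  sorted list of eigenvalues can be prescribed later.\<close>

theorem spectral_decomposition:
  fixes A :: "real mat"
  assumes "A \<in> carrier_mat n n" and "A\<^sup>T = A"
    and "char_poly A = (\<Prod>e\<leftarrow>es. [:- e, 1:])"
  shows "\<exists>W. W \<in> carrier_mat n n \<and> W\<^sup>T * W = 1\<^sub>m n \<and>
    A = W * mat_diag n (\<lambda>i. es ! i) * W\<^sup>T"
  using assms
proof (induction es arbitrary: n A)
  case Nil
  then have "n = 0" using degree_monic_char_poly[of A n] by simp
  then show ?case using Nil by (intro exI[of _ "1\<^sub>m n"]) (auto intro!: eq_matI)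
next
  case (Cons e es n A)
  have A: "A \<in> carrier_mat n n" by fact
  have "degree (char_poly A) = length (e # es)"
    unfolding Cons.prems(3) by (rule degree_linear_factors)
  then have n: "n = Suc (length es)" using degree_monic_char_poly[OF A] by simp
  define k where "k = length es"
  have nk: "n = Suc k" using n k_def by simp
  have "poly (char_poly A) e = 0" unfolding Cons.prems(3) by simp
  then obtain v where v: "v \<in> carrier_vec n" "A *\<^sub>v v = e \<cdot>\<^sub>v v" "v \<bullet> v = 1"
    using real_eigenvector_unit[OF A] by blast
  obtain H where H: "H \<in> carrier_mat n n" "H\<^sup>T = H" "H * H = 1\<^sub>m n" "col H 0 = v"
    using unit_vec_reflection[OF v(1) _ v(3)] n by blast
  define A' where "A' = H * A * H"
  have A'c: "A' \<in> carrier_mat n n" using A H by (simp add: A'_def)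
  have A'sym: "A'\<^sup>T = A'"
    unfolding A'_def using A H Cons.prems(2)
    by (simp add: transpose_mult[of _ n n _ n] assoc_mult_mat[of _ n n _ n _ n])
  have AH: "A = H * A' * H"
  proof -
    have "H * A' * H = (H * H) * A * (H * H)"
      unfolding A'_def using A H(1) by (simp add: assoc_mult_mat[of _ n n _ n _ n])
    then show ?thesis using A H by simp
  qed
  have col0: "col A' 0 = e \<cdot>\<^sub>v unit_vec n 0"
  proof -
    have "col A' 0 = (H * A) *\<^sub>v col H 0"
      unfolding A'_def using A H n by (intro col_mult2) auto
    also have "\<dots> = H *\<^sub>v (A *\<^sub>v v)" using A H v by (simp add: assoc_mult_mat_vec[of _ n n _ n])
    also have "\<dots> = e \<cdot>\<^sub>v (H *\<^sub>v v)" unfolding v(2) using H v by (simp add: mult_mat_vec)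
    also have "H *\<^sub>v v = col (H * H) 0" unfolding H(4)[symmetric] using n by (intro col_mult2[OF H(1) H(1), symmetric]) auto
    also have "\<dots> = unit_vec n 0" using H n by simp
    finally show ?thesis .
  qed
  have A'0: "A' $$ (i, 0) = (if i = 0 then e else 0)" if "i < n" for i
  proof -
    have "A' $$ (i, 0) = col A' 0 $ i" using that A'c n by simp
    then show ?thesis using that n unfolding col0 by (simp add: unit_vec_def)
  qed
  have A'0': "A' $$ (0, i) = (if i = 0 then e else 0)" if "i < n" for i
  proof -
    have "A' $$ (0, i) = A'\<^sup>T $$ (i, 0)" using that A'c n by simp
    then show ?thesis using A'0[OF that] unfolding A'sym by simp
  qed
  define B where "B = mat k k (\<lambda>(i, j). A' $$ (Suc i, Suc j))"
  have B: "B \<in> carrier_mat k k" by (simp add: B_def)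
  have Bsym: "B\<^sup>T = B"
  proof (rule eq_matI)
    fix i j assume ij: "i < dim_row B" "j < dim_col B"
    then have "A' $$ (Suc j, Suc i) = A'\<^sup>T $$ (Suc i, Suc j)"
      using A'c nk by (simp add: B_def)
    then show "B\<^sup>T $$ (i, j) = B $$ (i, j)" using ij unfolding A'sym by (simp add: B_def)
  qed (auto simp: B_def)
  define E where "E = mat 1 1 (\<lambda>_. e)"
  have E: "E \<in> carrier_mat 1 1" by (simp add: E_def)
  \<comment> \<open>The first column of \<open>A'\<close> is known because \<open>H\<close> maps the
    first unit vector to \<open>v\<close> and back; symmetry then clears the first row as
    well.\<close>
  have A'blk: "A' = four_block_mat E (0\<^sub>m 1 k) (0\<^sub>m k 1) B"
    using A'c nk A'0 A'0' by (intro eq_matI) (auto simp: B_def E_def)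
  have "similar_mat A A'"
    unfolding similar_mat_def similar_mat_wit_def
    using A A'c H AH by (intro exI[of _ H]) (auto simp: Let_def)
  then have "char_poly A' = [:- e, 1:] * (\<Prod>e\<leftarrow>es. [:- e, 1:])"
    using char_poly_similar Cons.prems(3) by fastforce
  moreover have "char_poly A' = char_poly E * char_poly B"
    unfolding A'blk by (rule char_poly_four_block_zeros_col[OF E _ B]) auto
  moreover have "char_poly E = [:- e, 1:]"
    using char_poly_upper_triangular[OF E] by (auto simp: E_def diag_mat_def upper_triangular_def)
  ultimately have "char_poly B = (\<Prod>e\<leftarrow>es. [:- e, 1:])"
    by (metis mult_left_cancel one_neq_zero pCons_eq_0_iff)
  then obtain W where W: "W \<in> carrier_mat k k" "W\<^sup>T * W = 1\<^sub>m k"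
    "B = W * mat_diag k (\<lambda>i. es ! i) * W\<^sup>T"
    using Cons.IH[OF B Bsym] by blast
  define V where "V = four_block_mat (1\<^sub>m 1) (0\<^sub>m 1 k) (0\<^sub>m k 1) W"
  have V: "V \<in> carrier_mat n n" using four_block_carrier_mat[OF one_carrier_mat W(1), of 1] nk by (simp add: V_def)
  have Vt: "V\<^sup>T = four_block_mat (1\<^sub>m 1) (0\<^sub>m 1 k) (0\<^sub>m k 1) (W\<^sup>T)"
    unfolding V_def using W by (subst transpose_four_block_mat) auto
  have VV: "V\<^sup>T * V = 1\<^sub>m n"
    unfolding Vt unfolding V_def using W nk
    by (subst mult_four_block_mat[of _ 1 1 _ k _ k _ _ 1 _ k]) (auto intro!: eq_matI)
  have D: "mat_diag n (\<lambda>i. (e # es) ! i) = four_block_mat E (0\<^sub>m 1 k) (0\<^sub>m k 1) (mat_diag k (\<lambda>i. es ! i))"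
    using nk by (intro eq_matI) (auto simp: mat_diag_def E_def nth_Cons')
  have VDV: "A' = V * mat_diag n (\<lambda>i. (e # es) ! i) * V\<^sup>T"
  proof -
    define K where "K = mat_diag k (\<lambda>i. es ! i)"
    have K: "K \<in> carrier_mat k k" by (simp add: K_def)
    have WK: "W * K \<in> carrier_mat k k" using W(1) K by simp
    have Wt: "W\<^sup>T \<in> carrier_mat k k" using W(1) by simp
    have "V * four_block_mat E (0\<^sub>m 1 k) (0\<^sub>m k 1) K = four_block_mat E (0\<^sub>m 1 k) (0\<^sub>m k 1) (W * K)"
      unfolding V_def using W(1) E K WK
      by (subst mult_four_block_mat[OF one_carrier_mat zero_carrier_mat zero_carrier_mat W(1)
            E zero_carrier_mat zero_carrier_mat K]) (simp add: left_mult_zero_mat[OF K])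
    also have "\<dots> * V\<^sup>T = four_block_mat E (0\<^sub>m 1 k) (0\<^sub>m k 1) (W * K * W\<^sup>T)"
      unfolding Vt using E WK Wt mult_carrier_mat[OF WK Wt]
      by (subst mult_four_block_mat[OF E zero_carrier_mat zero_carrier_mat WK
            one_carrier_mat zero_carrier_mat zero_carrier_mat Wt])
        (simp add: left_mult_zero_mat[OF Wt] right_mult_zero_mat[OF WK] right_mult_zero_mat[OF E])
    finally show ?thesis unfolding A'blk D K_def[symmetric] using W(3) by (simp add: K_def)
  qed
  show ?case
  proof (intro exI[of _ "H * V"] conjI)
    show "H * V \<in> carrier_mat n n" using H V by simp
    have T: "(H * V)\<^sup>T = V\<^sup>T * H"
      using H V by (simp add: transpose_mult[of _ n n _ n])
    have "(H * V)\<^sup>T * (H * V) = V\<^sup>T * (H * H) * V"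
      unfolding T using H(1) V by (simp add: assoc_mult_mat[of _ n n _ n _ n])
    then show "(H * V)\<^sup>T * (H * V) = 1\<^sub>m n" using H(3) V VV by simp
    define K where "K = mat_diag n (\<lambda>i. (e # es) ! i)"
    have K: "K \<in> carrier_mat n n" by (simp add: K_def)
    have "A = H * V * K * (H * V)\<^sup>T"
      unfolding T unfolding AH VDV K_def[symmetric] using H(1) V K
      by (simp add: assoc_mult_mat[of _ n n _ n _ n])
    then show "A = H * V * mat_diag n (\<lambda>i. (e # es) ! i) * (H * V)\<^sup>T"
      unfolding K_def .
  qed
qed

section \<open>Frobenius inner product\<close>

text \<open>Equations between dimensions contain no free sizes, unlike carrier hypotheses, so the
  simplifier can discharge them when these rules are used for rewriting.\<close>

lemma mult_assoc_dim:
  fixes A :: "real mat"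
  shows "dim_col A = dim_row B \<Longrightarrow> dim_col B = dim_row C \<Longrightarrow> A * B * C = A * (B * C)"
  by (rule assoc_mult_mat[of A "dim_row A" "dim_col A" B "dim_col B" C "dim_col C"]) auto

lemma transpose_mult_dim:
  fixes A :: "real mat"
  shows "dim_col A = dim_row B \<Longrightarrow>
    (A * B)\<^sup>T = B\<^sup>T * A\<^sup>T"
  by (rule transpose_mult[of A "dim_row A" "dim_col A" B "dim_col B"]) auto

lemma mult_cancel_dim:
  fixes A :: "real mat"
  shows "A * B = 1\<^sub>m n \<Longrightarrow> dim_col A = dim_row B \<Longrightarrow> dim_col B = dim_row C \<Longrightarrow> dim_row C = n \<Longrightarrow>
    A * (B * C) = C"
  by (subst mult_assoc_dim[symmetric]) auto

lemma dim_mat_diag [simp]: "dim_row (mat_diag n f) = n" "dim_col (mat_diag n f) = n"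
  by (auto simp: mat_diag_def)

text \<open>The Frobenius inner product, that is, the trace of the transpose of \<open>A\<close>
  times \<open>B\<close>; the index ranges are read off the first argument.\<close>

definition minner :: "real mat \<Rightarrow> real mat \<Rightarrow> real" where
  "minner A B = (\<Sum>i<dim_row A. \<Sum>j<dim_col A. A $$ (i, j) * B $$ (i, j))"

lemma minner_comm:
  "A \<in> carrier_mat n m \<Longrightarrow> B \<in> carrier_mat n m \<Longrightarrow> minner A B = minner B A"
  by (auto simp: minner_def mult.commute)

lemma minner_add_left:
  "A \<in> carrier_mat n m \<Longrightarrow> B \<in> carrier_mat n m \<Longrightarrow> C \<in> carrier_mat n m \<Longrightarrow>
    minner (A + B) C = minner A C + minner B C"
  by (auto simp: minner_def algebra_simps sum.distrib)

lemma minner_diff_left: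
  "A \<in> carrier_mat n m \<Longrightarrow> B \<in> carrier_mat n m \<Longrightarrow> C \<in> carrier_mat n m \<Longrightarrow>
    minner (A - B) C = minner A C - minner B C"
  by (auto simp: minner_def algebra_simps sum_subtractf)

lemma minner_add_right:
  "A \<in> carrier_mat n m \<Longrightarrow> B \<in> carrier_mat n m \<Longrightarrow> C \<in> carrier_mat n m \<Longrightarrow>
    minner C (A + B) = minner C A + minner C B"
  by (auto simp: minner_def algebra_simps sum.distrib)

lemma minner_diff_right:
  "A \<in> carrier_mat n m \<Longrightarrow> B \<in> carrier_mat n m \<Longrightarrow> C \<in> carrier_mat n m \<Longrightarrow>
    minner C (A - B) = minner C A - minner C B"
  by (auto simp: minner_def algebra_simps sum_subtractf)

lemma minner_smult_left: "minner (c \<cdot>\<^sub>m A) B = c * minner A B"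
  by (auto simp: minner_def sum_distrib_left mult.assoc)

lemma minner_smult_right:
  "A \<in> carrier_mat n m \<Longrightarrow> B \<in> carrier_mat n m \<Longrightarrow> minner A (c \<cdot>\<^sub>m B) = c * minner A B"
  by (auto simp: minner_def sum_distrib_left mult_ac)

lemma minner_transpose:
  "A \<in> carrier_mat n m \<Longrightarrow> B \<in> carrier_mat n m \<Longrightarrow>
    minner (A\<^sup>T) (B\<^sup>T) = minner A B"
  by (auto simp: minner_def intro: sum.swap)

lemma minner_self_nonneg: "0 \<le> minner A A"
  by (auto simp: minner_def intro!: sum_nonneg)

lemma minner_self_eq_0:
  assumes "A \<in> carrier_mat n m" "minner A A = 0"
  shows "A = 0\<^sub>m n m"
proof -
  have "\<forall>i<n. (\<Sum>j<m. A $$ (i, j) * A $$ (i, j)) = 0"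
    using assms by (simp add: minner_def sum_nonneg_eq_0_iff sum_nonneg)
  then have "\<forall>i<n. \<forall>j<m. A $$ (i, j) = 0"
    by (simp add: sum_nonneg_eq_0_iff)
  then show ?thesis using assms by (intro eq_matI) auto
qed

lemma minner_mult_left:
  assumes "A \<in> carrier_mat n k" "B \<in> carrier_mat k m" "C \<in> carrier_mat n m"
  shows "minner (A * B) C = minner B (A\<^sup>T * C)"
proof -
  have "minner (A * B) C = (\<Sum>i<n. \<Sum>j<m. \<Sum>l<k. A $$ (i, l) * B $$ (l, j) * C $$ (i, j))"
    using assms by (auto simp: minner_def scalar_prod_def sum_distrib_right lessThan_atLeast0
        intro!: sum.cong)
  also have "\<dots> = (\<Sum>i<n. \<Sum>l<k. \<Sum>j<m. A $$ (i, l) * B $$ (l, j) * C $$ (i, j))"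
    by (intro sum.cong refl sum.swap)
  also have "\<dots> = (\<Sum>l<k. \<Sum>i<n. \<Sum>j<m. A $$ (i, l) * B $$ (l, j) * C $$ (i, j))"
    by (rule sum.swap)
  also have "\<dots> = (\<Sum>l<k. \<Sum>j<m. \<Sum>i<n. A $$ (i, l) * B $$ (l, j) * C $$ (i, j))"
    by (intro sum.cong refl sum.swap)
  also have "\<dots> = minner B (A\<^sup>T * C)"
    using assms by (auto simp: minner_def scalar_prod_def sum_distrib_left lessThan_atLeast0 mult_ac
        intro!: sum.cong)
  finally show ?thesis .
qed

lemma minner_mult_right:
  assumes "A \<in> carrier_mat n k" "B \<in> carrier_mat k m" "C \<in> carrier_mat n m"
  shows "minner (A * B) C = minner A (C * B\<^sup>T)"
proof -
  have "minner (A * B) C = minner ((A * B)\<^sup>T) (C\<^sup>T)"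
    using assms by (intro minner_transpose[symmetric]) auto
  also have "\<dots> = minner (B\<^sup>T * A\<^sup>T) (C\<^sup>T)"
    using assms by (simp add: transpose_mult_dim)
  also have "\<dots> = minner (A\<^sup>T) (B * C\<^sup>T)"
    using assms by (subst minner_mult_left[of _ m k _ n]) auto
  also have "B * C\<^sup>T = (C * B\<^sup>T)\<^sup>T"
    using assms by (simp add: transpose_mult_dim)
  also have "minner (A\<^sup>T) \<dots> = minner A (C * B\<^sup>T)"
    using assms by (intro minner_transpose) auto
  finally show ?thesis .
qed

lemma minner_isometry:
  assumes "L \<in> carrier_mat n k" "L\<^sup>T * L = 1\<^sub>m k"
    "A \<in> carrier_mat k m" "B \<in> carrier_mat k m"
  shows "minner (L * A) (L * B) = minner A B"
proof -
  have "minner (L * A) (L * B) = minner A (L\<^sup>T * (L * B))"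
    using assms by (intro minner_mult_left) auto
  also have "L\<^sup>T * (L * B) = B"
    using assms by (intro mult_cancel_dim[OF assms(2)]) auto
  finally show ?thesis .
qed

lemma minner_diff_sq:
  assumes "A \<in> carrier_mat n m" "B \<in> carrier_mat n m"
  shows "minner (A - B) (A - B) = minner A A - 2 * minner A B + minner B B"
  using assms by (simp add: minner_diff_left[of _ n m] minner_diff_right[of _ n m] minner_smult_left minner_smult_right[of _ n m] minner_comm[of B n m A] minus_carrier_mat[OF assms(2)])

lemma minner_le_mean:
  assumes "A \<in> carrier_mat n m" "B \<in> carrier_mat n m"
  shows "2 * minner A B \<le> minner A A + minner B B"
  using minner_diff_sq[OF assms] minner_self_nonneg[of "A - B"] by simp

lemma fro_norm_sq: "(fro_norm A)\<^sup>2 = minner A A"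
  unfolding fro_norm_def minner_def
  by (subst real_sqrt_pow2) (auto intro!: sum_nonneg simp: power2_eq_square)

lemma minner_Cauchy_Schwarz:
  assumes "A \<in> carrier_mat n m" "B \<in> carrier_mat n m"
  shows "(minner A B)\<^sup>2 \<le> minner A A * minner B B"
proof (cases "minner B B = 0")
  case True
  then have "B = 0\<^sub>m n m" using minner_self_eq_0 assms by blast
  then have "minner A B = 0" using assms by (simp add: minner_def)
  then show ?thesis using True by simp
next
  case False
  define t where "t = minner A B / minner B B"
  have "0 \<le> minner (A - t \<cdot>\<^sub>m B) (A - t \<cdot>\<^sub>m B)" by (rule minner_self_nonneg)
  also have "\<dots> = minner A A - 2 * (t * minner A B) + t * (t * minner B B)"
    using assms by (subst minner_diff_sq[of _ n m]) (auto simp: minner_diff_left[of _ n m] minner_diff_right[of _ n m] minner_smult_left minner_smult_right[of _ n m])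
  also have "\<dots> = minner A A - (minner A B)\<^sup>2 / minner B B"
    using False by (simp add: t_def power2_eq_square)
  finally show ?thesis
    using False minner_self_nonneg[of B] by (simp add: divide_simps split: if_splits)
qed

section \<open>Functions of symmetric matrices and the polar factor\<close>

lemma orthogonal_mat_right:
  fixes W :: "real mat"
  assumes "W \<in> carrier_mat n n" "W\<^sup>T * W = 1\<^sub>m n"
  shows "W * W\<^sup>T = 1\<^sub>m n"
  using mat_mult_left_right_inverse[OF _ assms(1) assms(2)] assms(1) by simp

lemma transpose_mat_diag [simp]: "(mat_diag n f)\<^sup>T = mat_diag n f"
  by (intro eq_matI) (auto simp: mat_diag_def)

text \<open>In a fixed eigenbasis \<open>W\<close>, functions of a symmetric matrix multiply
  pointwise. Square roots, inverses and inverse square roots below are all obtained from this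
  rule.\<close>

lemma spectral_function_mult:
  fixes W :: "real mat"
  assumes "W \<in> carrier_mat n n" "W\<^sup>T * W = 1\<^sub>m n"
  shows "(W * mat_diag n f * W\<^sup>T) * (W * mat_diag n g * W\<^sup>T) =
    W * mat_diag n (\<lambda>i. f i * g i) * W\<^sup>T"
proof -
  have "(W * mat_diag n f * W\<^sup>T) * (W * mat_diag n g * W\<^sup>T) =
    W * (mat_diag n f * ((W\<^sup>T * W) * (mat_diag n g * W\<^sup>T)))"
    using assms(1) by (simp add: mult_assoc_dim)
  also have "\<dots> = W * ((mat_diag n f * mat_diag n g) * W\<^sup>T)"
    unfolding assms(2) using assms(1) by (simp add: mult_assoc_dim del: mat_diag_diag)
  finally show ?thesis using assms(1) by (simp add: mult_assoc_dim)
qed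

lemma spectral_function_sym:
  fixes W :: "real mat"
  assumes "W \<in> carrier_mat n n"
  shows "(W * mat_diag n f * W\<^sup>T)\<^sup>T = W * mat_diag n f * W\<^sup>T"
  using assms by (simp add: transpose_mult_dim mult_assoc_dim)

lemma minner_mat_diag:
  fixes f :: "nat \<Rightarrow> real"
  assumes "X \<in> carrier_mat n c"
  shows "minner X (mat_diag n f * X) = (\<Sum>i<n. f i * (\<Sum>j<c. (X $$ (i, j))\<^sup>2))"
  using assms by (auto simp: minner_def mat_diag_mult_left sum_distrib_left power2_eq_square mult_ac
      intro!: sum.cong)

lemma spectral_form:
  fixes W :: "real mat"
  assumes W: "W \<in> carrier_mat n n" and X: "X \<in> carrier_mat n c"
  shows "minner X ((W * mat_diag n f * W\<^sup>T) * X) =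
    (\<Sum>i<n. f i * (\<Sum>j<c. ((W\<^sup>T * X) $$ (i, j))\<^sup>2))"
proof -
  have "minner X ((W * mat_diag n f * W\<^sup>T) * X) =
    minner X (W * (mat_diag n f * (W\<^sup>T * X)))"
    using W X by (simp add: mult_assoc_dim)
  also have "\<dots> = minner (W * (mat_diag n f * (W\<^sup>T * X))) X"
    using W X by (intro minner_comm[of _ n c]) auto
  also have "\<dots> = minner (mat_diag n f * (W\<^sup>T * X)) (W\<^sup>T * X)"
    using W X by (intro minner_mult_left) auto
  also have "\<dots> = minner (W\<^sup>T * X) (mat_diag n f * (W\<^sup>T * X))"
    using W X by (intro minner_comm[of _ n c]) auto
  finally show ?thesis using W X by (simp add: minner_mat_diag[of _ n c])
qed

text \<open>The pairing is the sum of the quadratic form of \<open>S\<close> over the columns of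
  \<open>D\<close>; this transfers positive definiteness from vectors to matrices.\<close>

lemma minner_pos_def:
  assumes S: "pos_def_mat S" "S \<in> carrier_mat n n" and D: "D \<in> carrier_mat n m"
  shows "0 \<le> minner D (S * D)" and "minner D (S * D) = 0 \<Longrightarrow> D = 0\<^sub>m n m"
proof -
  have eq: "minner D (S * D) = (\<Sum>j<m. col D j \<bullet> (S *\<^sub>v col D j))"
    unfolding minner_def using S D by (subst sum.swap) (auto simp: scalar_prod_def lessThan_atLeast0 intro!: sum.cong)
  have pos: "0 \<le> col D j \<bullet> (S *\<^sub>v col D j) \<and>
    (col D j \<bullet> (S *\<^sub>v col D j) = 0 \<longrightarrow> col D j = 0\<^sub>v n)" if "j < m" for j
  proof (cases "col D j = 0\<^sub>v n")
    case True
    then show ?thesis using S D that by simp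
  next
    case False
    then have "0 < col D j \<bullet> (S *\<^sub>v col D j)" using S D that by (auto simp: pos_def_mat_def)
    then show ?thesis by simp
  qed
  show "0 \<le> minner D (S * D)" unfolding eq using pos by (auto intro: sum_nonneg)
  assume "minner D (S * D) = 0"
  then have "\<forall>j<m. col D j \<bullet> (S *\<^sub>v col D j) = 0"
    unfolding eq using pos by (subst (asm) sum_nonneg_eq_0_iff) auto
  then have "\<forall>j<m. col D j = 0\<^sub>v n" using pos by blast
  then show "D = 0\<^sub>m n m" using D by (intro eq_matI) (auto simp: vec_eq_iff)
qed

text \<open>With \<open>D = S - T\<close>, the equation \<open>S\<^sup>2 = T\<^sup>2\<close> becomes \<open>S D + D T = 0\<close>, and pairing it with
  \<open>D\<close> gives a sum of two nonnegative terms.\<close>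

lemma pos_def_sqrt_unique:
  assumes S: "pos_def_mat S" "S \<in> carrier_mat n n" and T: "pos_def_mat T" "T \<in> carrier_mat n n"
    and eq: "S * S = T * T"
  shows "S = T"
proof -
  define D where "D = S - T"
  have D: "D \<in> carrier_mat n n" using minus_carrier_mat[OF T(2)] by (simp add: D_def)
  have Tt: "T\<^sup>T = T" using T by (simp add: pos_def_mat_def)
  have DT: "D * T = S * T - T * T" unfolding D_def by (rule minus_mult_distrib_mat[OF S(2) T(2) T(2)])
  have SD: "S * D = S * S - S * T" unfolding D_def by (rule mult_minus_distrib_mat[OF S(2) S(2) T(2)])
  have SS: "S * S \<in> carrier_mat n n" "S * T \<in> carrier_mat n n" "T * T \<in> carrier_mat n n"
    using S T by auto
  have "minner D (S * D) + minner D (D * T) = 0"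
    unfolding DT SD using D SS eq by (simp add: minner_diff_right[of _ n n])
  moreover have "minner D (D * T) = minner (D\<^sup>T) (T * D\<^sup>T)"
    using minner_transpose[of D n n "D * T"] D T(2) Tt by (simp add: transpose_mult_dim)
  ultimately have "minner D (S * D) = 0"
    using minner_pos_def(1)[OF S D] minner_pos_def(1)[OF T, of "D\<^sup>T" n] D by simp
  then have "D = 0\<^sub>m n n" using minner_pos_def(2)[OF S D] by simp
  then have "\<forall>i<n. \<forall>j<n. D $$ (i, j) = 0" by simp
  then show ?thesis using S T by (intro eq_matI) (auto simp: D_def)
qed

lemma pos_def_spectral:
  fixes W :: "real mat"
  assumes W: "W \<in> carrier_mat n n" "W\<^sup>T * W = 1\<^sub>m n" and f: "\<And>i. i < n \<Longrightarrow> 0 < f i"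
  shows "pos_def_mat (W * mat_diag n f * W\<^sup>T)" (is "pos_def_mat ?S")
proof -
  have S: "?S \<in> carrier_mat n n" using W by auto
  have "0 < x \<bullet> (?S *\<^sub>v x)" if x: "x \<in> carrier_vec n" "x \<noteq> 0\<^sub>v n" for x
  proof -
    define y where "y = W\<^sup>T *\<^sub>v x"
    have y: "y \<in> carrier_vec n" using W x by (simp add: y_def)
    have Wy: "W *\<^sub>v y = x"
      using W x orthogonal_mat_right[OF W]
      by (simp add: y_def assoc_mult_mat_vec[of _ n n _ n, symmetric])
    have "y \<noteq> 0\<^sub>v n" using Wy x W by auto
    then obtain i where i: "i < n" "y $ i \<noteq> 0" using y by (metis carrier_vecD eq_vecI index_zero_vec)
    have "?S *\<^sub>v x = W *\<^sub>v (mat_diag n f *\<^sub>v y)"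
      using W x by (simp add: y_def assoc_mult_mat_vec[of _ n n _ n])
    then have "x \<bullet> (?S *\<^sub>v x) = (W *\<^sub>v (mat_diag n f *\<^sub>v y)) \<bullet> x"
      using W x y comm_scalar_prod[of x n "W *\<^sub>v (mat_diag n f *\<^sub>v y)"]
      by (simp add: mult_mat_vec_carrier[OF mat_diag_dim])
    also have "\<dots> = (mat_diag n f *\<^sub>v y) \<bullet> (W\<^sup>T *\<^sub>v x)"
      using transpose_vec_mult_scalar[OF W(1) mult_mat_vec_carrier[OF mat_diag_dim y] x(1)] W(1) x y
      by (simp add: comm_scalar_prod[of _ n] mult_mat_vec_carrier[OF mat_diag_dim])
    also have "\<dots> = (\<Sum>i<n. f i * (y $ i)\<^sup>2)"
    proof -
      have "(mat_diag n f *\<^sub>v y) $ i = f i * y $ i" if "i < n" for i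
        using that y by (simp add: mat_diag_def scalar_prod_def if_distrib[of "\<lambda>z. z * _"] cong: if_cong)
      then show ?thesis unfolding y_def[symmetric] using y
        by (auto simp: scalar_prod_def lessThan_atLeast0 power2_eq_square intro!: sum.cong)
    qed
    also have "\<dots> > 0"
      using i f by (intro sum_pos2[of _ i]) (auto simp: less_imp_le)
    finally show ?thesis .
  qed
  then show ?thesis using S W by (auto simp: pos_def_mat_def spectral_function_sym)
qed

text \<open>The definite description in \<open>mat_inv_sqrt\<close> can only be evaluated with
  uniqueness: two candidates both square to the inverse of the matrix, and positive definite square
  roots are unique.\<close>

lemma mat_inv_sqrt_spectral:
  fixes W :: "real mat"
  assumes W: "W \<in> carrier_mat n n" "W\<^sup>T * W = 1\<^sub>m n" and f: "\<And>i. i < n \<Longrightarrow> 0 < f i"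
  shows "mat_inv_sqrt (W * mat_diag n f * W\<^sup>T) =
    W * mat_diag n (\<lambda>i. 1 / sqrt (f i)) * W\<^sup>T" (is "mat_inv_sqrt ?M = ?S")
proof -
  have M: "?M \<in> carrier_mat n n" and S: "?S \<in> carrier_mat n n" using W by auto
  have diag1: "mat_diag n (\<lambda>i. (1 / sqrt (f i) * (1 / sqrt (f i))) * f i) = 1\<^sub>m n"
    using f by (intro eq_matI) (auto simp: mat_diag_def less_imp_neq[symmetric] less_imp_le)
  have SSM: "?S * ?S * ?M = 1\<^sub>m n"
    unfolding spectral_function_mult[OF W] diag1 using W orthogonal_mat_right[OF W] by simp
  have posS: "pos_def_mat ?S" using f by (intro pos_def_spectral W) auto
  have MSS: "?M * (?S * ?S) = 1\<^sub>m n"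
    using mat_mult_left_right_inverse[OF _ M SSM] S by simp
  show ?thesis unfolding mat_inv_sqrt_def
  proof (rule the_equality)
    show "?S \<in> carrier_mat (dim_row ?M) (dim_row ?M) \<and> pos_def_mat ?S \<and> inverts_mat (?S * ?S) ?M"
      using S M posS SSM W by (auto simp: inverts_mat_def)
    fix T assume "T \<in> carrier_mat (dim_row ?M) (dim_row ?M) \<and> pos_def_mat T \<and> inverts_mat (T * T) ?M"
    then have T: "T \<in> carrier_mat n n" "pos_def_mat T" "T * T * ?M = 1\<^sub>m n"
      using M W by (auto simp: inverts_mat_def)
    have "T * T = T * T * (?M * (?S * ?S))" unfolding MSS using T by simp
    also have "\<dots> = (T * T * ?M) * (?S * ?S)"
      using T(1) W(1) by (simp add: mult_assoc_dim)
    also have "\<dots> = ?S * ?S" unfolding T(3) by (rule left_mult_one_mat[OF mult_carrier_mat[OF S S]])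
    finally show "T = ?S" by (intro pos_def_sqrt_unique[of T n]) (use T S posS in auto)
  qed
qed

text \<open>Polar decomposition: the retraction is the orthonormal factor of \<open>G\<close>, and
  the symmetric factor is the square root of its Gram matrix.\<close>

lemma polar_retr_spectral:
  fixes W :: "real mat"
  assumes G: "G \<in> carrier_mat p n" and W: "W \<in> carrier_mat n n" "W\<^sup>T * W = 1\<^sub>m n"
    and f: "\<And>i. i < n \<Longrightarrow> 0 < f i"
    and GG: "G\<^sup>T * G = W * mat_diag n f * W\<^sup>T"
  shows "polar_retr G \<in> carrier_mat p n"
    and "(polar_retr G)\<^sup>T * polar_retr G = 1\<^sub>m n"
    and "G = polar_retr G * (W * mat_diag n (\<lambda>i. sqrt (f i)) * W\<^sup>T)"
proof -
  define Q where "Q = W * mat_diag n (\<lambda>i. 1 / sqrt (f i)) * W\<^sup>T"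
  define H where "H = W * mat_diag n (\<lambda>i. sqrt (f i)) * W\<^sup>T"
  have Qc: "Q \<in> carrier_mat n n" and Hc: "H \<in> carrier_mat n n" using W by (auto simp: Q_def H_def)
  have polar: "polar_retr G = G * Q"
    unfolding polar_retr_def GG Q_def using mat_inv_sqrt_spectral[OF W f] by simp
  show "polar_retr G \<in> carrier_mat p n" unfolding polar using G Qc by simp
  have QH: "Q * H = 1\<^sub>m n"
  proof -
    have "mat_diag n (\<lambda>i. 1 / sqrt (f i) * sqrt (f i)) = 1\<^sub>m n"
      using f by (intro eq_matI) (auto simp: mat_diag_def less_imp_neq[symmetric] less_imp_le)
    then show ?thesis unfolding Q_def H_def spectral_function_mult[OF W]
      using W orthogonal_mat_right[OF W] by simp
  qed
  show "G = polar_retr G * (W * mat_diag n (\<lambda>i. sqrt (f i)) * W\<^sup>T)"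
    unfolding polar H_def[symmetric] using G Qc Hc QH by (simp add: mult_assoc_dim)
  have Qt: "Q\<^sup>T = Q" unfolding Q_def by (rule spectral_function_sym[OF W(1)])
  have "(G * Q)\<^sup>T * (G * Q) = Q * ((G\<^sup>T * G) * Q)"
    using G Qc Qt by (simp add: transpose_mult_dim mult_assoc_dim)
  also have "\<dots> = W * mat_diag n (\<lambda>i. 1 / sqrt (f i) * (f i * (1 / sqrt (f i)))) * W\<^sup>T"
    unfolding GG Q_def spectral_function_mult[OF W] ..
  also have "mat_diag n (\<lambda>i. 1 / sqrt (f i) * (f i * (1 / sqrt (f i)))) = 1\<^sub>m n"
    using f by (intro eq_matI) (auto simp: mat_diag_def less_imp_neq[symmetric] less_imp_le)
  also have "W * 1\<^sub>m n * W\<^sup>T = 1\<^sub>m n" using W orthogonal_mat_right[OF W] by simp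
  finally show "(polar_retr G)\<^sup>T * polar_retr G = 1\<^sub>m n" unfolding polar .
qed

lemma symmetric_spectral:
  fixes A :: "real mat"
  assumes "A \<in> carrier_mat n n" and "A\<^sup>T = A"
  obtains W f where "W \<in> carrier_mat n n" "W\<^sup>T * W = 1\<^sub>m n"
    "A = W * mat_diag n f * W\<^sup>T"
  using symmetric_char_poly_splits[OF assms] spectral_decomposition[OF assms] by blast

text \<open>An eigenvalue of a Gram matrix is the squared length of the image of its eigenvector. It
  is therefore nonnegative, and it vanishes only if that image does.\<close>

lemma gram_spectrum:
  fixes W :: "real mat"
  assumes G: "G \<in> carrier_mat p n" and W: "W \<in> carrier_mat n n" "W\<^sup>T * W = 1\<^sub>m n"
    and GG: "G\<^sup>T * G = W * mat_diag n f * W\<^sup>T" and i: "i < n"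
  shows "f i = (\<Sum>j<p. ((G * W) $$ (j, i))\<^sup>2)"
proof -
  have "(G * W)\<^sup>T * (G * W) = W\<^sup>T * (G\<^sup>T * G) * W"
    using G W by (simp add: transpose_mult_dim mult_assoc_dim)
  also have "\<dots> = (W\<^sup>T * W) * (mat_diag n f * (W\<^sup>T * W))"
    unfolding GG using W(1) by (simp add: mult_assoc_dim)
  also have "\<dots> = mat_diag n f" unfolding W(2) using mat_diag_dim[of n f] by simp
  finally have "f i = ((G * W)\<^sup>T * (G * W)) $$ (i, i)" using i by (simp add: mat_diag_def)
  also have "\<dots> = (\<Sum>j<p. ((G * W) $$ (j, i))\<^sup>2)"
    using G W i by (simp add: scalar_prod_def lessThan_atLeast0 power2_eq_square)
  finally show ?thesis .
qed

text \<open>Write \<open>G = Q H\<close> with \<open>H = (G\<^sup>T G)\<^sup>1\<^sup>/\<^sup>2\<close> and \<open>H - I = C C\<^sup>T\<close>. Then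
  \<open>\<langle>Q (H - I), Z\<rangle> = \<langle>Q C, Z C\<rangle> \<le> \<parallel>C\<parallel>\<^sup>2 = tr (H - I)\<close>, and what remains is
  \<open>\<parallel>H - I\<parallel>\<^sup>2 \<ge> 0\<close>.\<close>

lemma polar_retr_nonexpansive:
  assumes G: "G \<in> carrier_mat p n" and Y: "Y \<in> carrier_mat p n"
    and GG: "G\<^sup>T * G = 1\<^sub>m n + Y\<^sup>T * Y"
    and Z: "Z \<in> carrier_mat p n" "Z\<^sup>T * Z = 1\<^sub>m n"
  shows "polar_retr G \<in> carrier_mat p n"
    and "(polar_retr G)\<^sup>T * polar_retr G = 1\<^sub>m n"
    and "minner (polar_retr G - Z) (polar_retr G - Z) \<le> minner (G - Z) (G - Z)"
proof -
  have "(G\<^sup>T * G)\<^sup>T = G\<^sup>T * G"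
    using G by (simp add: transpose_mult_dim)
  then obtain W f where W: "W \<in> carrier_mat n n" "W\<^sup>T * W = 1\<^sub>m n"
    and eq: "G\<^sup>T * G = W * mat_diag n f * W\<^sup>T"
    using symmetric_spectral[of "G\<^sup>T * G" n] G by auto
  \<comment> \<open>The matrix \<open>Y\<close> has a Gram matrix diagonalised by the same
    \<open>W\<close>, with eigenvalues \<open>f i - 1\<close>. Hence \<open>f i\<close> is at least
    1, which makes the nested root in \<open>C\<close> below meaningful.\<close>
  have YY: "Y\<^sup>T * Y = W * mat_diag n (\<lambda>i. f i - 1) * W\<^sup>T"
  proof -
    have "mat_diag n (\<lambda>i. f i - 1) = mat_diag n f - 1\<^sub>m n"
      by (intro eq_matI) (auto simp: mat_diag_def)
    then have "W * mat_diag n (\<lambda>i. f i - 1) * W\<^sup>T =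
      W * mat_diag n f * W\<^sup>T - W * 1\<^sub>m n * W\<^sup>T"
      using W mat_diag_dim[of n f]
      by (simp add: mult_minus_distrib_mat[of _ n n _ n] minus_mult_distrib_mat[of _ n n _ _ n])
    also have "\<dots> = 1\<^sub>m n + Y\<^sup>T * Y - 1\<^sub>m n"
      unfolding eq[symmetric] GG using W orthogonal_mat_right[OF W] by simp
    also have "\<dots> = Y\<^sup>T * Y" using Y by (intro eq_matI) auto
    finally show ?thesis by simp
  qed
  have f1: "1 \<le> f i" if "i < n" for i
    proof -
    have "0 \<le> f i - 1" unfolding gram_spectrum[OF Y W YY that] by (intro sum_nonneg) auto
    then show ?thesis by simp
  qed
  have f0: "0 < f i" if "i < n" for i using f1[OF that] by simp
  note polar = polar_retr_spectral[OF G W f0 eq]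
  show Qc: "polar_retr G \<in> carrier_mat p n" by (rule polar)
  show QQ: "(polar_retr G)\<^sup>T * polar_retr G = 1\<^sub>m n" by (rule polar)
  define Q where "Q = polar_retr G"
  define H where "H = W * mat_diag n (\<lambda>i. sqrt (f i)) * W\<^sup>T"
  define C where "C = W * mat_diag n (\<lambda>i. sqrt (sqrt (f i) - 1)) * W\<^sup>T"
  have H: "H \<in> carrier_mat n n" and C: "C \<in> carrier_mat n n" using W by (auto simp: H_def C_def)
  have Q: "Q \<in> carrier_mat p n" using Qc by (simp add: Q_def)
  have Q2: "Q\<^sup>T * Q = 1\<^sub>m n" using QQ by (simp add: Q_def)
  have GQH: "G = Q * H" unfolding Q_def H_def by (rule polar)
  have Ct: "C\<^sup>T = C" unfolding C_def by (rule spectral_function_sym[OF W(1)])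
  have CC: "C * C\<^sup>T = H - 1\<^sub>m n"
  proof -
    have "mat_diag n (\<lambda>i. sqrt (sqrt (f i) - 1) * sqrt (sqrt (f i) - 1)) =
      mat_diag n (\<lambda>i. sqrt (f i)) - 1\<^sub>m n"
      using f1 by (intro eq_matI) (auto simp: mat_diag_def)
    then have "C * C\<^sup>T =
      W * mat_diag n (\<lambda>i. sqrt (f i)) * W\<^sup>T - W * 1\<^sub>m n * W\<^sup>T"
      unfolding Ct unfolding C_def spectral_function_mult[OF W]
      using W mat_diag_dim[of n "\<lambda>i. sqrt (f i)"]
      by (simp add: mult_minus_distrib_mat[of _ n n _ n] minus_mult_distrib_mat[of _ n n _ _ n])
    then show ?thesis using W orthogonal_mat_right[OF W] by (simp add: H_def)
  qed
  have one: "(1\<^sub>m n :: real mat) \<in> carrier_mat n n" by simp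
  have QH1: "G - Q = Q * (C * C\<^sup>T)"
    unfolding CC GQH using Q H by (simp add: mult_minus_distrib_mat[of _ p n _ n])
  have trC: "minner C C = minner H (1\<^sub>m n) - minner (1\<^sub>m n) (1\<^sub>m n)"
  proof -
    have "minner (C * C\<^sup>T) (1\<^sub>m n) = minner C C"
      using C by (subst minner_mult_right[of _ n n _ n]) auto
    then show ?thesis unfolding CC using H by (simp add: minner_diff_left[of _ n n] minner_diff_right[of _ n n] minner_smult_left minner_smult_right[of _ n n])
  qed
  have "minner G Z - minner Q Z = minner (Q * (C * C\<^sup>T)) Z"
    using QH1 G Q Z by (simp add: minner_diff_left[of _ p n, symmetric])
  also have "Q * (C * C\<^sup>T) = (Q * C) * C\<^sup>T"
    using Q C by (simp add: mult_assoc_dim)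
  also have "minner ((Q * C) * C\<^sup>T) Z = minner (Q * C) (Z * C)"
    using Q C Z by (subst minner_mult_right[of _ p n _ n]) auto
  finally have cross: "2 * (minner G Z - minner Q Z) \<le> minner (Q * C) (Q * C) + minner (Z * C) (Z * C)"
    using minner_le_mean[of "Q * C" p n "Z * C"] Q C Z by simp
  have QC: "minner (Q * C) (Q * C) = minner C C" by (rule minner_isometry[OF Q Q2 C C])
  have ZC: "minner (Z * C) (Z * C) = minner C C" by (rule minner_isometry[OF Z C C])
  have GH: "minner G G = minner H H" unfolding GQH by (rule minner_isometry[OF Q Q2 H H])
  have Q1: "minner Q Q = minner (1\<^sub>m n) (1\<^sub>m n)"
    using minner_isometry[OF Q Q2 one one] Q by simp
  have H1: "0 \<le> minner H H - 2 * minner H (1\<^sub>m n) + minner (1\<^sub>m n) (1\<^sub>m n)"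
    using minner_diff_sq[OF H one] minner_self_nonneg[of "H - 1\<^sub>m n"] by simp
  have "minner G Z - minner Q Z \<le> minner H (1\<^sub>m n) - minner (1\<^sub>m n) (1\<^sub>m n)"
    using cross unfolding QC ZC trC by argo
  then have "minner Q Q - 2 * minner Q Z + minner Z Z \<le> minner G G - 2 * minner G Z + minner Z Z"
    unfolding Q1 GH using H1 by argo
  then show "minner (polar_retr G - Z) (polar_retr G - Z) \<le> minner (G - Z) (G - Z)"
    unfolding Q_def[symmetric] minner_diff_sq[OF Q Z(1)] minner_diff_sq[OF G Z(1)] .
qed

section \<open>Tangent projection of the Stiefel manifold and the retracted step\<close>

text \<open>Pairing with a symmetric matrix sees only the symmetric part of the other
  argument.\<close>

lemma minner_sym_diff:
  assumes "K \<in> carrier_mat k k" "K\<^sup>T = K" "B \<in> carrier_mat k k"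
  shows "minner K (B\<^sup>T) = minner K B"
  using minner_transpose[OF assms(1,3)] assms(2) by simp

lemma transpose_smult: "(c \<cdot>\<^sub>m A)\<^sup>T = c \<cdot>\<^sub>m A\<^sup>T"
  by (intro eq_matI) auto

context
  fixes L U :: "real mat" and p n :: nat
  assumes L: "L \<in> carrier_mat p n" "L\<^sup>T * L = 1\<^sub>m n" and U: "U \<in> carrier_mat p n"
begin

private definition "K = U\<^sup>T * L + L\<^sup>T * U"
private definition "P = stiefel_proj L U"

private lemma K: "K \<in> carrier_mat n n" "K\<^sup>T = K"
proof -
  show "K \<in> carrier_mat n n" using L U by (auto simp: K_def)
  have "K\<^sup>T = L\<^sup>T * U + U\<^sup>T * L"
    unfolding K_def using L U
    by (subst transpose_add[of _ n n]) (auto simp: transpose_mult_dim)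
  also have "\<dots> = K" unfolding K_def using L U by (intro comm_add_mat[of _ n n]) auto
  finally show "K\<^sup>T = K" .
qed

private lemma P_eq: "P = U - (1/2) \<cdot>\<^sub>m (L * K)"
  by (simp add: P_def stiefel_proj_def K_def)

lemma stiefel_proj_carrier: "stiefel_proj L U \<in> carrier_mat p n"
  using L K(1) unfolding P_def[symmetric] P_eq by (intro minus_carrier_mat) auto

private lemma P: "P \<in> carrier_mat p n"
  unfolding P_def by (rule stiefel_proj_carrier)

private lemma LtP: "L\<^sup>T * P = L\<^sup>T * U - (1/2) \<cdot>\<^sub>m K"
proof -
  have "L\<^sup>T * (L * K) = K" using L K by (intro mult_cancel_dim[OF L(2)]) auto
  then show ?thesis unfolding P_eq using L K U
    by (subst mult_minus_distrib_mat[of _ n p _ n]) (auto simp: mult_smult_distrib[of _ n p _ n])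
qed

lemma stiefel_proj_tangent:
  "(stiefel_proj L U)\<^sup>T * L + L\<^sup>T * stiefel_proj L U = 0\<^sub>m n n"
proof -
  have "P\<^sup>T * L = (L\<^sup>T * P)\<^sup>T"
    using L P by (simp add: transpose_mult_dim)
  also have "\<dots> = U\<^sup>T * L - (1/2) \<cdot>\<^sub>m K"
    unfolding LtP using L U K
    by (subst transpose_minus[of _ n n]) (auto simp: transpose_mult_dim transpose_smult)
  finally have PtL: "P\<^sup>T * L = U\<^sup>T * L - (1/2) \<cdot>\<^sub>m K" .
  have "P\<^sup>T * L + L\<^sup>T * P = 0\<^sub>m n n"
    unfolding PtL LtP using L U K(1) by (intro eq_matI) (auto simp: K_def)
  then show ?thesis by (simp add: P_def)
qed

text \<open>Tangency cancels the two cross terms of the Gram matrix, so a tangent step can only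
  lengthen. This is the form of hypothesis under which the polar factor is nonexpansive.\<close>

lemma stiefel_proj_step_gram:
  assumes "G = L - t \<cdot>\<^sub>m stiefel_proj L U"
  shows "G \<in> carrier_mat p n"
    and "G\<^sup>T * G =
      1\<^sub>m n + (t \<cdot>\<^sub>m stiefel_proj L U)\<^sup>T * (t \<cdot>\<^sub>m stiefel_proj L U)"
proof -
  define Y where "Y = t \<cdot>\<^sub>m P"
  have Y: "Y \<in> carrier_mat p n" using P by (simp add: Y_def)
  show G: "G \<in> carrier_mat p n" unfolding assms using P L by (auto simp: P_def intro: minus_carrier_mat)
  have GY: "G = L - Y" by (simp add: assms Y_def P_def)
  have tan: "(Y\<^sup>T * L) $$ (i, j) + (L\<^sup>T * Y) $$ (i, j) = 0"
    if "i < n" "j < n" for i j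
  proof -
    have "(P\<^sup>T * L + L\<^sup>T * P) $$ (i, j) = 0"
      using stiefel_proj_tangent that by (simp add: P_def)
    then have "(P\<^sup>T * L) $$ (i, j) + (L\<^sup>T * P) $$ (i, j) = 0"
      using that L P by simp
    then have "t * (P\<^sup>T * L) $$ (i, j) + t * (L\<^sup>T * P) $$ (i, j) = 0"
      by (simp add: distrib_left[symmetric])
    moreover have "(Y\<^sup>T * L) $$ (i, j) = t * (P\<^sup>T * L) $$ (i, j)"
      using that L P by (simp add: Y_def scalar_prod_def sum_distrib_left mult_ac)
    moreover have "(L\<^sup>T * Y) $$ (i, j) = t * (L\<^sup>T * P) $$ (i, j)"
      using that L P by (simp add: Y_def scalar_prod_def sum_distrib_left mult_ac)
    ultimately show ?thesis by simp
  qed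
  have "G\<^sup>T * G = 1\<^sub>m n + Y\<^sup>T * Y"
  proof (rule eq_matI)
    fix i j assume "i < dim_row (1\<^sub>m n + Y\<^sup>T * Y)" "j < dim_col (1\<^sub>m n + Y\<^sup>T * Y)"
    then have ij: "i < n" "j < n" using Y by auto
    have "(G\<^sup>T * G) $$ (i, j) =
      (L\<^sup>T * L) $$ (i, j) - (Y\<^sup>T * L) $$ (i, j) - (L\<^sup>T * Y) $$ (i, j)
        + (Y\<^sup>T * Y) $$ (i, j)"
      using ij L(1) Y by (simp add: GY scalar_prod_def algebra_simps sum.distrib sum_subtractf)
    then show "(G\<^sup>T * G) $$ (i, j) = (1\<^sub>m n + Y\<^sup>T * Y) $$ (i, j)"
      using tan[OF ij] ij Y unfolding L(2) by simp
  qed (use G Y in auto)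
  then show "G\<^sup>T * G =
      1\<^sub>m n + (t \<cdot>\<^sub>m stiefel_proj L U)\<^sup>T * (t \<cdot>\<^sub>m stiefel_proj L U)"
    by (simp add: Y_def P_def)
qed

text \<open>The projection is orthogonal: the removed part is \<open>L\<close> times a symmetric
  matrix, while the transpose of \<open>L\<close> times the projection is skew, so the two parts
  have inner product zero.\<close>

lemma stiefel_proj_norm: "minner (stiefel_proj L U) (stiefel_proj L U) \<le> minner U U"
proof -
  have LP: "L\<^sup>T * P \<in> carrier_mat n n" using L P by auto
  have LK: "L * K \<in> carrier_mat p n" using L K by auto
  have "minner K ((L\<^sup>T * P)\<^sup>T) = minner K (L\<^sup>T * P)"
    by (rule minner_sym_diff[OF K LP])
  moreover have "(L\<^sup>T * P)\<^sup>T = P\<^sup>T * L"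
    using L P by (simp add: transpose_mult_dim)
  moreover have "minner K (P\<^sup>T * L + L\<^sup>T * P) = 0"
    unfolding P_def stiefel_proj_tangent using K by (simp add: minner_def)
  ultimately have "minner K (L\<^sup>T * P) = 0"
    using minner_add_right[of "P\<^sup>T * L" n n "L\<^sup>T * P" K] L P K LP by auto
  then have LKP: "minner (L * K) P = 0" using minner_mult_left[OF L(1) K(1) P] by simp
  have "U = P + (1/2) \<cdot>\<^sub>m (L * K)" unfolding P_eq using U LK by (intro eq_matI) auto
  then have "minner U U = minner (P + (1/2) \<cdot>\<^sub>m (L * K)) (P + (1/2) \<cdot>\<^sub>m (L * K))" by simp
  also have "\<dots> = minner P P + minner ((1/2) \<cdot>\<^sub>m (L * K)) ((1/2) \<cdot>\<^sub>m (L * K))"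
    using LKP P LK minner_comm[OF P LK]
    by (simp add: minner_add_left[of _ p n] minner_add_right[of _ p n] minner_smult_left
        minner_smult_right[of _ p n])
  finally show ?thesis using minner_self_nonneg[of "(1/2) \<cdot>\<^sub>m (L * K)"] by (simp add: P_def)
qed

text \<open>The normal component of \<open>L - Z\<close> is quadratic in \<open>L - Z\<close> because
  \<open>(L - Z)\<^sup>T L + L\<^sup>T (L - Z) = (L - Z)\<^sup>T (L - Z)\<close> for two points of the Stiefel manifold.\<close>

lemma stiefel_proj_inner:
  assumes Z: "Z \<in> carrier_mat p n" "Z\<^sup>T * Z = 1\<^sub>m n"
  shows "minner (stiefel_proj L U) (L - Z) =
    minner U (L - Z) - 1/2 * minner U (L * ((L - Z)\<^sup>T * (L - Z)))"
proof -
  define D where "D = L - Z"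
  have D: "D \<in> carrier_mat p n" using Z by (simp add: D_def minus_carrier_mat)
  have DD: "D\<^sup>T * D \<in> carrier_mat n n" using D by auto
  have LD: "L\<^sup>T * D \<in> carrier_mat n n" using D L by auto
  have LK: "L * K \<in> carrier_mat p n" using L K by auto
  have eq: "D\<^sup>T * D = (L\<^sup>T * D)\<^sup>T + L\<^sup>T * D"
  proof (rule eq_matI)
    fix i j assume "i < dim_row ((L\<^sup>T * D)\<^sup>T + L\<^sup>T * D)"
      "j < dim_col ((L\<^sup>T * D)\<^sup>T + L\<^sup>T * D)"
    then have ij: "i < n" "j < n" using L D by auto
    have a: "(D\<^sup>T * D) $$ (i, j) = (L\<^sup>T * L) $$ (i, j)
      - (L\<^sup>T * Z) $$ (i, j) - (L\<^sup>T * Z) $$ (j, i) + (Z\<^sup>T * Z) $$ (i, j)"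
      using ij L(1) Z(1) by (simp add: D_def scalar_prod_def algebra_simps sum.distrib sum_subtractf)
    have b: "(L\<^sup>T * D) $$ (i, j) = (L\<^sup>T * L) $$ (i, j) - (L\<^sup>T * Z) $$ (i, j)"
      "(L\<^sup>T * D) $$ (j, i) = (L\<^sup>T * L) $$ (j, i) - (L\<^sup>T * Z) $$ (j, i)"
      using ij L(1) Z(1) by (simp_all add: D_def scalar_prod_def algebra_simps sum.distrib sum_subtractf)
    show "(D\<^sup>T * D) $$ (i, j) = ((L\<^sup>T * D)\<^sup>T + L\<^sup>T * D) $$ (i, j)"
      using a b ij L(1) D unfolding L(2) Z(2) by auto
  qed (use L D in auto)
  have KL: "2 * minner K (L\<^sup>T * D) = minner K (D\<^sup>T * D)"
    unfolding eq using K LD minner_sym_diff[OF K LD] by (simp add: minner_add_right[of _ n n])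
  have "minner K (D\<^sup>T * D) = 2 * minner (D\<^sup>T * D) (L\<^sup>T * U)"
  proof -
    have s: "(D\<^sup>T * D)\<^sup>T = D\<^sup>T * D" using D by (simp add: transpose_mult_dim)
    have LU: "L\<^sup>T * U \<in> carrier_mat n n" using L U by auto
    have "minner (D\<^sup>T * D) ((L\<^sup>T * U)\<^sup>T) =
      minner (D\<^sup>T * D) (L\<^sup>T * U)"
      by (rule minner_sym_diff[OF DD s LU])
    moreover have "(L\<^sup>T * U)\<^sup>T = U\<^sup>T * L"
      using L U by (simp add: transpose_mult_dim)
    moreover have "minner K (D\<^sup>T * D) = minner (D\<^sup>T * D) K"
      by (rule minner_comm[OF K(1) DD])
    moreover have "U\<^sup>T * L \<in> carrier_mat n n" using L U by auto
    ultimately show ?thesis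
      unfolding K_def using LU DD by (simp add: minner_add_right[of _ n n])
  qed
  also have "minner (D\<^sup>T * D) (L\<^sup>T * U) = minner (L * (D\<^sup>T * D)) U"
    by (rule minner_mult_left[OF L(1) DD U, symmetric])
  also have "\<dots> = minner U (L * (D\<^sup>T * D))"
    using L DD U by (intro minner_comm[of _ p n]) auto
  finally have KU: "minner K (D\<^sup>T * D) = 2 * minner U (L * (D\<^sup>T * D))" .
  have "minner P D = minner U D - 1/2 * minner (L * K) D"
    unfolding P_eq using U LK D by (simp add: minner_diff_left[of _ p n] minner_smult_left)
  also have "minner (L * K) D = minner K (L\<^sup>T * D)" by (rule minner_mult_left[OF L(1) K(1) D])
  finally show ?thesis using KL KU by (simp add: P_def D_def)
qed

text \<open>The squared distance to \<open>Z\<close> is expanded before retracting, and the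
  retraction does not increase it. The conclusion refers to the unprojected \<open>U\<close>: the
  linear term carries the normal correction, and the quadratic term uses that projecting
  shortens.\<close>

lemma stiefel_retraction_step:
  assumes Z: "Z \<in> carrier_mat p n" "Z\<^sup>T * Z = 1\<^sub>m n"
    and Q: "Q = polar_retr (L - t \<cdot>\<^sub>m stiefel_proj L U)"
  shows "Q \<in> carrier_mat p n" and "Q\<^sup>T * Q = 1\<^sub>m n"
    and "minner (Q - Z) (Q - Z) \<le> minner (L - Z) (L - Z)
      - 2 * t * (minner U (L - Z) - 1/2 * minner U (L * ((L - Z)\<^sup>T * (L - Z))))
      + t\<^sup>2 * minner U U"
proof -
  define G where "G = L - t \<cdot>\<^sub>m stiefel_proj L U"
  note gram = stiefel_proj_step_gram[OF G_def]
  have tP: "t \<cdot>\<^sub>m stiefel_proj L U \<in> carrier_mat p n" using stiefel_proj_carrier by simp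
  note polar = polar_retr_nonexpansive[OF gram(1) tP gram(2) Z, folded Q[folded G_def]]
  show "Q \<in> carrier_mat p n" "Q\<^sup>T * Q = 1\<^sub>m n" by (rule polar)+
  have D: "L - Z \<in> carrier_mat p n" using Z by (simp add: minus_carrier_mat)
  have "G - Z = (L - Z) - t \<cdot>\<^sub>m P"
    unfolding G_def using L Z P by (intro eq_matI) (auto simp: P_def)
  then have "minner (G - Z) (G - Z) =
    minner (L - Z) (L - Z) - 2 * (t * minner (L - Z) P) + t * (t * minner P P)"
    using minner_diff_sq[OF D, of "t \<cdot>\<^sub>m P"] D P
    by (simp add: minner_smult_left minner_smult_right[of _ p n])
  also have "minner (L - Z) P = minner P (L - Z)" by (rule minner_comm[OF D P])
  also have "\<dots> = minner U (L - Z) - 1/2 * minner U (L * ((L - Z)\<^sup>T * (L - Z)))"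
    unfolding P_def by (rule stiefel_proj_inner[OF Z])
  also have "t * (t * minner P P) \<le> t\<^sup>2 * minner U U"
    using stiefel_proj_norm mult_left_mono[of "minner P P" "minner U U" "t\<^sup>2"]
    by (simp add: P_def power2_eq_square mult.assoc)
  finally show "minner (Q - Z) (Q - Z) \<le> minner (L - Z) (L - Z)
      - 2 * t * (minner U (L - Z) - 1/2 * minner U (L * ((L - Z)\<^sup>T * (L - Z))))
      + t\<^sup>2 * minner U U"
    using polar(3) by (simp add: mult.assoc)
qed

end

section \<open>Singular values\<close>

text \<open>Links the definition by a sorted list of roots to an eigenbasis: the spectral theorem is
  applied to exactly this list, whose order becomes the order of the diagonal.\<close>

lemma singular_value_spectrum:
  fixes A :: "real mat"
  assumes A: "A \<in> carrier_mat p n"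
  shows "\<exists>W es. W \<in> carrier_mat n n \<and> W\<^sup>T * W = 1\<^sub>m n \<and>
    A\<^sup>T * A = W * mat_diag n (\<lambda>i. es ! i) * W\<^sup>T \<and>
    (\<forall>i<n. 0 \<le> es ! i) \<and> (\<forall>i j. i \<le> j \<longrightarrow> j < n \<longrightarrow> es ! j \<le> es ! i) \<and>
    (\<forall>k. singular_value A k = sqrt (es ! (k - 1)))"
proof -
  let ?M = "A\<^sup>T * A"
  have M: "?M \<in> carrier_mat n n" and Ms: "?M\<^sup>T = ?M"
    using A by (auto simp: transpose_mult_dim)
  obtain es' where es': "char_poly ?M = (\<Prod>e\<leftarrow>es'. [:- e, 1:])"
    using symmetric_char_poly_splits[OF M Ms] by blast
  have proots: "proots (char_poly ?M) = mset es'"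
    unfolding es'
  proof (induction es')
    case (Cons e es')
    have "(\<Prod>e\<leftarrow>es'. [:- e, 1:]) \<noteq> 0" by (auto simp: prod_list_zero_iff)
    then show ?case using Cons by (simp add: proots_mult del: mult_pCons_left)
  qed simp
  define es where "es = rev (sorted_list_of_multiset (proots (char_poly ?M)))"
  have mset: "mset es = mset es'" by (simp add: es_def proots)
  have "(\<Prod>e\<leftarrow>es. [:- e, 1:]) = (\<Prod>e\<leftarrow>es'. [:- e, 1:])"
    by (metis (no_types, lifting) mset mset_map prod_mset_prod_list)
  then have cp: "char_poly ?M = (\<Prod>e\<leftarrow>es. [:- e, 1:])" using es' by simp
  then obtain W where W: "W \<in> carrier_mat n n" "W\<^sup>T * W = 1\<^sub>m n"
    "?M = W * mat_diag n (\<lambda>i. es ! i) * W\<^sup>T"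
    using spectral_decomposition[OF M Ms] by blast
  have len: "length es = n"
    using degree_monic_char_poly[OF M] degree_linear_factors[of uminus es] cp by simp
  show ?thesis
  proof (intro exI conjI allI impI)
    show "W \<in> carrier_mat n n" "W\<^sup>T * W = 1\<^sub>m n"
      "?M = W * mat_diag n (\<lambda>i. es ! i) * W\<^sup>T" by (rule W)+
    show "0 \<le> es ! i" if "i < n" for i
      unfolding gram_spectrum[OF A W that] by (intro sum_nonneg) auto
    show "es ! j \<le> es ! i" if "i \<le> j" "j < n" for i j
      using that len sorted_rev_nth_mono[of es i j] by (simp add: es_def)
    show "singular_value A k = sqrt (es ! (k - 1))" for k
      by (simp add: singular_value_def es_def)
  qed
qed

lemma minner_singular_value_1:
  fixes A :: "real mat"
  assumes A: "A \<in> carrier_mat p n" and n: "0 < n" and X: "X \<in> carrier_mat n c"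
  shows "minner (A * X) (A * X) \<le> (singular_value A 1)\<^sup>2 * minner X X"
proof -
  obtain W es where W: "W \<in> carrier_mat n n" "W\<^sup>T * W = 1\<^sub>m n"
    "A\<^sup>T * A = W * mat_diag n (\<lambda>i. es ! i) * W\<^sup>T"
    and es: "\<forall>i<n. 0 \<le> es ! i" "\<forall>i j. i \<le> j \<longrightarrow> j < n \<longrightarrow> es ! j \<le> es ! i"
    and sv: "\<forall>k. singular_value A k = sqrt (es ! (k - 1))"
    using singular_value_spectrum[OF A] by blast
  have WtX: "W\<^sup>T * X \<in> carrier_mat n c" using W X by auto
  have Wt: "W\<^sup>T \<in> carrier_mat n n" "(W\<^sup>T)\<^sup>T * W\<^sup>T = 1\<^sub>m n"
    using W orthogonal_mat_right[OF W(1,2)] by auto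
  have "minner (A * X) (A * X) = minner X (A\<^sup>T * A * X)"
    using A X minner_mult_left[OF A X, of "A * X"] by (simp add: mult_assoc_dim)
  also have "\<dots> = (\<Sum>i<n. es ! i * (\<Sum>j<c. ((W\<^sup>T * X) $$ (i, j))\<^sup>2))"
    unfolding W(3) by (rule spectral_form[OF W(1) X])
  also have "\<dots> \<le> (\<Sum>i<n. es ! 0 * (\<Sum>j<c. ((W\<^sup>T * X) $$ (i, j))\<^sup>2))"
    using es by (intro sum_mono mult_right_mono sum_nonneg) auto
  also have "\<dots> = es ! 0 * minner (W\<^sup>T * X) (W\<^sup>T * X)"
    unfolding minner_def carrier_matD[OF WtX] sum_distrib_left power2_eq_square ..
  also have "minner (W\<^sup>T * X) (W\<^sup>T * X) = minner X X"
    by (rule minner_isometry[OF Wt X X])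
  finally show ?thesis using sv es(1) n by simp
qed

lemma singular_value_nonneg:
  assumes A: "A \<in> carrier_mat p n" and "1 \<le> k" "k \<le> n"
  shows "0 \<le> singular_value A k"
proof -
  obtain W es where "\<And>i. i < n \<Longrightarrow> 0 \<le> es ! i" "\<And>k. singular_value A k = sqrt (es ! (k - 1))"
    using singular_value_spectrum[OF A] by metis
  then show ?thesis using assms by simp
qed

lemma singular_value_antimono:
  assumes A: "A \<in> carrier_mat p n" and "1 \<le> j" "j \<le> k" "k \<le> n"
  shows "singular_value A k \<le> singular_value A j"
proof -
  obtain W es where "\<And>i j. i \<le> j \<Longrightarrow> j < n \<Longrightarrow> es ! j \<le> es ! i" "\<And>k. singular_value A k = sqrt (es ! (k - 1))"
    using singular_value_spectrum[OF A] by metis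
  then show ?thesis using assms by simp
qed

text \<open>A matrix and its transpose have the same operator norm. The spectral information
  concerns only \<open>A\<close> acting from the left, so Cauchy-Schwarz moves \<open>A\<close> to
  the other side and one factor of the norm of \<open>X * A\<close> cancels.\<close>

lemma minner_singular_value_1_left:
  fixes A :: "real mat"
  assumes A: "A \<in> carrier_mat p n" and n: "0 < n" and X: "X \<in> carrier_mat c p"
  shows "minner (X * A) (X * A) \<le> (singular_value A 1)\<^sup>2 * minner X X"
proof -
  define s where "s = (singular_value A 1)\<^sup>2"
  define Y where "Y = (X * A)\<^sup>T"
  have Y: "Y \<in> carrier_mat n c" and XA: "X * A \<in> carrier_mat c n" using A X by (auto simp: Y_def)
  have AY: "(A * Y)\<^sup>T \<in> carrier_mat c p" using A Y by auto
  have YY: "minner Y Y = minner (X * A) (X * A)" unfolding Y_def by (rule minner_transpose[OF XA XA])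
  have "minner (X * A) (X * A) = minner X ((X * A) * A\<^sup>T)"
    by (rule minner_mult_right[OF X A XA])
  also have "(X * A) * A\<^sup>T = (A * Y)\<^sup>T"
    using A X by (simp add: Y_def transpose_mult_dim)
  finally have "(minner (X * A) (X * A))\<^sup>2 \<le> minner X X * minner ((A * Y)\<^sup>T) ((A * Y)\<^sup>T)"
    using minner_Cauchy_Schwarz[OF X AY] by simp
  also have "minner ((A * Y)\<^sup>T) ((A * Y)\<^sup>T) = minner (A * Y) (A * Y)"
    using A Y by (intro minner_transpose[of _ p c]) auto
  also have "minner X X * \<dots> \<le> minner X X * (s * minner Y Y)"
    unfolding s_def by (intro mult_left_mono minner_singular_value_1[OF A n Y] minner_self_nonneg)
  finally have "minner (X * A) (X * A) * minner (X * A) (X * A) \<le> (s * minner X X) * minner (X * A) (X * A)"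
    unfolding YY by (simp add: power2_eq_square mult_ac)
  then show ?thesis
    using minner_self_nonneg[of "X * A"] minner_self_nonneg[of X]
    by (cases "minner (X * A) (X * A) = 0") (auto simp: s_def)
qed

text \<open>With \<open>B = V W\<^sub>r\<close>, \<open>W\<^sub>r\<close> the leading \<open>r\<close> eigenvectors of \<open>V\<^sup>T V\<close>, the matrix
  \<open>B\<^sup>T B\<close> is the diagonal matrix of the leading eigenvalues; hence \<open>B\<close> is invertible when the last one
  is positive.\<close>

lemma minner_singular_value_lower:
  fixes U V :: "real mat"
  assumes U: "U \<in> carrier_mat p r" "U\<^sup>T * U = 1\<^sub>m r" and V: "V \<in> carrier_mat r n"
    and r: "1 \<le> r" "r \<le> n" and X: "X \<in> carrier_mat c r"
  shows "(singular_value (U * V) r)\<^sup>2 * minner X X \<le> minner (X * V) (X * V)"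
proof -
  have UV: "U * V \<in> carrier_mat p n" using U V by auto
  have gram: "(U * V)\<^sup>T * (U * V) = V\<^sup>T * V"
  proof -
    have "U\<^sup>T * (U * V) = V" using U V by (intro mult_cancel_dim[OF U(2)]) auto
    then show ?thesis using U V by (simp add: transpose_mult_dim mult_assoc_dim)
  qed
  obtain W es where W: "W \<in> carrier_mat n n" "W\<^sup>T * W = 1\<^sub>m n"
    "(U * V)\<^sup>T * (U * V) = W * mat_diag n (\<lambda>i. es ! i) * W\<^sup>T"
    and es: "\<forall>i<n. 0 \<le> es ! i" "\<forall>i j. i \<le> j \<longrightarrow> j < n \<longrightarrow> es ! j \<le> es ! i"
    and sv: "\<forall>k. singular_value (U * V) k = sqrt (es ! (k - 1))"
    using singular_value_spectrum[OF UV] by blast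
  define l where "l = es ! (r - 1)"
  have l0: "0 \<le> l" using es r by (simp add: l_def)
  have sq: "(singular_value (U * V) r)\<^sup>2 = l" using sv l0 by (simp add: l_def)
  show ?thesis
  proof (cases "l = 0")
    case True
    then show ?thesis using sq minner_self_nonneg by simp
  next
    case False
    then have lpos: "0 < l" using l0 by simp
    have lle: "l \<le> es ! i" if "i < r" for i using es that r by (simp add: l_def)
    \<comment> \<open>Multiplication by \<open>J\<close> selects the leading \<open>r\<close>
      columns.\<close>
    define J where "J = (mat n r (\<lambda>(i, j). if i = j then 1 else 0) :: real mat)"
    define B where "B = V * W * J"
    have J: "J \<in> carrier_mat n r" by (simp add: J_def)
    have B: "B \<in> carrier_mat r r" using V W J by (auto simp: B_def)
    define K where "K = mat_diag n (\<lambda>i. es ! i)"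
    have K: "K \<in> carrier_mat n n" by (simp add: K_def)
    have VV: "V\<^sup>T * V = W * K * W\<^sup>T" using gram W(3) by (simp add: K_def)
    have WW: "W\<^sup>T * (W * Y) = Y" if "dim_row Y = n" for Y
      using W that by (intro mult_cancel_dim[OF W(2)]) auto
    have "B\<^sup>T * B = J\<^sup>T * (W\<^sup>T * ((V\<^sup>T * V) * (W * J)))"
      unfolding B_def using V W J by (simp add: transpose_mult_dim mult_assoc_dim)
    also have "\<dots> = J\<^sup>T * (K * J)"
      unfolding VV using V W J K by (simp add: mult_assoc_dim WW)
    also have "\<dots> = mat_diag r (\<lambda>i. es ! i)"
    proof (rule eq_matI)
      fix i j assume ij: "i < dim_row (mat_diag r ((!) es))" "j < dim_col (mat_diag r ((!) es))"
      have "(J\<^sup>T * (K * J)) $$ (i, j) =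
        (\<Sum>k<n. (if k = i then 1 else 0) * (es ! k * (if k = j then 1 else 0)))"
        using ij r unfolding K_def mat_diag_mult_left[OF J]
        by (auto simp: J_def scalar_prod_def lessThan_atLeast0 intro!: sum.cong)
      also have "\<dots> = mat_diag r ((!) es) $$ (i, j)"
        using ij r by (simp add: mat_diag_def if_distrib[of "\<lambda>x. x * _"] cong: if_cong)
      finally show "(J\<^sup>T * (K * J)) $$ (i, j) = mat_diag r ((!) es) $$ (i, j)" .
    qed (use J K in auto)
    finally have BB: "B\<^sup>T * B = mat_diag r (\<lambda>i. es ! i)" .
    define I where "I = mat_diag r (\<lambda>i. 1 / es ! i)"
    have I: "I \<in> carrier_mat r r" by (simp add: I_def)
    have "es ! i \<noteq> 0" if "i < r" for i using lle[OF that] lpos by auto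
    then have "I * (B\<^sup>T * B) = 1\<^sub>m r"
      unfolding BB I_def mat_diag_diag by (intro eq_matI) (auto simp: mat_diag_def)
    then have "(I * B\<^sup>T) * B = 1\<^sub>m r" using I B by (simp add: mult_assoc_dim)
    then have BI: "B * (I * B\<^sup>T) = 1\<^sub>m r"
      using mat_mult_left_right_inverse[of "I * B\<^sup>T" r B] I B by auto
    have XB: "X * B \<in> carrier_mat c r" using X B by auto
    have XBI: "X * B * I \<in> carrier_mat c r" using XB I by auto
    have It: "I\<^sup>T = I" by (simp add: I_def)
    \<comment> \<open>Since \<open>B\<close> is invertible, the squared norm of \<open>X\<close> is
      that of \<open>X * B\<close> weighted by the reciprocals of the leading eigenvalues, each at
      most \<open>1 / l\<close>. Afterwards the columns beyond \<open>r\<close> are added back,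
      which only increases the sum.\<close>
    have "minner X X = minner (X * B * I * B\<^sup>T) X"
      using BI X B I by (simp add: mult_assoc_dim)
    also have "\<dots> = minner (X * B * I) (X * B)"
      using minner_mult_right[OF XBI, of "B\<^sup>T" r X] B X by simp
    also have "\<dots> = (\<Sum>i<c. \<Sum>j<r. ((X * B) $$ (i, j))\<^sup>2 / es ! j)"
      using XB unfolding I_def mat_diag_mult_right[OF XB]
      by (auto simp: minner_def power2_eq_square intro!: sum.cong)
    also have "\<dots> \<le> (\<Sum>i<c. \<Sum>j<r. ((X * B) $$ (i, j))\<^sup>2 / l)"
    proof (intro sum_mono divide_left_mono)
      fix j assume "j \<in> {..<r}"
      then show "l \<le> es ! j" "0 < es ! j * l" using lle[of j] lpos by auto
    qed auto
    finally have "l * minner X X \<le> l * (\<Sum>i<c. \<Sum>j<r. ((X * B) $$ (i, j))\<^sup>2 / l)"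
      using lpos by (simp add: mult_left_mono)
    also have "\<dots> = (\<Sum>i<c. \<Sum>j<r. ((X * B) $$ (i, j))\<^sup>2)"
      using lpos by (simp add: sum_distrib_left)
    also have "\<dots> = (\<Sum>i<c. \<Sum>j<r. ((X * V * W) $$ (i, j))\<^sup>2)"
    proof (intro sum.cong refl)
      fix i j assume ij: "i \<in> {..<c}" "j \<in> {..<r}"
      have "X * B = X * V * W * J" unfolding B_def using X V W J by (simp add: mult_assoc_dim)
      moreover have "(X * V * W * J) $$ (i, j) = (\<Sum>k<n. (X * V * W) $$ (i, k) * J $$ (k, j))"
        using ij X V W J by (simp add: scalar_prod_def lessThan_atLeast0)
      moreover have "\<dots> = (\<Sum>k<n. if k = j then (X * V * W) $$ (i, k) else 0)"
        using ij by (intro sum.cong refl) (auto simp: J_def)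
      ultimately show "((X * B) $$ (i, j))\<^sup>2 = ((X * V * W) $$ (i, j))\<^sup>2" using ij r by simp
    qed
    also have "\<dots> \<le> (\<Sum>i<c. \<Sum>j<n. ((X * V * W) $$ (i, j))\<^sup>2)"
      using r by (intro sum_mono sum_mono2) auto
    also have "\<dots> = minner (X * V * W) (X * V * W)"
      using X V W by (simp add: minner_def power2_eq_square)
    also have "\<dots> = minner (X * V) (X * V * W * W\<^sup>T)"
      using X V W by (intro minner_mult_right[of _ c n _ n]) auto
    also have "X * V * W * W\<^sup>T = X * V"
      using X V W orthogonal_mat_right[OF W(1,2)] by (simp add: mult_assoc_dim)
    finally show ?thesis using sq by simp
  qed
qed

section \<open>Orthogonal alignment\<close>

lemma minner_one_right: "A \<in> carrier_mat n n \<Longrightarrow> minner A (1\<^sub>m n) = (\<Sum>i<n. A $$ (i, i))"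
  by (auto simp: minner_def one_mat_def if_distrib[of "\<lambda>x. _ * x"] cong: if_cong)

text \<open>Singular shifts are roots of the characteristic polynomial of \<open>- M\<close>; there
  are finitely many of them, while the interval is infinite.\<close>

lemma invertible_shift_exists:
  fixes M :: "real mat"
  assumes M: "M \<in> carrier_mat n n" and e: "0 < (e::real)"
  obtains t where "0 < t" "t < e" "det (M + t \<cdot>\<^sub>m 1\<^sub>m n) \<noteq> 0"
proof -
  have M': "- M \<in> carrier_mat n n" using M by simp
  have eqd: "det (M + t \<cdot>\<^sub>m 1\<^sub>m n) = 0 \<longleftrightarrow> poly (char_poly (- M)) t = 0" for t
  proof -
    have "char_matrix (- M) t = - (M + t \<cdot>\<^sub>m 1\<^sub>m n)"
      unfolding char_matrix_def using M by (intro eq_matI) auto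
    then have "det (char_matrix (- M) t) = 0 \<longleftrightarrow> det (- (M + t \<cdot>\<^sub>m 1\<^sub>m n)) = 0" by simp
    also have "\<dots> \<longleftrightarrow> det (M + t \<cdot>\<^sub>m 1\<^sub>m n) = 0"
      using det_0_negate[of "M + t \<cdot>\<^sub>m 1\<^sub>m n" n] M by simp
    finally show ?thesis
      using eigenvalue_root_char_poly[OF M', of t] eigenvalue_det[OF M', of t] by simp
  qed
  have "char_poly (- M) \<noteq> 0" using degree_monic_char_poly[OF M'] by auto
  then have "finite {t. poly (char_poly (- M)) t = 0}" by (rule poly_roots_finite)
  moreover have "infinite {0<..<e}" using e by simp
  ultimately obtain t where "t \<in> {0<..<e}" "poly (char_poly (- M)) t \<noteq> 0"
    by (metis (mono_tags, lifting) finite_subset mem_Collect_eq subsetI)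
  then show ?thesis using that eqd by auto
qed

lemma minner_projection:
  assumes W: "W \<in> carrier_mat p n" "W\<^sup>T * W = 1\<^sub>m n" and Y: "Y \<in> carrier_mat p c"
  shows "minner (Y - W * (W\<^sup>T * Y)) (Y - W * (W\<^sup>T * Y)) =
    minner Y Y - minner (W\<^sup>T * Y) (W\<^sup>T * Y)"
proof -
  have WY: "W\<^sup>T * Y \<in> carrier_mat n c" and WWY: "W * (W\<^sup>T * Y) \<in> carrier_mat p c"
    using W Y by auto
  have "minner Y (W * (W\<^sup>T * Y)) = minner (W * (W\<^sup>T * Y)) Y"
    by (rule minner_comm[OF Y WWY])
  then show ?thesis
    unfolding minner_diff_sq[OF Y WWY] minner_isometry[OF W WY WY] minner_mult_left[OF W(1) WY Y]
    by simp
qed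

lemma minner_self_orthonormal:
  assumes "W \<in> carrier_mat p n" "W\<^sup>T * W = 1\<^sub>m n"
  shows "minner W W = real n"
proof -
  have "minner W W = minner (W * 1\<^sub>m n) (W * 1\<^sub>m n)" using assms by simp
  also have "\<dots> = minner (1\<^sub>m n) (1\<^sub>m n)" by (rule minner_isometry[OF assms]) auto
  finally show ?thesis by (simp add: minner_one_right)
qed

text \<open>The constant \<open>4\<close> is twice the optimal one. The slack allows us to take for \<open>R\<close> the polar factor
  of a small invertible perturbation \<open>M + t I\<close> of \<open>M = W\<^sup>T U\<close>, except when \<open>M\<close> is itself orthogonal.\<close>

lemma orthogonal_alignment:
  assumes U: "U \<in> carrier_mat p n" "U\<^sup>T * U = 1\<^sub>m n"
    and W: "W \<in> carrier_mat p n" "W\<^sup>T * W = 1\<^sub>m n"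
  obtains R where "R \<in> carrier_mat n n" "R\<^sup>T * R = 1\<^sub>m n"
    "minner (U - W * R) (U - W * R) \<le>
      4 * minner (W - U * (U\<^sup>T * W)) (W - U * (U\<^sup>T * W))"
proof -
  define M where "M = W\<^sup>T * U"
  have M: "M \<in> carrier_mat n n" using U W by (auto simp: M_def)
  have Mt: "M\<^sup>T = U\<^sup>T * W" using U W by (simp add: M_def transpose_mult_dim)
  have one: "(1\<^sub>m n :: real mat) \<in> carrier_mat n n" by simp
  have n11: "minner (1\<^sub>m n) (1\<^sub>m n) = real n" by (simp add: minner_one_right)
  \<comment> \<open>The number \<open>e\<close> is the squared residual of \<open>W\<close> against
    the range of \<open>U\<close>. As \<open>n\<close> is the squared norm of \<open>M\<close> plus
    \<open>e\<close>, the claim for an orthogonal \<open>R\<close> amounts to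
    \<open>minner R M\<close> being at least \<open>minner M M - e\<close>.\<close>
  define e where "e = real n - minner M M"
  have e: "minner (W - U * (U\<^sup>T * W)) (W - U * (U\<^sup>T * W)) = e"
    unfolding minner_projection[OF U W(1)] minner_self_orthonormal[OF W] e_def
    using minner_transpose[OF M M] Mt by simp
  have e0: "0 \<le> e" unfolding e[symmetric] by (rule minner_self_nonneg)
  have dist: "minner (U - W * R) (U - W * R) = 2 * real n - 2 * minner R M"
    if R: "R \<in> carrier_mat n n" "R\<^sup>T * R = 1\<^sub>m n" for R
  proof -
    have WR: "W * R \<in> carrier_mat p n" using W R by auto
    have "minner U (W * R) = minner (W * R) U" by (rule minner_comm[OF U(1) WR])
    also have "\<dots> = minner R M" unfolding M_def by (rule minner_mult_left[OF W(1) R(1) U(1)])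
    finally show ?thesis
      unfolding minner_diff_sq[OF U(1) WR] minner_isometry[OF W R(1) R(1)]
      using minner_self_orthonormal[OF U] minner_self_orthonormal[OF R] by simp
  qed
  show ?thesis
  proof (cases "e = 0")
    case True
    then have "W - U * (U\<^sup>T * W) = 0\<^sub>m p n"
      using e U W by (intro minner_self_eq_0) (auto intro: minus_carrier_mat)
    then have WUM: "W = U * M\<^sup>T"
      unfolding Mt
    proof (intro eq_matI)
      fix i j assume "i < dim_row (U * (U\<^sup>T * W))" "j < dim_col (U * (U\<^sup>T * W))"
      then have ij: "i < p" "j < n" using U W by auto
      have "(W - U * (U\<^sup>T * W)) $$ (i, j) = W $$ (i, j) - (U * (U\<^sup>T * W)) $$ (i, j)"
        using U W ij by (intro index_minus_mat) auto
      then show "W $$ (i, j) = (U * (U\<^sup>T * W)) $$ (i, j)"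
        unfolding \<open>W - U * (U\<^sup>T * W) = 0\<^sub>m p n\<close> using ij by simp
    qed (use U W in auto)
    have UU: "U\<^sup>T * (U * M\<^sup>T) = M\<^sup>T"
      using U M by (intro mult_cancel_dim[OF U(2)]) auto
    have "1\<^sub>m n = W\<^sup>T * W" using W by simp
    also have "\<dots> = M * M\<^sup>T"
      using U M UU unfolding WUM by (simp add: transpose_mult_dim mult_assoc_dim)
    finally have "M\<^sup>T * M = 1\<^sub>m n"
      using mat_mult_left_right_inverse[OF M, of "M\<^sup>T"] M by simp
    moreover have "minner M M = real n" using True by (simp add: e_def)
    ultimately show ?thesis using that[OF M] dist[OF M] e True by simp
  next
    case False
    with e0 have epos: "0 < e" by simp
    \<comment> \<open>The 5 is the total of the perturbation errors \<open>a1\<close>,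
      \<open>a2\<close>, \<open>a3\<close> below, namely 2 + 2 + 1 multiples of
      \<open>t * real n\<close>; the added 1 keeps the denominator positive.\<close>
    have "0 < min 1 (e / (5 * real n + 1))" using epos by simp
    then obtain t where t: "0 < t" "t < min 1 (e / (5 * real n + 1))" "det (M + t \<cdot>\<^sub>m 1\<^sub>m n) \<noteq> 0"
      using invertible_shift_exists[OF M] by metis
    have "t * (5 * real n + 1) < e" using t(2) by (simp add: pos_less_divide_eq)
    then have te: "5 * (t * real n) \<le> e" using t(1) by (simp add: algebra_simps)
    have t1: "t < 1" using t by simp
    define G where "G = M + t \<cdot>\<^sub>m 1\<^sub>m n"
    have G: "G \<in> carrier_mat n n" using M by (simp add: G_def)
    have GG: "G\<^sup>T * G \<in> carrier_mat n n" "(G\<^sup>T * G)\<^sup>T = G\<^sup>T * G"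
      using G by (auto simp: transpose_mult_dim)
    obtain V f where V: "V \<in> carrier_mat n n" "V\<^sup>T * V = 1\<^sub>m n"
      and eq: "G\<^sup>T * G = V * mat_diag n f * V\<^sup>T"
      using symmetric_spectral[OF GG] by blast
    obtain B where B: "B \<in> carrier_mat n n" "B * G = 1\<^sub>m n"
      using det_non_zero_imp_unit[OF G t(3)[folded G_def], of n] unfolding Units_def ring_mat_def by auto
    have f0: "0 < f i" if i: "i < n" for i
    proof -
      have fi: "f i = (\<Sum>j<n. ((G * V) $$ (j, i))\<^sup>2)" by (rule gram_spectrum[OF G V eq i])
      have "f i \<noteq> 0"
      proof
        assume "f i = 0"
        then have z: "(G * V) $$ (j, i) = 0" if "j < n" for j
          using that unfolding fi by (simp add: sum_nonneg_eq_0_iff)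
        have BGV: "B * (G * V) = V" using G V B by (intro mult_cancel_dim[OF B(2)]) auto
        have "V $$ (j, i) = 0" if j: "j < n" for j
        proof -
          have "V $$ (j, i) = (B * (G * V)) $$ (j, i)" unfolding BGV ..
          also have "\<dots> = (\<Sum>k<n. B $$ (j, k) * (G * V) $$ (k, i))"
          proof -
            define D where "D = G * V"
            have "D \<in> carrier_mat n n" using G V by (auto simp: D_def)
            then show ?thesis unfolding D_def[symmetric]
              using B i j by (simp add: scalar_prod_def lessThan_atLeast0)
          qed
          also have "\<dots> = 0" using z by simp
          finally show ?thesis .
        qed
        then have "(V\<^sup>T * V) $$ (i, i) = 0" using V(1) i by (simp add: scalar_prod_def)
        then show False unfolding V(2) using i by simp
      qed
      moreover have "0 \<le> f i" unfolding fi by (intro sum_nonneg) auto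
      ultimately show ?thesis by simp
    qed
    define Q where "Q = polar_retr G"
    define H where "H = V * mat_diag n (\<lambda>i. sqrt (f i)) * V\<^sup>T"
    define C where "C = V * mat_diag n (\<lambda>i. sqrt (sqrt (f i))) * V\<^sup>T"
    have Q: "Q \<in> carrier_mat n n" "Q\<^sup>T * Q = 1\<^sub>m n" and GQH: "G = Q * H"
      unfolding Q_def H_def using polar_retr_spectral[OF G V f0 eq] by auto
    have H: "H \<in> carrier_mat n n" and C: "C \<in> carrier_mat n n" using V by (auto simp: H_def C_def)
    have Ct: "C\<^sup>T = C" unfolding C_def by (rule spectral_function_sym[OF V(1)])
    have diag: "mat_diag n (\<lambda>i. sqrt (sqrt (f i)) * sqrt (sqrt (f i))) = mat_diag n (\<lambda>i. sqrt (f i))"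
      using f0 by (intro eq_matI) (auto simp: mat_diag_def less_imp_le)
    have CC: "C * C = H"
      unfolding C_def spectral_function_mult[OF V] diag H_def ..
    have QG: "minner Q G = minner C C"
    proof -
      have "minner Q G = minner (Q * 1\<^sub>m n) (Q * H)" using Q GQH by simp
      also have "\<dots> = minner (1\<^sub>m n) (C * C)" unfolding CC by (rule minner_isometry[OF Q one H])
      also have "\<dots> = minner (C * C) (1\<^sub>m n)" using C by (intro minner_comm[of _ n n]) auto
      also have "\<dots> = minner C C" using minner_mult_right[OF C C one] C Ct by simp
      finally show ?thesis .
    qed
    \<comment> \<open>The matrix \<open>M\<close> is a contraction because \<open>U\<close> and
      \<open>W\<close> have orthonormal columns. Without the shift, the next estimates would say
      that the nuclear norm of a contraction dominates its squared Frobenius norm.\<close>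
    have MC: "minner (M * C) (M * C) \<le> minner C C"
    proof -
      have UC: "U * C \<in> carrier_mat p n" using U C by auto
      have "M * C = W\<^sup>T * (U * C)" using U W C by (simp add: M_def mult_assoc_dim)
      moreover have "minner (W\<^sup>T * (U * C)) (W\<^sup>T * (U * C)) \<le> minner (U * C) (U * C)"
        using minner_projection[OF W UC] minner_self_nonneg[of "U * C - W * (W\<^sup>T * (U * C))"] by simp
      ultimately show ?thesis using minner_isometry[OF U C C] by simp
    qed
    have GC: "minner (G * C) (G * C) \<le> (1 + t)\<^sup>2 * minner C C"
    proof -
      have MCc: "M * C \<in> carrier_mat n n" and tC: "t \<cdot>\<^sub>m C \<in> carrier_mat n n" using M C by auto
      have "G * C = M * C + t \<cdot>\<^sub>m C"
        unfolding G_def using M C by (simp add: add_mult_distrib_mat[of _ n n _ _ n] mult_smult_assoc_mat[OF one C])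
      then have "minner (G * C) (G * C) = minner (M * C) (M * C) + t * (2 * minner (M * C) C) + t\<^sup>2 * minner C C"
        using MCc tC C minner_comm[OF MCc C]
        by (simp add: minner_add_left[of _ n n] minner_add_right[of _ n n] minner_smult_left
            minner_smult_right[of _ n n] power2_eq_square distrib_left)
      moreover have "t * (2 * minner (M * C) C) \<le> t * (minner C C + minner C C)"
        using minner_le_mean[OF MCc C] MC t by (intro mult_left_mono) auto
      ultimately show ?thesis using MC by (simp add: power2_eq_square distrib_left distrib_right)
    qed
    have GGC: "minner G G \<le> (1 + t) * minner C C"
    proof -
      have QC: "(1 + t) \<cdot>\<^sub>m (Q * C) \<in> carrier_mat n n" and GCc: "G * C \<in> carrier_mat n n"
        and QCc: "Q * C \<in> carrier_mat n n" using Q C G by auto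
      have "G = Q * C * C" unfolding GQH CC[symmetric] using Q C by (simp add: mult_assoc_dim)
      then have "minner G G = minner (Q * C * C) G" by simp
      also have "\<dots> = minner (Q * C) (G * C)" using minner_mult_right[OF QCc C G] Ct by simp
      \<comment> \<open>The scaling by \<open>1 + t\<close> balances the two squares in the mean
        inequality: both are at most \<open>(1 + t)^2 * minner C C\<close>.\<close>
      finally have "2 * ((1 + t) * minner G G) = 2 * minner ((1 + t) \<cdot>\<^sub>m (Q * C)) (G * C)"
        by (simp add: minner_smult_left)
      also have "\<dots> \<le> minner ((1 + t) \<cdot>\<^sub>m (Q * C)) ((1 + t) \<cdot>\<^sub>m (Q * C)) + minner (G * C) (G * C)"
        by (rule minner_le_mean[OF QC GCc])
      also have "minner ((1 + t) \<cdot>\<^sub>m (Q * C)) ((1 + t) \<cdot>\<^sub>m (Q * C)) = (1 + t) * ((1 + t) * minner C C)"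
        using minner_isometry[OF Q C C] QCc by (simp add: minner_smult_left minner_smult_right[of _ n n])
      also have "(1 + t) * ((1 + t) * minner C C) + minner (G * C) (G * C) \<le> 2 * ((1 + t) * ((1 + t) * minner C C))"
        using GC unfolding power2_eq_square mult.assoc by linarith
      finally show ?thesis using t(1) by simp
    qed
    have QM: "2 * minner Q M \<le> 2 * real n"
      using minner_le_mean[OF Q(1) M] minner_self_orthonormal[OF Q] e0 by (simp add: e_def)
    have Q1: "2 * minner Q (1\<^sub>m n) \<le> 2 * real n"
      using minner_le_mean[OF Q(1) one] minner_self_orthonormal[OF Q] n11 by simp
    have "2 * minner ((-1) \<cdot>\<^sub>m M) (1\<^sub>m n) \<le> minner M M + real n"
      using minner_le_mean[OF _ one, of "(-1) \<cdot>\<^sub>m M"] M n11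
      by (simp add: minner_smult_left minner_smult_right[of _ n n])
    then have M1: "- 2 * minner M (1\<^sub>m n) \<le> 2 * real n" using e0 by (simp add: minner_smult_left e_def)
    have QGe: "minner Q G = minner Q M + t * minner Q (1\<^sub>m n)"
      unfolding G_def using Q M by (simp add: minner_add_right[of _ n n] minner_smult_right[of _ n n])
    have GGe: "minner G G = minner M M + t * (2 * minner M (1\<^sub>m n)) + t\<^sup>2 * real n"
      unfolding G_def using M minner_comm[OF M one] n11
      by (simp add: minner_add_left[of _ n n] minner_add_right[of _ n n] minner_smult_left
            minner_smult_right[of _ n n] power2_eq_square distrib_left)
    have a1: "t * (- 2 * minner M (1\<^sub>m n)) \<le> t * (2 * real n)" using M1 t by (intro mult_left_mono) auto
    have a2: "(1 + t) * (t * minner Q (1\<^sub>m n)) \<le> 2 * (t * real n)"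
    proof -
      have "t * minner Q (1\<^sub>m n) \<le> t * real n" using Q1 t by (intro mult_left_mono) auto
      then have "(1 + t) * (t * minner Q (1\<^sub>m n)) \<le> (1 + t) * (t * real n)" using t by (intro mult_left_mono) auto
      also have "\<dots> \<le> 2 * (t * real n)" using t t1 by (intro mult_right_mono) auto
      finally show ?thesis .
    qed
    have a3: "t * minner Q M \<le> t * real n" using QM t by (intro mult_left_mono) auto
    have h: "minner M M + t * (2 * minner M (1\<^sub>m n)) + t\<^sup>2 * real n \<le>
      minner Q M + t * minner Q M + (1 + t) * (t * minner Q (1\<^sub>m n))"
      using GGC unfolding QG[symmetric] QGe GGe by (simp add: algebra_simps)
    have "minner M M - 5 * (t * real n) \<le> minner Q M"
    proof -
      have "0 \<le> t\<^sup>2 * real n" by simp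
      then show ?thesis using a1 a2 a3 h by argo
    qed
    then have "2 * real n - 2 * minner Q M \<le> 4 * e" using te by (simp add: e_def)
    then show ?thesis using that[OF Q] dist[OF Q] e by simp
  qed
qed

lemma sum_Cauchy_Schwarz:
  fixes f g :: "nat \<Rightarrow> real"
  shows "(\<Sum>a<n. f a * g a)\<^sup>2 \<le> (\<Sum>a<n. (f a)\<^sup>2) * (\<Sum>a<n. (g a)\<^sup>2)"
  using minner_Cauchy_Schwarz[of "mat 1 n (\<lambda>(_, a). f a)" 1 n "mat 1 n (\<lambda>(_, a). g a)"]
  by (simp add: minner_def power2_eq_square)

section \<open>Multi-indices\<close>

text \<open>Ranges of modes are written from \<open>Suc j\<close> to \<open>j + l\<close> to avoid
  subtraction; position \<open>k\<close> of the list, counted from 0, belongs to mode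
  \<open>Suc (j + k)\<close>.\<close>

lemma multi_idx_iff:
  "s \<in> multi_idx d (Suc j) (j + l) \<longleftrightarrow> length s = l \<and> (\<forall>k<l. s ! k < d (Suc (j + k)))"
  unfolding multi_idx_def multi_idx_list_def product_lists_set
  by (auto simp: list_all2_conv_all_nth simp del: upt_Suc)

lemma finite_multi_idx [simp]: "finite (multi_idx d a b)"
  by (simp add: multi_idx_def)

lemma multi_idx_empty: "multi_idx d (Suc j) j = {[]}"
  using multi_idx_iff[of _ d j 0] by auto

lemma multi_idx_single: "multi_idx d (Suc j) (Suc j) = (\<lambda>x. [x]) ` {..<d (Suc j)}"
proof (rule Set.set_eqI, rule iffI)
  fix s assume "s \<in> multi_idx d (Suc j) (Suc j)"
  then have s: "length s = 1" "s ! 0 < d (Suc j)" using multi_idx_iff[of s d j 1] by simp_all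
  then have "s = [s ! 0]" by (cases s) auto
  then show "s \<in> (\<lambda>x. [x]) ` {..<d (Suc j)}" using s(2) by blast
next
  fix s assume "s \<in> (\<lambda>x. [x]) ` {..<d (Suc j)}"
  then show "s \<in> multi_idx d (Suc j) (Suc j)" using multi_idx_iff[of s d j 1] by auto
qed

lemma multi_idx_append:
  assumes s: "s \<in> multi_idx d (Suc j) (j + k)" and t: "t \<in> multi_idx d (Suc (j + k)) (j + k + l)"
  shows "s @ t \<in> multi_idx d (Suc j) (j + k + l)"
proof -
  have len: "length s = k" "length t = l" using s t by (auto simp: multi_idx_iff)
  have "(s @ t) ! i < d (Suc (j + i))" if i: "i < k + l" for i
  proof (cases "i < k")
    case True
    then show ?thesis using s by (simp add: multi_idx_iff nth_append)
  next
    case False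
    then have "i - k < l" using i by simp
    then have "t ! (i - k) < d (Suc (j + k + (i - k)))" using t unfolding multi_idx_iff by blast
    moreover have "j + k + (i - k) = j + i" using False by simp
    ultimately show ?thesis using False len by (metis nth_append)
  qed
  then show ?thesis using len multi_idx_iff[of "s @ t" d j "k + l"] by (simp add: add.assoc)
qed

lemma multi_idx_split:
  assumes s: "s \<in> multi_idx d (Suc j) (j + k + l)"
  shows "take k s \<in> multi_idx d (Suc j) (j + k)" "drop k s \<in> multi_idx d (Suc (j + k)) (j + k + l)"
proof -
  have s': "length s = k + l" "\<And>i. i < k + l \<Longrightarrow> s ! i < d (Suc (j + i))"
    using s multi_idx_iff[of s d j "k + l"] by (simp_all add: add.assoc)
  show "take k s \<in> multi_idx d (Suc j) (j + k)" using s' by (simp add: multi_idx_iff)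
  have "s ! (k + i) < d (Suc (j + k + i))" if "i < l" for i
    using s'(2)[of "k + i"] that by (simp add: add.assoc)
  then show "drop k s \<in> multi_idx d (Suc (j + k)) (j + k + l)" using s'(1) by (simp add: multi_idx_iff)
qed

lemma sum_multi_idx_append:
  fixes f :: "nat list \<Rightarrow> real"
  assumes "j \<le> k" "k \<le> l"
  shows "(\<Sum>s\<in>multi_idx d (Suc j) l. f s) =
    (\<Sum>s\<in>multi_idx d (Suc j) k. \<Sum>t\<in>multi_idx d (Suc k) l. f (s @ t))"
proof -
  obtain a b where k: "k = j + a" and l: "l = j + a + b"
    using assms by (metis le_Suc_ex)
  have "(\<Sum>s\<in>multi_idx d (Suc j) k. \<Sum>t\<in>multi_idx d (Suc k) l. f (s @ t)) =
    (\<Sum>(s, t)\<in>multi_idx d (Suc j) k \<times> multi_idx d (Suc k) l. f (s @ t))"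
    by (simp add: sum.cartesian_product)
  also have "\<dots> = (\<Sum>s\<in>multi_idx d (Suc j) l. f s)"
  proof (rule sum.reindex_bij_witness[where i = "\<lambda>s. (take a s, drop a s)" and j = "\<lambda>(s, t). s @ t"])
    fix s assume s: "s \<in> multi_idx d (Suc j) l"
    show "(\<lambda>(s, t). s @ t) (take a s, drop a s) = s" by simp
    show "(take a s, drop a s) \<in> multi_idx d (Suc j) k \<times> multi_idx d (Suc k) l"
      using multi_idx_split[of s d j a b] s by (simp add: k l)
  next
    fix st assume st: "st \<in> multi_idx d (Suc j) k \<times> multi_idx d (Suc k) l"
    then show "(\<lambda>(s, t). s @ t) st \<in> multi_idx d (Suc j) l"
      using multi_idx_append by (auto simp: k l)
    have "length (fst st) = a" using st by (auto simp: k multi_idx_iff)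
    then show "(take a ((\<lambda>(s, t). s @ t) st), drop a ((\<lambda>(s, t). s @ t) st)) = st"
      by (auto simp: case_prod_beta)
  qed (auto simp: case_prod_beta)
  finally show ?thesis ..
qed

lemma sum_multi_idx_single:
  fixes f :: "nat list \<Rightarrow> real"
  shows "(\<Sum>s\<in>multi_idx d (Suc j) (Suc j). f s) = (\<Sum>x<d (Suc j). f [x])"
  unfolding multi_idx_single by (subst sum.reindex) (auto simp: inj_on_def)

lemma sum_multi_idx_snoc:
  fixes f :: "nat list \<Rightarrow> real"
  shows "j \<le> k \<Longrightarrow> (\<Sum>s\<in>multi_idx d (Suc j) (Suc k). f s) =
    (\<Sum>s\<in>multi_idx d (Suc j) k. \<Sum>x<d (Suc k). f (s @ [x]))"
  by (subst sum_multi_idx_append[of j k]) (auto simp: sum_multi_idx_single)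

lemma distinct_multi_idx_list: "distinct (multi_idx_list d a b)"
  unfolding multi_idx_list_def by (rule distinct_product_lists) auto

lemma sum_multi_idx_list:
  fixes f :: "nat list \<Rightarrow> real"
  shows "(\<Sum>p<length (multi_idx_list d a b). f (multi_idx_list d a b ! p)) = (\<Sum>s\<in>multi_idx d a b. f s)"
  using sum_list_distinct_conv_sum_set[OF distinct_multi_idx_list[of d a b], of f]
  by (simp add: multi_idx_def sum_list_sum_nth lessThan_atLeast0)

section \<open>Products of slices\<close>

text \<open>\<open>seg r Y j [x\<^sub>1, \<dots>, x\<^sub>l] a b\<close> is the entry \<open>(a, b)\<close> of
  \<open>\<^bold>Y\<^sub>j\<^sub>+\<^sub>1(x\<^sub>1) \<dots> \<^bold>Y\<^sub>j\<^sub>+\<^sub>l(x\<^sub>l)\<close>.\<close>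

fun seg :: "(nat \<Rightarrow> nat) \<Rightarrow> factors \<Rightarrow> nat \<Rightarrow> nat list \<Rightarrow> nat \<Rightarrow> nat \<Rightarrow> real" where
  "seg r Y j [] a b = (if a = b then 1 else 0)"
| "seg r Y j (x # xs) a b = (\<Sum>c<r (Suc j). Y (Suc j) x $$ (a, c) * seg r Y (Suc j) xs c b)"

lemma seg_append:
  "a < r j \<Longrightarrow> seg r Y j (xs @ ys) a b =
    (\<Sum>c<r (j + length xs). seg r Y j xs a c * seg r Y (j + length xs) ys c b)"
proof (induction xs arbitrary: a j)
  case Nil
  have "(\<Sum>c<r j. seg r Y j [] a c * seg r Y j ys c b) = (\<Sum>c<r j. if c = a then seg r Y j ys c b else 0)"
    by (intro sum.cong) auto
  then show ?case using Nil by simp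
next
  case (Cons x xs)
  have "seg r Y j ((x # xs) @ ys) a b = (\<Sum>e<r (Suc j). \<Sum>c<r (Suc j + length xs).
    Y (Suc j) x $$ (a, e) * (seg r Y (Suc j) xs e c * seg r Y (Suc j + length xs) ys c b))"
    using Cons.IH[of _ "Suc j"] by (simp add: sum_distrib_left)
  also have "\<dots> = (\<Sum>c<r (Suc j + length xs). \<Sum>e<r (Suc j).
    Y (Suc j) x $$ (a, e) * (seg r Y (Suc j) xs e c * seg r Y (Suc j + length xs) ys c b))"
    by (rule sum.swap)
  finally show ?case by (simp add: sum_distrib_right mult.assoc)
qed

lemma seg_single: "b < r (Suc j) \<Longrightarrow> seg r Y j [x] a b = Y (Suc j) x $$ (a, b)"
proof -
  assume b: "b < r (Suc j)"
  have "seg r Y j [x] a b = (\<Sum>c<r (Suc j). if c = b then Y (Suc j) x $$ (a, c) else 0)"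
    unfolding seg.simps by (intro sum.cong) auto
  then show ?thesis using b by simp
qed

lemma seg_snoc:
  assumes "a < r j" "b < r (Suc (j + length xs))"
  shows "seg r Y j (xs @ [x]) a b =
    (\<Sum>c<r (j + length xs). seg r Y j xs a c * Y (Suc (j + length xs)) x $$ (c, b))"
  using assms by (subst seg_append) (auto simp: seg_single simp del: seg.simps)

lemma seg_cong:
  "(\<And>i. j < i \<Longrightarrow> i \<le> j + length xs \<Longrightarrow> Y i = Z i) \<Longrightarrow> seg r Y j xs a b = seg r Z j xs a b"
proof (induction xs arbitrary: a j)
  case (Cons x xs)
  have "seg r Y (Suc j) xs c b = seg r Z (Suc j) xs c b" for c
    using Cons.prems by (intro Cons.IH) auto
  moreover have "Y (Suc j) = Z (Suc j)" using Cons.prems by auto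
  ultimately show ?case by simp
qed simp

text \<open>Inner product of left unfoldings expressed in slices. It takes bare slice families, so a
  trial direction for one factor need not belong to a whole family.\<close>

definition fac_inner :: "(nat \<Rightarrow> nat) \<Rightarrow> (nat \<Rightarrow> nat) \<Rightarrow> nat \<Rightarrow> (nat \<Rightarrow> real mat) \<Rightarrow> (nat \<Rightarrow> real mat) \<Rightarrow> real"
  where "fac_inner d r i V W =
    (\<Sum>x<d i. \<Sum>a<r (i - 1). \<Sum>b<r i. V x $$ (a, b) * W x $$ (a, b))"

lemma sum_mult_split:
  fixes f :: "nat \<Rightarrow> real"
  shows "(\<Sum>p<m * n. f p) = (\<Sum>x<m. \<Sum>a<n. f (x * n + a))"
proof (induction m)
  case (Suc m)
  have "(\<Sum>p<Suc m * n. f p) = (\<Sum>p<m * n. f p) + (\<Sum>p\<in>{m * n..<m * n + n}. f p)"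
    by (subst sum.union_disjoint[symmetric]) (auto intro!: sum.cong)
  also have "(\<Sum>p\<in>{m * n..<m * n + n}. f p) = (\<Sum>a<n. f (m * n + a))"
    using sum.shift_bounds_nat_ivl[of f 0 "m * n" n] by (simp add: lessThan_atLeast0 add.commute)
  finally show ?case using Suc by simp
qed simp

lemma left_unfold_carrier [simp]: "left_unfold d r Y i \<in> carrier_mat (d i * r (i - 1)) (r i)"
  by (simp add: left_unfold_def)

lemma left_unfold_index:
  "x < d i \<Longrightarrow> a < r (i - 1) \<Longrightarrow> b < r i \<Longrightarrow> left_unfold d r Y i $$ (x * r (i - 1) + a, b) = Y i x $$ (a, b)"
proof -
  assume "x < d i" "a < r (i - 1)" "b < r i"
  moreover from this have "x * r (i - 1) + a < d i * r (i - 1)"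
    by (metis add.commute add_less_cancel_left less_le_trans mult_Suc mult_le_mono1 Suc_leI)
  ultimately show ?thesis by (simp add: left_unfold_def)
qed

lemma left_unfold_ext:
  assumes "A \<in> carrier_mat (d i * r (i - 1)) n" "B \<in> carrier_mat (d i * r (i - 1)) n"
    and "\<And>x a b. x < d i \<Longrightarrow> a < r (i - 1) \<Longrightarrow> b < n \<Longrightarrow>
      A $$ (x * r (i - 1) + a, b) = B $$ (x * r (i - 1) + a, b)"
  shows "A = B"
proof (rule eq_matI)
  fix p b assume "p < dim_row B" "b < dim_col B"
  then have p: "p < d i * r (i - 1)" "b < n" using assms by auto
  then have "p div r (i - 1) < d i" "p mod r (i - 1) < r (i - 1)"
    by (auto simp: less_mult_imp_div_less) (metis gr0I mod_less_divisor mult_0_right not_less_zero)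
  then show "A $$ (p, b) = B $$ (p, b)"
    using assms(3)[of "p div r (i - 1)" "p mod r (i - 1)" b] p by simp
qed (use assms in auto)

lemma minner_left_unfold:
  "minner (left_unfold d r Y i) (left_unfold d r Z i) = fac_inner d r i (Y i) (Z i)"
proof -
  have "minner (left_unfold d r Y i) (left_unfold d r Z i) =
    (\<Sum>p<d i * r (i - 1). \<Sum>b<r i. left_unfold d r Y i $$ (p, b) * left_unfold d r Z i $$ (p, b))"
    by (simp add: minner_def left_unfold_def)
  also have "\<dots> = fac_inner d r i (Y i) (Z i)"
    unfolding sum_mult_split fac_inner_def by (intro sum.cong refl) (simp add: left_unfold_index[unfolded One_nat_def])
  finally show ?thesis .
qed

lemma minner_left_unfold_mult:
  assumes "A \<in> carrier_mat (r i) 1" "B \<in> carrier_mat (r i) 1"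
  shows "minner (left_unfold d r Y i * A) (left_unfold d r Y i * B) =
    (\<Sum>x<d i. \<Sum>a<r (i - 1). (\<Sum>b<r i. Y i x $$ (a, b) * A $$ (b, 0)) * (\<Sum>b<r i. Y i x $$ (a, b) * B $$ (b, 0)))"
proof -
  have ent: "(left_unfold d r Y i * C) $$ (x * r (i - 1) + a, 0) = (\<Sum>b<r i. Y i x $$ (a, b) * C $$ (b, 0))"
    if "x < d i" "a < r (i - 1)" "C \<in> carrier_mat (r i) 1" for C x a
  proof -
    have "x * r (i - 1) + a < d i * r (i - 1)"
      using that by (metis add.commute add_less_cancel_left less_le_trans mult_Suc mult_le_mono1 Suc_leI)
    then have "(left_unfold d r Y i * C) $$ (x * r (i - 1) + a, 0) =
      (\<Sum>b<r i. left_unfold d r Y i $$ (x * r (i - 1) + a, b) * C $$ (b, 0))"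
      using that carrier_matD[OF left_unfold_carrier[of d r Y i]] by (simp add: scalar_prod_def lessThan_atLeast0)
    also have "\<dots> = (\<Sum>b<r i. Y i x $$ (a, b) * C $$ (b, 0))"
      using that by (intro sum.cong refl) (simp add: left_unfold_index[unfolded One_nat_def])
    finally show ?thesis .
  qed
  have "minner (left_unfold d r Y i * A) (left_unfold d r Y i * B) =
    (\<Sum>p<d i * r (i - 1). (left_unfold d r Y i * A) $$ (p, 0) * (left_unfold d r Y i * B) $$ (p, 0))"
    using assms carrier_matD[OF left_unfold_carrier[of d r Y i]] unfolding minner_def by simp
  also have "\<dots> = (\<Sum>x<d i. \<Sum>a<r (i - 1). (\<Sum>b<r i. Y i x $$ (a, b) * A $$ (b, 0)) * (\<Sum>b<r i. Y i x $$ (a, b) * B $$ (b, 0)))"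
    unfolding sum_mult_split using assms by (intro sum.cong refl) (simp add: ent[unfolded One_nat_def])
  finally show ?thesis .
qed

text \<open>A left-orthogonal factor acts as an isometry on coefficient vectors \<open>w\<close>,
  \<open>v\<close>, which is the form needed when interfaces grow by one mode.\<close>

lemma fac_orthogonal:
  assumes "(left_unfold d r Y i)\<^sup>T * left_unfold d r Y i = 1\<^sub>m (r i)"
  shows "(\<Sum>x<d i. \<Sum>a<r (i - 1). (\<Sum>b<r i. Y i x $$ (a, b) * w b) * (\<Sum>b<r i. Y i x $$ (a, b) * v b)) =
    (\<Sum>b<r i. w b * v b)"
  using minner_left_unfold_mult[of "mat (r i) 1 (\<lambda>(b, _). w b)" r i "mat (r i) 1 (\<lambda>(b, _). v b)" d Y]
    minner_isometry[OF left_unfold_carrier assms, of "mat (r i) 1 (\<lambda>(b, _). w b)" 1 "mat (r i) 1 (\<lambda>(b, _). v b)"]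
  by (simp add: minner_def)

lemma fac_bound:
  "(\<Sum>x<d i. \<Sum>a<r (i - 1). (\<Sum>b<r i. V x $$ (a, b) * w b)\<^sup>2) \<le> fac_inner d r i V V * (\<Sum>b<r i. (w b)\<^sup>2)"
proof -
  have "(\<Sum>x<d i. \<Sum>a<r (i - 1). (\<Sum>b<r i. V x $$ (a, b) * w b)\<^sup>2) \<le>
    (\<Sum>x<d i. \<Sum>a<r (i - 1). (\<Sum>b<r i. (V x $$ (a, b))\<^sup>2) * (\<Sum>b<r i. (w b)\<^sup>2))"
    by (intro sum_mono sum_Cauchy_Schwarz)
  then show ?thesis by (simp add: fac_inner_def sum_distrib_right power2_eq_square)
qed

section \<open>Interface bounds\<close>

text \<open>The left interface is the matrix of the first \<open>j\<close> modes, with rows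
  \<open>s\<close> and columns \<open>a\<close>; \<open>C\<close> bounds its squared operator norm.
  \<open>rbound\<close> is the analogue for the modes after \<open>j\<close>.\<close>

definition lbound :: "(nat \<Rightarrow> nat) \<Rightarrow> (nat \<Rightarrow> nat) \<Rightarrow> factors \<Rightarrow> nat \<Rightarrow> real \<Rightarrow> bool" where
  "lbound d r Y j C \<longleftrightarrow> (\<forall>w. (\<Sum>s\<in>multi_idx d 1 j. (\<Sum>a<r j. seg r Y 0 s 0 a * w a)\<^sup>2) \<le> C * (\<Sum>a<r j. (w a)\<^sup>2))"

definition rbound :: "nat \<Rightarrow> (nat \<Rightarrow> nat) \<Rightarrow> (nat \<Rightarrow> nat) \<Rightarrow> factors \<Rightarrow> nat \<Rightarrow> real \<Rightarrow> bool" where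
  "rbound N d r Y j M \<longleftrightarrow>
    (\<forall>u. (\<Sum>t\<in>multi_idx d (Suc j) N. (\<Sum>a<r j. u a * seg r Y j t a 0)\<^sup>2) \<le> M * (\<Sum>a<r j. (u a)\<^sup>2))"

lemma lbound_cong:
  assumes "lbound d r Y j C" "\<And>i. 1 \<le> i \<Longrightarrow> i \<le> j \<Longrightarrow> Y i = Z i"
  shows "lbound d r Z j C"
proof -
  have "seg r Z 0 s 0 a = seg r Y 0 s 0 a" if "s \<in> multi_idx d 1 j" for s a
    using that multi_idx_iff[of s d 0 j] assms(2) by (intro seg_cong) auto
  then show ?thesis using assms(1) unfolding lbound_def by (auto cong: sum.cong)
qed

lemma rbound_cong:
  assumes "rbound N d r Y j M" "j \<le> N" "\<And>i. j < i \<Longrightarrow> i \<le> N \<Longrightarrow> Y i = Z i"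
  shows "rbound N d r Z j M"
proof -
  have "seg r Z j s a 0 = seg r Y j s a 0" if "s \<in> multi_idx d (Suc j) N" for s a
    using that multi_idx_iff[of s d j "N - j"] assms(2,3) by (intro seg_cong) auto
  then show ?thesis using assms(1) unfolding rbound_def by (auto cong: sum.cong)
qed

lemma seg_left_snoc_sum:
  assumes "r 0 = 1" "s \<in> multi_idx d 1 j"
  shows "(\<Sum>b<r (Suc j). seg r Y 0 (s @ [x]) 0 b * w b) =
    (\<Sum>a<r j. seg r Y 0 s 0 a * (\<Sum>b<r (Suc j). Y (Suc j) x $$ (a, b) * w b))"
proof -
  have len: "length s = j" using assms(2) multi_idx_iff[of s d 0 j] by simp
  have "(\<Sum>b<r (Suc j). seg r Y 0 (s @ [x]) 0 b * w b) =
    (\<Sum>b<r (Suc j). \<Sum>a<r j. seg r Y 0 s 0 a * (Y (Suc j) x $$ (a, b) * w b))"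
  proof (intro sum.cong refl)
    fix b assume "b \<in> {..<r (Suc j)}"
    then have "seg r Y 0 (s @ [x]) 0 b = (\<Sum>a<r j. seg r Y 0 s 0 a * Y (Suc j) x $$ (a, b))"
      using seg_snoc[of 0 r 0 b s Y x] assms(1) len by simp
    then show "seg r Y 0 (s @ [x]) 0 b * w b = (\<Sum>a<r j. seg r Y 0 s 0 a * (Y (Suc j) x $$ (a, b) * w b))"
      by (simp add: sum_distrib_right mult.assoc)
  qed
  also have "\<dots> = (\<Sum>a<r j. \<Sum>b<r (Suc j). seg r Y 0 s 0 a * (Y (Suc j) x $$ (a, b) * w b))"
    by (rule sum.swap)
  finally show ?thesis by (simp add: sum_distrib_left)
qed

text \<open>Submultiplicativity: appending a factor first applies its slices to \<open>w\<close> and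
  then the shorter interface to each result.\<close>

lemma lbound_Suc:
  assumes r0: "r 0 = 1" and L: "lbound d r Y j C" "0 \<le> C"
    and step: "\<And>w. (\<Sum>x<d (Suc j). \<Sum>a<r j. (\<Sum>b<r (Suc j). Y (Suc j) x $$ (a, b) * w b)\<^sup>2) \<le> c * (\<Sum>b<r (Suc j). (w b)\<^sup>2)"
  shows "lbound d r Y (Suc j) (C * c)"
  unfolding lbound_def
proof
  fix w
  define v where "v x a = (\<Sum>b<r (Suc j). Y (Suc j) x $$ (a, b) * w b)" for x a
  have "(\<Sum>s\<in>multi_idx d 1 (Suc j). (\<Sum>a<r (Suc j). seg r Y 0 s 0 a * w a)\<^sup>2) =
    (\<Sum>s\<in>multi_idx d 1 j. \<Sum>x<d (Suc j). (\<Sum>a<r j. seg r Y 0 s 0 a * v x a)\<^sup>2)"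
    using sum_multi_idx_snoc[of 0 j] seg_left_snoc_sum[of r, OF r0]
    unfolding v_def One_nat_def by (simp cong: sum.cong)
  also have "\<dots> = (\<Sum>x<d (Suc j). \<Sum>s\<in>multi_idx d 1 j. (\<Sum>a<r j. seg r Y 0 s 0 a * v x a)\<^sup>2)"
    by (rule sum.swap)
  also have "\<dots> \<le> (\<Sum>x<d (Suc j). C * (\<Sum>a<r j. (v x a)\<^sup>2))"
    using L unfolding lbound_def by (intro sum_mono) auto
  also have "\<dots> = C * (\<Sum>x<d (Suc j). \<Sum>a<r j. (v x a)\<^sup>2)" by (simp add: sum_distrib_left)
  also have "\<dots> \<le> C * (c * (\<Sum>b<r (Suc j). (w b)\<^sup>2))"
    unfolding v_def using L(2) step by (intro mult_left_mono) auto
  finally show "(\<Sum>s\<in>multi_idx d 1 (Suc j). (\<Sum>a<r (Suc j). seg r Y 0 s 0 a * w a)\<^sup>2) \<le>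
    C * c * (\<Sum>a<r (Suc j). (w a)\<^sup>2)" by (simp add: mult.assoc)
qed

text \<open>Isometries compose: peeling off the last mode reduces the claim to the shorter interface
  and to left-orthogonality of one factor.\<close>

lemma left_interface_orthonormal:
  assumes r0: "r 0 = 1"
    and orth: "\<And>i. 1 \<le> i \<Longrightarrow> i \<le> j \<Longrightarrow> (left_unfold d r Y i)\<^sup>T * left_unfold d r Y i = 1\<^sub>m (r i)"
  shows "(\<Sum>s\<in>multi_idx d 1 j. (\<Sum>a<r j. seg r Y 0 s 0 a * w a) * (\<Sum>a<r j. seg r Y 0 s 0 a * v a)) =
    (\<Sum>a<r j. w a * v a)"
  using orth
proof (induction j arbitrary: w v)
  case 0
  then show ?case using r0 multi_idx_empty[of d 0] by simp
next
  case (Suc j)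
  define W where "W w x a = (\<Sum>b<r (Suc j). Y (Suc j) x $$ (a, b) * w b)" for w x a
  have "(\<Sum>s\<in>multi_idx d 1 (Suc j). (\<Sum>a<r (Suc j). seg r Y 0 s 0 a * w a) * (\<Sum>a<r (Suc j). seg r Y 0 s 0 a * v a)) =
    (\<Sum>s\<in>multi_idx d 1 j. \<Sum>x<d (Suc j). (\<Sum>a<r j. seg r Y 0 s 0 a * W w x a) * (\<Sum>a<r j. seg r Y 0 s 0 a * W v x a))"
    using sum_multi_idx_snoc[of 0 j] seg_left_snoc_sum[of r, OF r0]
    unfolding W_def One_nat_def by (simp cong: sum.cong)
  also have "\<dots> = (\<Sum>x<d (Suc j). \<Sum>s\<in>multi_idx d 1 j. (\<Sum>a<r j. seg r Y 0 s 0 a * W w x a) * (\<Sum>a<r j. seg r Y 0 s 0 a * W v x a))"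
    by (rule sum.swap)
  also have "\<dots> = (\<Sum>x<d (Suc j). \<Sum>a<r j. W w x a * W v x a)"
    using Suc by (intro sum.cong refl) auto
  also have "\<dots> = (\<Sum>a<r (Suc j). w a * v a)"
    unfolding W_def using fac_orthogonal[of d r Y "Suc j" w v] Suc.prems by simp
  finally show ?case .
qed

lemma lbound_orthonormal:
  assumes "r 0 = 1"
    and "\<And>i. 1 \<le> i \<Longrightarrow> i \<le> j \<Longrightarrow> (left_unfold d r Y i)\<^sup>T * left_unfold d r Y i = 1\<^sub>m (r i)"
  shows "lbound d r Y j 1"
  using left_interface_orthonormal[of r j d Y, OF assms] by (simp add: lbound_def power2_eq_square)

lemma rbound_N: "r N = 1 \<Longrightarrow> rbound N d r Y N 1"
  by (simp add: rbound_def multi_idx_empty)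

text \<open>The Frobenius norm of a product is at most the operator norms of the outer matrices
  times the Frobenius norm of the middle one; the middle one is the factor of mode
  \<open>Suc j\<close>.\<close>

lemma seg_norm_bound:
  assumes r0: "r 0 = 1" and j: "j < N"
    and L: "lbound d r Y j C" "0 \<le> C" and R: "rbound N d r Y (Suc j) M" "0 \<le> M"
  shows "(\<Sum>s\<in>multi_idx d 1 N. (seg r Y 0 s 0 0)\<^sup>2) \<le> C * M * fac_inner d r (Suc j) (Y (Suc j)) (Y (Suc j))"
proof -
  define u where "u s b = seg r Y 0 s 0 b" for s b
  have "(\<Sum>s\<in>multi_idx d 1 N. (seg r Y 0 s 0 0)\<^sup>2) =
    (\<Sum>s\<in>multi_idx d 1 (Suc j). \<Sum>t\<in>multi_idx d (Suc (Suc j)) N. (seg r Y 0 (s @ t) 0 0)\<^sup>2)"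
    using sum_multi_idx_append[of 0 "Suc j" N] j by simp
  also have "\<dots> = (\<Sum>s\<in>multi_idx d 1 (Suc j). \<Sum>t\<in>multi_idx d (Suc (Suc j)) N.
    (\<Sum>b<r (Suc j). u s b * seg r Y (Suc j) t b 0)\<^sup>2)"
  proof (intro sum.cong refl)
    fix s t assume "s \<in> multi_idx d 1 (Suc j)"
    then have "length s = Suc j" using multi_idx_iff[of s d 0 "Suc j"] by simp
    then show "(seg r Y 0 (s @ t) 0 0)\<^sup>2 = (\<Sum>b<r (Suc j). u s b * seg r Y (Suc j) t b 0)\<^sup>2"
      using seg_append[of 0 r 0 Y s t 0] r0 by (simp add: u_def)
  qed
  also have "\<dots> \<le> (\<Sum>s\<in>multi_idx d 1 (Suc j). M * (\<Sum>b<r (Suc j). (u s b)\<^sup>2))"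
    using R unfolding rbound_def by (intro sum_mono) auto
  also have "\<dots> = M * (\<Sum>s\<in>multi_idx d 1 (Suc j). \<Sum>b<r (Suc j). (u s b)\<^sup>2)"
    by (simp add: sum_distrib_left)
  also have "(\<Sum>s\<in>multi_idx d 1 (Suc j). \<Sum>b<r (Suc j). (u s b)\<^sup>2) =
    (\<Sum>s\<in>multi_idx d 1 j. \<Sum>x<d (Suc j). \<Sum>b<r (Suc j). (u (s @ [x]) b)\<^sup>2)"
    using sum_multi_idx_snoc[of 0 j] by simp
  also have "\<dots> = (\<Sum>s\<in>multi_idx d 1 j. \<Sum>x<d (Suc j). \<Sum>b<r (Suc j).
    (\<Sum>a<r j. seg r Y 0 s 0 a * Y (Suc j) x $$ (a, b))\<^sup>2)"
  proof (intro sum.cong refl)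
    fix s x b assume "s \<in> multi_idx d 1 j" and b: "b \<in> {..<r (Suc j)}"
    then have "length s = j" using multi_idx_iff[of s d 0 j] by simp
    then show "(u (s @ [x]) b)\<^sup>2 = (\<Sum>a<r j. seg r Y 0 s 0 a * Y (Suc j) x $$ (a, b))\<^sup>2"
      using seg_snoc[of 0 r 0 b s Y x] r0 b by (simp add: u_def)
  qed
  also have "\<dots> = (\<Sum>x<d (Suc j). \<Sum>b<r (Suc j). \<Sum>s\<in>multi_idx d 1 j.
    (\<Sum>a<r j. seg r Y 0 s 0 a * Y (Suc j) x $$ (a, b))\<^sup>2)"
    by (subst sum.swap) (intro sum.cong refl sum.swap)
  also have "\<dots> \<le> (\<Sum>x<d (Suc j). \<Sum>b<r (Suc j). C * (\<Sum>a<r j. (Y (Suc j) x $$ (a, b))\<^sup>2))"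
    using L unfolding lbound_def by (intro sum_mono) auto
  also have "\<dots> = C * fac_inner d r (Suc j) (Y (Suc j)) (Y (Suc j))"
  proof -
    have "(\<Sum>b<r (Suc j). \<Sum>a<r j. (Y (Suc j) x $$ (a, b))\<^sup>2) = (\<Sum>a<r j. \<Sum>b<r (Suc j). (Y (Suc j) x $$ (a, b))\<^sup>2)" for x
      by (rule sum.swap)
    then show ?thesis by (simp add: fac_inner_def sum_distrib_left[symmetric] power2_eq_square)
  qed
  finally have "(\<Sum>s\<in>multi_idx d 1 N. (seg r Y 0 s 0 0)\<^sup>2) \<le> M * (C * fac_inner d r (Suc j) (Y (Suc j)) (Y (Suc j)))"
    using R(2) by (simp add: mult_left_mono)
  then show ?thesis by (simp add: mult_ac)
qed

lemma multi_idx_1_iff: "s \<in> multi_idx d 1 N \<longleftrightarrow> length s = N \<and> (\<forall>k<N. s ! k < d (Suc k))"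
  using multi_idx_iff[of s d 0 N] by simp

lemma tt_factors_carrier:
  assumes "tt_factors N d r Y" "j < N" "x < d (Suc j)"
  shows "Y (Suc j) x \<in> carrier_mat (r j) (r (Suc j))"
proof -
  have "Suc j \<in> {1..N}" using assms(2) by auto
  then have "Y (Suc j) x \<in> carrier_mat (r (Suc j - 1)) (r (Suc j))"
    using assms unfolding tt_factors_def by blast
  then show ?thesis by simp
qed

lemma tt_tensor_seg:
  assumes Y: "tt_factors N d r Y" and r: "r 0 = 1" "r N = 1" and s: "s \<in> multi_idx d 1 N"
  shows "tt_tensor N d Y s = seg r Y 0 s 0 0"
proof -
  have len: "length s = N" and sd: "\<And>k. k < N \<Longrightarrow> s ! k < d (Suc k)" using s by (auto simp: multi_idx_1_iff[unfolded One_nat_def])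
  define F where "F j = foldr (\<lambda>i M. Y i (s ! (i - 1)) * M) [Suc j..<Suc N] (1\<^sub>m 1)" for j
  \<comment> \<open>The product is accumulated from its last factor, so the induction runs downwards
    from \<open>N\<close>.\<close>
  have "F j \<in> carrier_mat (r j) 1 \<and> (\<forall>a<r j. F j $$ (a, 0) = seg r Y j (drop j s) a 0)" if "j \<le> N" for j
    using that
  proof (induction j rule: inc_induct)
    case base
    then show ?case using r len by (simp add: F_def)
  next
    case (step j)
    have "F j = Y (Suc j) (s ! j) * F (Suc j)"
      using step(2) by (simp add: F_def upt_conv_Cons del: upt_Suc)
    moreover have "Y (Suc j) (s ! j) \<in> carrier_mat (r j) (r (Suc j))"
      using tt_factors_carrier[OF Y] sd[of j] step(2) by auto
    moreover have "drop j s = s ! j # drop (Suc j) s"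
      using step(2) len by (simp add: Cons_nth_drop_Suc)
    ultimately show ?case using step(3)
      by (auto simp: scalar_prod_def lessThan_atLeast0 intro!: sum.cong)
  qed
  from this[of 0] show ?thesis using s r by (simp add: tt_tensor_def F_def)
qed

lemma tensor_norm_sq: "(tensor_norm N d X)\<^sup>2 = (\<Sum>s\<in>multi_idx d 1 N. (X s)\<^sup>2)"
  unfolding tensor_norm_def by (intro real_sqrt_pow2 sum_nonneg) auto

lemma seg_split_at:
  assumes r0: "r 0 = 1" and s: "s \<in> multi_idx d 1 N" and i: "1 \<le> i" "i \<le> N"
  shows "seg r Y 0 s 0 0 = (\<Sum>a<r (i - 1). \<Sum>b<r i.
    seg r Y 0 (take (i - 1) s) 0 a * Y i (s ! (i - 1)) $$ (a, b) * seg r Y i (drop i s) b 0)"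
proof -
  obtain j where j: "i = Suc j" using i by (cases i) auto
  have len: "length s = N" using s by (simp add: multi_idx_1_iff[unfolded One_nat_def])
  have "s = take j s @ (s ! j # drop (Suc j) s)"
    using i len j by (simp add: Cons_nth_drop_Suc)
  then have "seg r Y 0 s 0 0 = seg r Y 0 (take j s @ (s ! j # drop (Suc j) s)) 0 0" by simp
  also have "\<dots> = (\<Sum>a<r j. seg r Y 0 (take j s) 0 a * (\<Sum>b<r (Suc j). Y (Suc j) (s ! j) $$ (a, b) * seg r Y (Suc j) (drop (Suc j) s) b 0))"
    using i len j r0 by (subst seg_append) auto
  finally show ?thesis by (simp add: j sum_distrib_left mult.assoc)
qed

lemma seg_upd_split_at:
  assumes r0: "r 0 = 1" and s: "s \<in> multi_idx d 1 N" and i: "1 \<le> i" "i \<le> N"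
  shows "seg r (Y(i := V)) 0 s 0 0 = (\<Sum>a<r (i - 1). \<Sum>b<r i.
    seg r Y 0 (take (i - 1) s) 0 a * V (s ! (i - 1)) $$ (a, b) * seg r Y i (drop i s) b 0)"
proof -
  have "seg r (Y(i := V)) 0 (take (i - 1) s) 0 a = seg r Y 0 (take (i - 1) s) 0 a" for a
    using i by (intro seg_cong) auto
  moreover have "seg r (Y(i := V)) i (drop i s) b 0 = seg r Y i (drop i s) b 0" for b
    by (intro seg_cong) auto
  ultimately show ?thesis unfolding seg_split_at[of r, OF assms] by simp
qed

text \<open>Linearity of the tensor in its factor of mode \<open>i\<close>, stated entrywise so that
  the slices need no carrier conditions.\<close>

lemma seg_upd_diff:
  assumes r0: "r 0 = 1" and s: "s \<in> multi_idx d 1 N" and i: "1 \<le> i" "i \<le> N"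
    and eq: "\<And>x a b. x < d i \<Longrightarrow> a < r (i - 1) \<Longrightarrow> b < r i \<Longrightarrow> U x $$ (a, b) = V x $$ (a, b) - c * W x $$ (a, b)"
  shows "seg r (Y(i := U)) 0 s 0 0 = seg r (Y(i := V)) 0 s 0 0 - c * seg r (Y(i := W)) 0 s 0 0"
proof -
  have "s ! (i - 1) < d i" using s i unfolding multi_idx_1_iff by (metis Suc_diff_1 Suc_le_lessD diff_less le_less_trans less_imp_diff_less less_one not_less_eq not_le order_less_le_trans One_nat_def Suc_le_eq)
  then have "p * U (s ! (i - 1)) $$ (a, b) * q = p * V (s ! (i - 1)) $$ (a, b) * q - c * (p * W (s ! (i - 1)) $$ (a, b) * q)"
    if "a < r (i - 1)" "b < r i" for a b p q
    unfolding eq[OF \<open>s ! (i - 1) < d i\<close> that] by (simp add: algebra_simps)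
  then show ?thesis
    unfolding seg_upd_split_at[of r, OF r0 s i] sum_distrib_left sum_subtractf[symmetric]
    by (intro sum.cong refl) auto
qed

section \<open>The subgradient as a Riesz representative\<close>

lemma foldr_transpose_seg:
  assumes Y: "tt_factors N d r Y" and s: "s \<in> multi_idx d 1 N"
    and M: "M \<in> carrier_mat (r j) c" and l: "j + l \<le> N"
  shows "foldr (\<lambda>i M. (Y i (s ! (i - 1)))\<^sup>T * M) (rev [Suc j..<Suc (j + l)]) M \<in> carrier_mat (r (j + l)) c \<and>
    (\<forall>a<r (j + l). \<forall>b<c. foldr (\<lambda>i M. (Y i (s ! (i - 1)))\<^sup>T * M) (rev [Suc j..<Suc (j + l)]) M $$ (a, b) =
      (\<Sum>e<r j. seg r Y j (take l (drop j s)) e a * M $$ (e, b)))"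
  using l
proof (induction l)
  case 0
  have "(\<Sum>e<r j. (if e = a then 1 else 0) * M $$ (e, b)) = M $$ (a, b)" if "a < r j" for a b
    using that by (simp add: if_distrib[of "\<lambda>x. x * _"] cong: if_cong)
  then show ?case using M by simp
next
  case (Suc l)
  define F where "F = foldr (\<lambda>i M. (Y i (s ! (i - 1)))\<^sup>T * M) (rev [Suc j..<Suc (j + l)]) M"
  have IH: "F \<in> carrier_mat (r (j + l)) c"
    "\<And>a b. a < r (j + l) \<Longrightarrow> b < c \<Longrightarrow> F $$ (a, b) = (\<Sum>e<r j. seg r Y j (take l (drop j s)) e a * M $$ (e, b))"
    using Suc unfolding F_def by auto
  have len: "length s = N" using s by (simp add: multi_idx_1_iff[unfolded One_nat_def])
  have eq: "foldr (\<lambda>i M. (Y i (s ! (i - 1)))\<^sup>T * M) (rev [Suc j..<Suc (j + Suc l)]) M =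
    (Y (Suc (j + l)) (s ! (j + l)))\<^sup>T * F"
    by (simp add: F_def)
  have "s ! (j + l) < d (Suc (j + l))" using s Suc.prems by (auto simp: multi_idx_1_iff[unfolded One_nat_def])
  then have Yc: "Y (Suc (j + l)) (s ! (j + l)) \<in> carrier_mat (r (j + l)) (r (Suc (j + l)))"
    using Y Suc.prems unfolding tt_factors_def by (metis Suc_le_eq add_Suc_right atLeastAtMost_iff diff_Suc_1 le_add1 plus_1_eq_Suc add.commute)
  have tk: "take (Suc l) (drop j s) = take l (drop j s) @ [s ! (j + l)]"
    using Suc.prems len by (simp add: take_Suc_conv_app_nth)
  have ltk: "length (take l (drop j s)) = l" using Suc.prems len by simp
  show ?case unfolding eq
  proof (intro conjI allI impI)
    show "(Y (Suc (j + l)) (s ! (j + l)))\<^sup>T * F \<in> carrier_mat (r (j + Suc l)) c"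
      using Yc IH by auto
    fix a b assume a: "a < r (j + Suc l)" and b: "b < c"
    have "((Y (Suc (j + l)) (s ! (j + l)))\<^sup>T * F) $$ (a, b) =
      (\<Sum>f<r (j + l). Y (Suc (j + l)) (s ! (j + l)) $$ (f, a) * F $$ (f, b))"
      using Yc IH(1) a b by (simp add: scalar_prod_def lessThan_atLeast0)
    also have "\<dots> = (\<Sum>f<r (j + l). \<Sum>e<r j. seg r Y j (take l (drop j s)) e f * Y (Suc (j + l)) (s ! (j + l)) $$ (f, a) * M $$ (e, b))"
      using IH(2) b by (simp add: sum_distrib_left mult_ac)
    also have "\<dots> = (\<Sum>e<r j. \<Sum>f<r (j + l). seg r Y j (take l (drop j s)) e f * Y (Suc (j + l)) (s ! (j + l)) $$ (f, a) * M $$ (e, b))"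
      by (rule sum.swap)
    also have "\<dots> = (\<Sum>e<r j. seg r Y j (take (Suc l) (drop j s)) e a * M $$ (e, b))"
    proof (intro sum.cong refl)
      fix e assume "e \<in> {..<r j}"
      then show "(\<Sum>f<r (j + l). seg r Y j (take l (drop j s)) e f * Y (Suc (j + l)) (s ! (j + l)) $$ (f, a) * M $$ (e, b)) =
        seg r Y j (take (Suc l) (drop j s)) e a * M $$ (e, b)"
        using seg_snoc[of e r j a "take l (drop j s)" Y "s ! (j + l)"] a
        unfolding tk ltk by (simp add: sum_distrib_right)
    qed
    finally show "((Y (Suc (j + l)) (s ! (j + l)))\<^sup>T * F) $$ (a, b) =
      (\<Sum>e<r j. seg r Y j (take (Suc l) (drop j s)) e a * M $$ (e, b))" .
  qed
qed

text \<open>The left and the right group of transposed slices meet in a dimension equal to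
  \<open>r 0 = r N = 1\<close>. Their product is thus an outer product of the two interface vectors
  around mode \<open>i\<close>.\<close>

lemma grad_prod_index:
  assumes Y: "tt_factors N d r Y" and r: "r 0 = 1" "r N = 1" and s: "s \<in> multi_idx d 1 N"
    and i: "1 \<le> i" "i \<le> N" and ab: "a < r (i - 1)" "b < r i"
  shows "grad_prod r Y N i s $$ (a, b) = seg r Y 0 (take (i - 1) s) 0 a * seg r Y i (drop i s) b 0"
proof -
  have len: "length s = N" using s by (simp add: multi_idx_1_iff[unfolded One_nat_def])
  define F where "F = foldr (\<lambda>i M. (Y i (s ! (i - 1)))\<^sup>T * M) (rev [Suc i..<Suc N]) (1\<^sub>m (r i))"
  have F: "F \<in> carrier_mat (r 0) (r i)" "F $$ (0, b) = seg r Y i (drop i s) b 0"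
  proof -
    note f = foldr_transpose_seg[OF Y s one_carrier_mat[of "r i"], of "N - i"]
    show "F \<in> carrier_mat (r 0) (r i)" using f i r by (simp add: F_def del: upt_Suc)
    have "F $$ (0, b) = (\<Sum>e<r i. seg r Y i (take (N - i) (drop i s)) e 0 * 1\<^sub>m (r i) $$ (e, b))"
      using f i r ab by (simp add: F_def del: upt_Suc)
    also have "\<dots> = (\<Sum>e<r i. if e = b then seg r Y i (drop i s) e 0 else 0)"
      using len ab by (intro sum.cong refl) auto
    finally show "F $$ (0, b) = seg r Y i (drop i s) b 0" using ab by simp
  qed
  have "grad_prod r Y N i s = foldr (\<lambda>i M. (Y i (s ! (i - 1)))\<^sup>T * M) (rev [Suc 0..<Suc (0 + (i - 1))]) F"
    using i by (simp add: grad_prod_def F_def del: upt_Suc)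
  then show ?thesis
    using foldr_transpose_seg[OF Y s F(1), of "i - 1"] i ab F(2) r(1) by (simp del: upt_Suc)
qed

text \<open>The adjoint measurement map applied to \<open>g\<close>, scaled by \<open>1 / m\<close>
  and paired with \<open>T\<close>. For \<open>g\<close> the signs of the residuals this is a
  subgradient of the loss on full tensors.\<close>

definition dual_sum :: "nat \<Rightarrow> (nat \<Rightarrow> nat) \<Rightarrow> nat \<Rightarrow> (nat \<Rightarrow> tensor) \<Rightarrow> (nat \<Rightarrow> real) \<Rightarrow> tensor \<Rightarrow> real" where
  "dual_sum N d m A g T = 1 / real m * (\<Sum>k<m. g k * tensor_inner N d (A k) T)"

lemma tensor_inner_cong:
  "(\<And>s. s \<in> multi_idx d 1 N \<Longrightarrow> T s = T' s) \<Longrightarrow> tensor_inner N d B T = tensor_inner N d B T'"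
  by (simp add: tensor_inner_def)

lemma sum_swap3:
  fixes f :: "'a \<Rightarrow> 'b \<Rightarrow> 'c \<Rightarrow> real"
  shows "(\<Sum>b\<in>B. \<Sum>k\<in>K. \<Sum>s\<in>S. f b k s) = (\<Sum>k\<in>K. \<Sum>s\<in>S. \<Sum>b\<in>B. f b k s)"
  by (subst sum.swap, rule sum.cong[OF refl], rule sum.swap)

text \<open>Chain rule in dual form: pairing with a block of the subgradient equals pairing the full
  tensor subgradient with the tensor whose factor \<open>i\<close> is replaced by the direction
  \<open>V\<close>. From here on the subgradient enters only through this identity.\<close>

lemma fac_inner_subgrad:
  assumes X: "tt_factors N d r X" and r: "r 0 = 1" "r N = 1" and i: "1 \<le> i" "i \<le> N"
  shows "fac_inner d r i (tt_subgrad N d r m A y X i) V =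
    dual_sum N d m A (\<lambda>k. sgn (tensor_inner N d (A k) (tt_tensor N d X) - y $ k))
      (\<lambda>s. seg r (X(i := V)) 0 s 0 0)"
proof -
  define g where "g k = sgn (tensor_inner N d (A k) (tt_tensor N d X) - y $ k)" for k
  define G where "G s a b = grad_prod r X N i s $$ (a, b)" for s a b
  define I where "I = multi_idx d 1 N"
  have fI: "finite I" by (simp add: I_def)
  have "fac_inner d r i (tt_subgrad N d r m A y X i) V =
    (\<Sum>x<d i. \<Sum>a<r (i - 1). \<Sum>b<r i. (1 / real m * (\<Sum>k<m. g k *
       (\<Sum>s | s \<in> I \<and> s ! (i - 1) = x. A k s * G s a b))) * V x $$ (a, b))"
    unfolding fac_inner_def tt_subgrad_def g_def G_def I_def by (intro sum.cong refl) simp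
  also have "\<dots> = (\<Sum>x<d i. \<Sum>a<r (i - 1). \<Sum>b<r i. \<Sum>k<m. \<Sum>s | s \<in> I \<and> s ! (i - 1) = x.
       1 / real m * g k * (A k s * (G s a b * V (s ! (i - 1)) $$ (a, b))))"
    by (simp add: sum_distrib_left sum_distrib_right mult.assoc)
  also have "\<dots> = (\<Sum>x<d i. \<Sum>k<m. \<Sum>s | s \<in> I \<and> s ! (i - 1) = x. \<Sum>a<r (i - 1). \<Sum>b<r i.
       1 / real m * g k * (A k s * (G s a b * V (s ! (i - 1)) $$ (a, b))))"
  proof (rule sum.cong[OF refl])
    fix x
    let ?S = "{s. s \<in> I \<and> s ! (i - 1) = x}"
    let ?f = "\<lambda>a b k s. 1 / real m * g k * (A k s * (G s a b * V (s ! (i - 1)) $$ (a, b)))"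
    have "(\<Sum>a<r (i - 1). \<Sum>b<r i. \<Sum>k<m. \<Sum>s\<in>?S. ?f a b k s) =
      (\<Sum>a<r (i - 1). \<Sum>k<m. \<Sum>s\<in>?S. \<Sum>b<r i. ?f a b k s)"
      by (rule sum.cong[OF refl sum_swap3])
    also have "\<dots> = (\<Sum>k<m. \<Sum>s\<in>?S. \<Sum>a<r (i - 1). \<Sum>b<r i. ?f a b k s)"
      by (rule sum_swap3)
    finally show "(\<Sum>a<r (i - 1). \<Sum>b<r i. \<Sum>k<m. \<Sum>s\<in>?S. ?f a b k s) =
      (\<Sum>k<m. \<Sum>s\<in>?S. \<Sum>a<r (i - 1). \<Sum>b<r i. ?f a b k s)" .
  qed
  also have "\<dots> = (\<Sum>k<m. \<Sum>x<d i. \<Sum>s | s \<in> I \<and> s ! (i - 1) = x. \<Sum>a<r (i - 1). \<Sum>b<r i.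
       1 / real m * g k * (A k s * (G s a b * V (s ! (i - 1)) $$ (a, b))))"
    by (rule sum.swap)
  \<comment> \<open>The multi-indices are partitioned by the value of their index in mode
    \<open>i\<close>, so the sum over slices disappears.\<close>
  also have "\<dots> = (\<Sum>k<m. \<Sum>s\<in>I. \<Sum>a<r (i - 1). \<Sum>b<r i.
       1 / real m * g k * (A k s * (G s a b * V (s ! (i - 1)) $$ (a, b))))"
  proof (intro sum.cong refl sum.group fI)
    show "(\<lambda>s. s ! (i - 1)) ` I \<subseteq> {..<d i}"
    proof
      fix x assume "x \<in> (\<lambda>s. s ! (i - 1)) ` I"
      then obtain s where s: "s \<in> multi_idx d 1 N" "x = s ! (i - 1)" by (auto simp: I_def)
      have "i - 1 < N" "Suc (i - 1) = i" using i by auto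
      then show "x \<in> {..<d i}" using s unfolding multi_idx_1_iff by (metis lessThan_iff)
    qed
  qed auto
  also have "\<dots> = (\<Sum>k<m. \<Sum>s\<in>I. 1 / real m * g k * (A k s * seg r (X(i := V)) 0 s 0 0))"
  proof (intro sum.cong refl)
    fix k s assume "s \<in> I"
    then have s: "s \<in> multi_idx d 1 N" by (simp add: I_def)
    have "seg r (X(i := V)) 0 s 0 0 = (\<Sum>a<r (i - 1). \<Sum>b<r i. G s a b * V (s ! (i - 1)) $$ (a, b))"
      unfolding seg_upd_split_at[of r, OF r(1) s i]
      by (intro sum.cong refl) (simp add: G_def grad_prod_index[OF X r s i])
    then show "(\<Sum>a<r (i - 1). \<Sum>b<r i. 1 / real m * g k * (A k s * (G s a b * V (s ! (i - 1)) $$ (a, b)))) =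
      1 / real m * g k * (A k s * seg r (X(i := V)) 0 s 0 0)"
      by (simp add: sum_distrib_left)
  qed
  finally show ?thesis
    by (simp add: dual_sum_def tensor_inner_def g_def I_def sum_distrib_left mult.assoc)
qed

section \<open>Telescoping sums\<close>

text \<open>Interpolates between the two families one factor at a time: \<open>Z\<close> at
  \<open>k = 0\<close>, and \<open>X\<close> on all modes at \<open>k = N\<close>.\<close>

definition mix :: "factors \<Rightarrow> factors \<Rightarrow> nat \<Rightarrow> factors" where
  "mix X Z k = (\<lambda>i. if i \<le> k then X i else Z i)"

definition fac_diff :: "factors \<Rightarrow> factors \<Rightarrow> factors" where
  "fac_diff X Z = (\<lambda>i x. X i x - Z i x)"

lemma fac_diff_index:
  assumes "tt_factors N d r X" "tt_factors N d r Z" "1 \<le> i" "i \<le> N" "x < d i" "a < r (i - 1)" "b < r i"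
  shows "fac_diff X Z i x $$ (a, b) = X i x $$ (a, b) - Z i x $$ (a, b)"
proof -
  have "X i x \<in> carrier_mat (r (i - 1)) (r i)" "Z i x \<in> carrier_mat (r (i - 1)) (r i)"
    using assms by (auto simp: tt_factors_def)
  then show ?thesis using assms by (simp add: fac_diff_def)
qed

lemma tt_factors_upd:
  "tt_factors N d r X \<Longrightarrow> (\<And>x. x < d i \<Longrightarrow> V x \<in> carrier_mat (r (i - 1)) (r i)) \<Longrightarrow> tt_factors N d r (X(i := V))"
  by (auto simp: tt_factors_def)

lemma tt_factors_diff: "tt_factors N d r X \<Longrightarrow> tt_factors N d r Z \<Longrightarrow> tt_factors N d r (fac_diff X Z)"
  unfolding tt_factors_def fac_diff_def by (meson minus_carrier_mat)

lemma tt_factors_mix: "tt_factors N d r X \<Longrightarrow> tt_factors N d r Z \<Longrightarrow> tt_factors N d r (mix X Z k)"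
  by (auto simp: tt_factors_def mix_def)

text \<open>Consecutive mixtures differ in one factor, so linearity turns their difference into one
  replaced factor. The offset \<open>i\<close> lets the same sum serve when the first factors agree
  already, as needed for second differences.\<close>

lemma seg_telescope:
  assumes X: "tt_factors N d r X" and Z: "tt_factors N d r Z" and r0: "r 0 = 1"
    and s: "s \<in> multi_idx d 1 N" and i: "i \<le> N" and agree: "\<And>k. 1 \<le> k \<Longrightarrow> k \<le> i \<Longrightarrow> X k = Z k"
  shows "seg r X 0 s 0 0 - seg r Z 0 s 0 0 =
    (\<Sum>k\<in>{i<..N}. seg r ((mix X Z k)(k := fac_diff X Z k)) 0 s 0 0)"
proof -
  have len: "length s = N" using s by (simp add: multi_idx_1_iff[unfolded One_nat_def])
  define T where "T k = seg r (mix X Z k) 0 s 0 0" for k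
  have step: "seg r ((mix X Z k)(k := fac_diff X Z k)) 0 s 0 0 = T k - T (k - 1)" if "k \<in> {i<..N}" for k
  proof -
    have k: "1 \<le> k" "k \<le> N" using that by auto
    have "seg r ((mix X Z k)(k := fac_diff X Z k)) 0 s 0 0 =
      seg r ((mix X Z k)(k := X k)) 0 s 0 0 - 1 * seg r ((mix X Z k)(k := Z k)) 0 s 0 0"
      using fac_diff_index[OF X Z k] by (intro seg_upd_diff[of r, OF r0 s k]) auto
    moreover have "(mix X Z k)(k := X k) = mix X Z k" "(mix X Z k)(k := Z k) = mix X Z (k - 1)"
      using k by (auto simp: mix_def fun_eq_iff)
    ultimately show ?thesis by (simp add: T_def)
  qed
  have "(\<Sum>k\<in>{i<..N}. T k - T (k - 1)) = T N - T i"
    using i sum_telescope''[of i N T] by (simp add: atLeastSucAtMost_greaterThanAtMost)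
  moreover have "T N = seg r X 0 s 0 0" unfolding T_def by (intro seg_cong) (auto simp: mix_def len)
  moreover have "T i = seg r Z 0 s 0 0" unfolding T_def using agree by (intro seg_cong) (auto simp: mix_def)
  ultimately show ?thesis using step by simp
qed

lemma lbound_extend:
  assumes "r 0 = 1" "lbound d r Y i C" "0 \<le> C" "i \<le> j"
    and "\<And>k. i < k \<Longrightarrow> k \<le> j \<Longrightarrow> (left_unfold d r Y k)\<^sup>T * left_unfold d r Y k = 1\<^sub>m (r k)"
  shows "lbound d r Y j C"
  using assms(4,5)
proof (induction j rule: dec_induct)
  case (step j)
  have "lbound d r Y (Suc j) (C * 1)"
  proof (rule lbound_Suc[of r, OF assms(1) _ assms(3)])
    show "lbound d r Y j C" using step by auto
    show "(\<Sum>x<d (Suc j). \<Sum>a<r j. (\<Sum>b<r (Suc j). Y (Suc j) x $$ (a, b) * w b)\<^sup>2) \<le> 1 * (\<Sum>b<r (Suc j). (w b)\<^sup>2)" for w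
      using fac_orthogonal[of d r Y "Suc j" w w] step by (simp add: power2_eq_square)
  qed
  then show ?case by simp
qed (use assms(2) in simp)

lemma left_unfold_cong: "Y i = Z i \<Longrightarrow> left_unfold d r Y i = left_unfold d r Z i"
  by (simp add: left_unfold_def)

lemma left_orthogonalD:
  "left_orthogonal N d r X \<Longrightarrow> 1 \<le> i \<Longrightarrow> i < N \<Longrightarrow>
    (left_unfold d r X i)\<^sup>T * left_unfold d r X i = 1\<^sub>m (r i)"
  by (auto simp: left_orthogonal_def)

lemma seg_norm_upd:
  assumes r0: "r 0 = 1" and i: "1 \<le> i" "i \<le> N" and X: "left_orthogonal N d r X"
    and agree: "\<And>k. 1 \<le> k \<Longrightarrow> k < i \<Longrightarrow> Y k = X k" and R: "rbound N d r Y i M" "0 \<le> M"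
  shows "(\<Sum>s\<in>multi_idx d 1 N. (seg r (Y(i := V)) 0 s 0 0)\<^sup>2) \<le> M * fac_inner d r i V V"
proof -
  obtain j where j: "i = Suc j" "j < N" using i by (cases i) auto
  have "lbound d r X j 1"
    using j by (intro lbound_orthonormal r0 left_orthogonalD[OF X]) auto
  then have L: "lbound d r (Y(i := V)) j 1"
    by (rule lbound_cong) (use agree j in auto)
  have R': "rbound N d r (Y(i := V)) (Suc j) M"
    using rbound_cong[OF R(1) i(2), of "Y(i := V)"] j by auto
  show ?thesis using seg_norm_bound[of r, OF r0 j(2) L _ R' R(2)] j by simp
qed

text \<open>The left interface is isometric up to \<open>i\<close>, the replaced factor contributes
  its Frobenius norm, and the orthogonal factors strictly between \<open>i\<close> and
  \<open>j\<close> add nothing.\<close>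

lemma seg_norm_upd2:
  assumes r0: "r 0 = 1" and ij: "1 \<le> i" "i < j" "j \<le> N" and X: "left_orthogonal N d r X"
    and agree: "\<And>k. 1 \<le> k \<Longrightarrow> k < j \<Longrightarrow> k \<noteq> i \<Longrightarrow> Y k = X k" and R: "rbound N d r Y j M" "0 \<le> M"
  shows "(\<Sum>s\<in>multi_idx d 1 N. (seg r (Y(i := U, j := V)) 0 s 0 0)\<^sup>2) \<le>
    fac_inner d r i U U * M * fac_inner d r j V V"
proof -
  obtain i' where i': "i = Suc i'" using ij by (cases i) auto
  obtain j' where j': "j = Suc j'" "j' < N" using ij by (cases j) auto
  let ?Y = "Y(i := U, j := V)"
  have f0: "0 \<le> fac_inner d r i U U" unfolding fac_inner_def by (intro sum_nonneg) auto
  have "lbound d r X i' 1"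
    using i' ij by (intro lbound_orthonormal r0 left_orthogonalD[OF X]) auto
  then have "lbound d r ?Y i' 1"
    by (rule lbound_cong) (use agree ij i' in auto)
  then have "lbound d r ?Y (Suc i') (1 * fac_inner d r i U U)"
  proof (rule lbound_Suc[of r, OF r0])
    show "(\<Sum>x<d (Suc i'). \<Sum>a<r i'. (\<Sum>b<r (Suc i'). ?Y (Suc i') x $$ (a, b) * w b)\<^sup>2) \<le>
      fac_inner d r i U U * (\<Sum>b<r (Suc i'). (w b)\<^sup>2)" for w
      using fac_bound[where d = d and r = r and i = "Suc i'" and V = U and w = w] ij i' by simp
  qed simp
  then have L: "lbound d r ?Y (Suc i') (fac_inner d r i U U)" by simp
  have L': "lbound d r ?Y j' (fac_inner d r i U U)"
  proof (rule lbound_extend[of r d ?Y "Suc i'" "fac_inner d r i U U" j', OF r0 L f0])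
    fix k assume k: "Suc i' < k" "k \<le> j'"
    then have "left_unfold d r ?Y k = left_unfold d r X k"
      using ij i' j' agree by (intro left_unfold_cong) auto
    then show "(left_unfold d r ?Y k)\<^sup>T * left_unfold d r ?Y k = 1\<^sub>m (r k)"
      using left_orthogonalD[OF X, of k] k j' by simp
  qed (use ij i' j' in auto)
  have R': "rbound N d r ?Y (Suc j') M"
    using rbound_cong[OF R(1) ij(3), of ?Y] ij j' by auto
  show ?thesis using seg_norm_bound[of r, OF r0 j'(2) L' f0 R' R(2)] j' by simp
qed

section \<open>Unfoldings\<close>

lemma multi_idx_list_nonempty:
  assumes "\<forall>i\<in>{1..N}. 1 \<le> d i" "j < N"
  shows "0 < length (multi_idx_list d (Suc j) N)"
proof -
  have "replicate (N - j) 0 \<in> multi_idx d (Suc j) N"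
  proof -
    have "0 < d (Suc (j + k))" if "k < N - j" for k
    proof -
      have "Suc (j + k) \<in> {1..N}" using that by auto
      then have "1 \<le> d (Suc (j + k))" using assms(1) by blast
      then show ?thesis by simp
    qed
    then show ?thesis using multi_idx_iff[of "replicate (N - j) 0" d j "N - j"] assms(2) by simp
  qed
  then show ?thesis unfolding multi_idx_def by (auto simp: length_pos_if_in_set)
qed

lemma tensor_unfold_dim:
  "tensor_unfold N d j X \<in> carrier_mat (length (multi_idx_list d 1 j)) (length (multi_idx_list d (Suc j) N))"
  by (simp add: tensor_unfold_def Let_def)

lemma tensor_unfold_index:
  "p < length (multi_idx_list d 1 j) \<Longrightarrow> q < length (multi_idx_list d (Suc j) N) \<Longrightarrow>
    tensor_unfold N d j X $$ (p, q) = X (multi_idx_list d 1 j ! p @ multi_idx_list d (Suc j) N ! q)"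
  by (simp add: tensor_unfold_def Let_def)

lemma minner_tensor_unfold:
  assumes "j \<le> N"
  shows "minner (tensor_unfold N d j X) (tensor_unfold N d j X) = (tensor_norm N d X)\<^sup>2"
proof -
  have "minner (tensor_unfold N d j X) (tensor_unfold N d j X) =
    (\<Sum>p<length (multi_idx_list d 1 j). \<Sum>q<length (multi_idx_list d (Suc j) N).
      (X (multi_idx_list d 1 j ! p @ multi_idx_list d (Suc j) N ! q))\<^sup>2)"
    unfolding minner_def carrier_matD[OF tensor_unfold_dim]
    by (intro sum.cong refl) (simp add: tensor_unfold_index[unfolded One_nat_def] power2_eq_square)
  also have "\<dots> = (\<Sum>s\<in>multi_idx d 1 j. \<Sum>t\<in>multi_idx d (Suc j) N. (X (s @ t))\<^sup>2)"
    by (simp add: sum_multi_idx_list[symmetric])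
  also have "\<dots> = (tensor_norm N d X)\<^sup>2"
    unfolding tensor_norm_sq using sum_multi_idx_append[of 0 j N] assms by simp
  finally show ?thesis .
qed

lemma tensor_unfold_bound:
  assumes "\<forall>i\<in>{1..N}. 1 \<le> d i" "j < N"
  shows "(\<Sum>t\<in>multi_idx d (Suc j) N. (\<Sum>s\<in>multi_idx d 1 j. z s * X (s @ t))\<^sup>2) \<le>
    (singular_value (tensor_unfold N d j X) 1)\<^sup>2 * (\<Sum>s\<in>multi_idx d 1 j. (z s)\<^sup>2)"
proof -
  define rs where "rs = multi_idx_list d 1 j"
  define cs where "cs = multi_idx_list d (Suc j) N"
  define A where "A = tensor_unfold N d j X"
  define Z where "Z = mat 1 (length rs) (\<lambda>(_, p). z (rs ! p))"
  have A: "A \<in> carrier_mat (length rs) (length cs)" unfolding A_def rs_def cs_def by (rule tensor_unfold_dim)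
  have Z: "Z \<in> carrier_mat 1 (length rs)" by (simp add: Z_def)
  have ZA: "(Z * A) $$ (0, q) = (\<Sum>s\<in>multi_idx d 1 j. z s * X (s @ cs ! q))" if "q < length cs" for q
  proof -
    have "(Z * A) $$ (0, q) = (\<Sum>p<length rs. z (rs ! p) * A $$ (p, q))"
      using that A Z by (simp add: scalar_prod_def lessThan_atLeast0) (simp add: Z_def)
    also have "\<dots> = (\<Sum>p<length rs. z (rs ! p) * X (rs ! p @ cs ! q))"
      using that tensor_unfold_index[of _ d j q N X] by (simp add: A_def rs_def cs_def)
    finally show ?thesis using sum_multi_idx_list[of "\<lambda>s. z s * X (s @ cs ! q)" d 1 j] by (simp add: rs_def)
  qed
  have "minner (Z * A) (Z * A) = (\<Sum>q<length cs. (\<Sum>s\<in>multi_idx d 1 j. z s * X (s @ cs ! q))\<^sup>2)"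
    using ZA A Z by (simp add: minner_def power2_eq_square)
  also have "\<dots> = (\<Sum>t\<in>multi_idx d (Suc j) N. (\<Sum>s\<in>multi_idx d 1 j. z s * X (s @ t))\<^sup>2)"
    unfolding cs_def by (rule sum_multi_idx_list)
  finally have eq: "minner (Z * A) (Z * A) = \<dots>" .
  have "minner Z Z = (\<Sum>s\<in>multi_idx d 1 j. (z s)\<^sup>2)"
    using sum_multi_idx_list[of "\<lambda>s. (z s)\<^sup>2" d 1 j] by (simp add: minner_def Z_def power2_eq_square rs_def)
  moreover have "0 < length cs" unfolding cs_def by (rule multi_idx_list_nonempty[OF assms])
  ultimately show ?thesis
    using minner_singular_value_1_left[OF A _ Z] eq by (simp add: A_def)
qed

text \<open>The isometric left interface lifts a coefficient vector \<open>u\<close> to a vector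
  \<open>z\<close> of the same norm on the rows of the unfolding. Hence the right interface is no
  larger than the unfolding.\<close>

lemma rbound_of_unfold:
  assumes r0: "r 0 = 1" and j: "j \<le> N"
    and orth: "\<And>i. 1 \<le> i \<Longrightarrow> i \<le> j \<Longrightarrow> (left_unfold d r Y i)\<^sup>T * left_unfold d r Y i = 1\<^sub>m (r i)"
    and bound: "\<And>z. (\<Sum>t\<in>multi_idx d (Suc j) N. (\<Sum>s\<in>multi_idx d 1 j. z s * seg r Y 0 (s @ t) 0 0)\<^sup>2) \<le>
      M * (\<Sum>s\<in>multi_idx d 1 j. (z s)\<^sup>2)"
  shows "rbound N d r Y j M"
  unfolding rbound_def
proof
  fix u :: "nat \<Rightarrow> real"
  define z where "z s = (\<Sum>a<r j. seg r Y 0 s 0 a * u a)" for s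
  note inner = left_interface_orthonormal[of r j d Y, OF r0 orth]
  have zz: "(\<Sum>s\<in>multi_idx d 1 j. (z s)\<^sup>2) = (\<Sum>a<r j. (u a)\<^sup>2)"
    using inner[of u u] by (simp add: z_def power2_eq_square)
  have "(\<Sum>s\<in>multi_idx d 1 j. z s * seg r Y 0 (s @ t) 0 0) = (\<Sum>a<r j. u a * seg r Y j t a 0)" for t
  proof -
    have "seg r Y 0 (s @ t) 0 0 = (\<Sum>a<r j. seg r Y 0 s 0 a * seg r Y j t a 0)" if "s \<in> multi_idx d 1 j" for s
      using that seg_append[of 0 r 0 Y s t 0] r0 by (simp add: multi_idx_1_iff[unfolded One_nat_def])
    then show ?thesis using inner[of u "\<lambda>a. seg r Y j t a 0"] by (simp add: z_def)
  qed
  then show "(\<Sum>t\<in>multi_idx d (Suc j) N. (\<Sum>a<r j. u a * seg r Y j t a 0)\<^sup>2) \<le> M * (\<Sum>a<r j. (u a)\<^sup>2)"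
    using bound[of z] zz by simp
qed

text \<open>A perturbation of half the size \<open>s\<close> enlarges the norm to at most 3/2 of
  \<open>s\<close>; this is the origin of the factor 9/4. The weights 3/2 and 3 in the pointwise
  bound are the optimal split for that ratio.\<close>

lemma sum_square_perturb:
  fixes f g :: "'a \<Rightarrow> real"
  assumes f: "(\<Sum>t\<in>I. (f t)\<^sup>2) \<le> s\<^sup>2 * w" and g: "(\<Sum>t\<in>I. (g t)\<^sup>2) \<le> e * w"
    and e: "e \<le> s\<^sup>2 / 4" and w: "0 \<le> w"
  shows "(\<Sum>t\<in>I. (f t + g t)\<^sup>2) \<le> (9/4 * s\<^sup>2) * w"
proof -
  have "(f t + g t)\<^sup>2 \<le> 3/2 * (f t)\<^sup>2 + 3 * (g t)\<^sup>2" for t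
    using zero_le_power2[of "f t - 2 * g t"] by (simp add: power2_eq_square algebra_simps)
  then have "(\<Sum>t\<in>I. (f t + g t)\<^sup>2) \<le> (\<Sum>t\<in>I. 3/2 * (f t)\<^sup>2 + 3 * (g t)\<^sup>2)" by (intro sum_mono)
  also have "\<dots> = 3/2 * (\<Sum>t\<in>I. (f t)\<^sup>2) + 3 * (\<Sum>t\<in>I. (g t)\<^sup>2)"
    by (simp add: sum.distrib sum_distrib_left)
  also have "\<dots> \<le> 3/2 * (s\<^sup>2 * w) + 3 * (s\<^sup>2 / 4 * w)"
    using f g mult_right_mono[OF e w] by linarith
  finally show ?thesis by (simp add: algebra_simps)
qed

lemma unfold_Cauchy_Schwarz:
  assumes "j \<le> N"
  shows "(\<Sum>t\<in>multi_idx d (Suc j) N. (\<Sum>s\<in>multi_idx d 1 j. z s * E (s @ t))\<^sup>2) \<le>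
    (tensor_norm N d E)\<^sup>2 * (\<Sum>s\<in>multi_idx d 1 j. (z s)\<^sup>2)"
proof -
  define rs where "rs = multi_idx_list d 1 j"
  have "(\<Sum>s\<in>multi_idx d 1 j. z s * E (s @ t))\<^sup>2 \<le> (\<Sum>s\<in>multi_idx d 1 j. (z s)\<^sup>2) * (\<Sum>s\<in>multi_idx d 1 j. (E (s @ t))\<^sup>2)" for t
    unfolding sum_multi_idx_list[symmetric] by (rule sum_Cauchy_Schwarz)
  then have "(\<Sum>t\<in>multi_idx d (Suc j) N. (\<Sum>s\<in>multi_idx d 1 j. z s * E (s @ t))\<^sup>2) \<le>
    (\<Sum>t\<in>multi_idx d (Suc j) N. (\<Sum>s\<in>multi_idx d 1 j. (z s)\<^sup>2) * (\<Sum>s\<in>multi_idx d 1 j. (E (s @ t))\<^sup>2))"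
    by (intro sum_mono)
  also have "\<dots> = (\<Sum>s\<in>multi_idx d 1 j. (z s)\<^sup>2) * (\<Sum>s\<in>multi_idx d 1 j. \<Sum>t\<in>multi_idx d (Suc j) N. (E (s @ t))\<^sup>2)"
    by (subst sum.swap) (simp add: sum_distrib_left)
  also have "(\<Sum>s\<in>multi_idx d 1 j. \<Sum>t\<in>multi_idx d (Suc j) N. (E (s @ t))\<^sup>2) = (tensor_norm N d E)\<^sup>2"
    unfolding tensor_norm_sq using sum_multi_idx_append[of 0 j N] assms by simp
  finally show ?thesis by (simp add: mult.commute)
qed

lemma interface_mat_orthonormal:
  assumes r0: "r 0 = 1" and j: "j < N" and Y: "left_orthogonal N d r Y"
  defines "U \<equiv> mat (length (multi_idx_list d 1 j)) (r j) (\<lambda>(p, b). seg r Y 0 (multi_idx_list d 1 j ! p) 0 b)"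
  shows "U\<^sup>T * U = 1\<^sub>m (r j)"
proof (rule eq_matI)
  fix a b assume "a < dim_row (1\<^sub>m (r j) :: real mat)" "b < dim_col (1\<^sub>m (r j) :: real mat)"
  then have ab: "a < r j" "b < r j" by auto
  have "(U\<^sup>T * U) $$ (a, b) =
    (\<Sum>p<length (multi_idx_list d 1 j). seg r Y 0 (multi_idx_list d 1 j ! p) 0 a * seg r Y 0 (multi_idx_list d 1 j ! p) 0 b)"
    using ab by (simp add: U_def scalar_prod_def lessThan_atLeast0)
  also have "\<dots> = (\<Sum>s\<in>multi_idx d 1 j. seg r Y 0 s 0 a * seg r Y 0 s 0 b)"
    by (rule sum_multi_idx_list)
  also have "\<dots> = (\<Sum>s\<in>multi_idx d 1 j. (\<Sum>c<r j. seg r Y 0 s 0 c * (if c = a then 1 else 0)) *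
      (\<Sum>c<r j. seg r Y 0 s 0 c * (if c = b then 1 else 0)))"
    using ab by (simp add: if_distrib[of "\<lambda>x. _ * x"] cong: if_cong)
  also have "\<dots> = (\<Sum>c<r j. (if c = a then 1 else 0) * (if c = b then 1 else 0))"
    using j by (intro left_interface_orthonormal r0 left_orthogonalD[OF Y]) auto
  also have "\<dots> = (\<Sum>c<r j. if c = a then (if a = b then 1 else 0) else 0)"
    by (intro sum.cong refl) auto
  finally show "(U\<^sup>T * U) $$ (a, b) = 1\<^sub>m (r j) $$ (a, b)" using ab by simp
qed (auto simp: U_def)

lemma tensor_unfold_factor:
  assumes Y: "tt_factors N d r Y" and r: "r 0 = 1" "r N = 1" and j: "j \<le> N"
  shows "tensor_unfold N d j (tt_tensor N d Y) =
    mat (length (multi_idx_list d 1 j)) (r j) (\<lambda>(p, b). seg r Y 0 (multi_idx_list d 1 j ! p) 0 b) *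
    mat (r j) (length (multi_idx_list d (Suc j) N)) (\<lambda>(a, q). seg r Y j (multi_idx_list d (Suc j) N ! q) a 0)"
    (is "?A = ?U * ?V")
proof (rule eq_matI)
  fix p q assume "p < dim_row (?U * ?V)" "q < dim_col (?U * ?V)"
  then have pq: "p < length (multi_idx_list d 1 j)" "q < length (multi_idx_list d (Suc j) N)" by auto
  define s where "s = multi_idx_list d 1 j ! p"
  define t where "t = multi_idx_list d (Suc j) N ! q"
  have s: "s \<in> multi_idx d (Suc 0) (0 + j)" and t: "t \<in> multi_idx d (Suc (0 + j)) (0 + j + (N - j))"
    using pq j by (auto simp: s_def t_def multi_idx_def)
  have st: "s @ t \<in> multi_idx d 1 N" using multi_idx_append[OF s t] j by simp
  have len: "length s = j" using s by (simp add: multi_idx_1_iff[unfolded One_nat_def])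
  have "?A $$ (p, q) = tt_tensor N d Y (s @ t)" unfolding s_def t_def by (rule tensor_unfold_index[OF pq])
  also have "\<dots> = (\<Sum>a<r j. seg r Y 0 s 0 a * seg r Y j t a 0)"
    unfolding tt_tensor_seg[OF Y r st] using seg_append[of 0 r 0 Y s t 0] r len by simp
  also have "\<dots> = (?U * ?V) $$ (p, q)"
    using pq by (simp add: scalar_prod_def lessThan_atLeast0 s_def t_def)
  finally show "?A $$ (p, q) = (?U * ?V) $$ (p, q)" .
qed (auto simp: tensor_unfold_def Let_def)

lemma rank_le_cols: "mat_rank A \<le> dim_col A"
  unfolding mat_rank_def by (rule vec_space.rank_le_nc) simp

text \<open>The residual \<open>(I - U U\<^sup>T) W\<close> of the two left interfaces, multiplied by the right interface of
  \<open>Y\<close>, is the projection \<open>(I - U U\<^sup>T)\<close> of the difference of the unfoldings.\<close>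

lemma interface_alignment:
  assumes X: "tt_factors N d r X" "left_orthogonal N d r X" and Y: "tt_factors N d r Y" "left_orthogonal N d r Y"
    and r: "r 0 = 1" "r N = 1" and j: "1 \<le> j" "j < N" and rj: "1 \<le> r j"
    and rank: "tt_rank N d (tt_tensor N d Y) j = r j"
  obtains R where "R \<in> carrier_mat (r j) (r j)" "R\<^sup>T * R = 1\<^sub>m (r j)"
    "(singular_value (tensor_unfold N d j (tt_tensor N d Y)) (r j))\<^sup>2 *
      (\<Sum>s\<in>multi_idx d 1 j. \<Sum>b<r j. (seg r X 0 s 0 b - (\<Sum>a<r j. seg r Y 0 s 0 a * R $$ (a, b)))\<^sup>2)
      \<le> 4 * (tensor_norm N d (\<lambda>s. tt_tensor N d X s - tt_tensor N d Y s))\<^sup>2"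
proof -
  define rs where "rs = multi_idx_list d 1 j"
  define cs where "cs = multi_idx_list d (Suc j) N"
  define U where "U = mat (length rs) (r j) (\<lambda>(p, b). seg r X 0 (rs ! p) 0 b)"
  define W where "W = mat (length rs) (r j) (\<lambda>(p, b). seg r Y 0 (rs ! p) 0 b)"
  define V where "V = mat (r j) (length cs) (\<lambda>(a, q). seg r X j (cs ! q) a 0)"
  define V' where "V' = mat (r j) (length cs) (\<lambda>(a, q). seg r Y j (cs ! q) a 0)"
  define A where "A = tensor_unfold N d j (tt_tensor N d X)"
  define B where "B = tensor_unfold N d j (tt_tensor N d Y)"
  define \<sigma> where "\<sigma> = singular_value B (r j)"
  have U: "U \<in> carrier_mat (length rs) (r j)" "U\<^sup>T * U = 1\<^sub>m (r j)"
    unfolding U_def rs_def using interface_mat_orthonormal[OF r(1) j(2) X(2)] by auto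
  have W: "W \<in> carrier_mat (length rs) (r j)" "W\<^sup>T * W = 1\<^sub>m (r j)"
    unfolding W_def rs_def using interface_mat_orthonormal[OF r(1) j(2) Y(2)] by auto
  have V: "V \<in> carrier_mat (r j) (length cs)" and V': "V' \<in> carrier_mat (r j) (length cs)"
    by (auto simp: V_def V'_def)
  have A: "A = U * V" unfolding A_def U_def V_def rs_def cs_def using j by (intro tensor_unfold_factor[OF X(1) r]) auto
  have B: "B = W * V'" unfolding B_def W_def V'_def rs_def cs_def using j by (intro tensor_unfold_factor[OF Y(1) r]) auto
  have Ac: "A \<in> carrier_mat (length rs) (length cs)" "B \<in> carrier_mat (length rs) (length cs)"
    using U W V V' by (auto simp: A B)
  \<comment> \<open>The rank hypothesis guarantees that the singular value of index
    \<open>r j\<close> really occurs in the list of eigenvalues.\<close>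
  have rle: "r j \<le> length cs"
    using rank rank_le_cols[of B] Ac by (simp add: tt_rank_def B_def)
  obtain R where R: "R \<in> carrier_mat (r j) (r j)" "R\<^sup>T * R = 1\<^sub>m (r j)"
    and Rle: "minner (U - W * R) (U - W * R) \<le> 4 * minner (W - U * (U\<^sup>T * W)) (W - U * (U\<^sup>T * W))"
    using orthogonal_alignment[OF U W] by blast
  define Z where "Z = W - U * (U\<^sup>T * W)"
  have UW: "U * (U\<^sup>T * W) \<in> carrier_mat (length rs) (r j)" using U W by auto
  have Z: "Z \<in> carrier_mat (length rs) (r j)" unfolding Z_def by (rule minus_carrier_mat[OF UW])
  have BA: "B - A \<in> carrier_mat (length rs) (length cs)" by (rule minus_carrier_mat[OF Ac(1)])
  have UtBA: "U\<^sup>T * (B - A) = U\<^sup>T * B - U\<^sup>T * A"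
    using U Ac by (intro mult_minus_distrib_mat[of _ "r j" "length rs" _ "length cs"]) auto
  have ZV: "Z * V' = (B - A) - U * (U\<^sup>T * (B - A))"
  proof -
    have c1: "U\<^sup>T * B \<in> carrier_mat (r j) (length cs)" "U\<^sup>T * A \<in> carrier_mat (r j) (length cs)"
      using U Ac by auto
    have c2: "U * (U\<^sup>T * B) \<in> carrier_mat (length rs) (length cs)" using U c1 by auto
    have UA: "U * (U\<^sup>T * A) = A"
    proof -
      have "U\<^sup>T * A = V" unfolding A using U V by (intro mult_cancel_dim[OF U(2)]) auto
      then show ?thesis by (simp add: A)
    qed
    have "Z * V' = W * V' - U * (U\<^sup>T * W) * V'"
      unfolding Z_def by (rule minus_mult_distrib_mat[OF W(1) UW V'])
    also have "U * (U\<^sup>T * W) * V' = U * (U\<^sup>T * B)"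
      unfolding B using U W V' by (simp add: mult_assoc_dim)
    also have "W * V' - U * (U\<^sup>T * B) = (B - A) - (U * (U\<^sup>T * B) - U * (U\<^sup>T * A))"
      unfolding UA B[symmetric] using Ac c2 by (intro eq_matI) auto
    also have "U * (U\<^sup>T * B) - U * (U\<^sup>T * A) = U * (U\<^sup>T * (B - A))"
      unfolding UtBA by (rule mult_minus_distrib_mat[OF U(1) c1, symmetric])
    finally show ?thesis .
  qed
  have "\<sigma>\<^sup>2 * minner Z Z \<le> minner (Z * V') (Z * V')"
    unfolding \<sigma>_def B by (rule minner_singular_value_lower[OF W V' rj rle Z])
  also have "\<dots> \<le> minner (B - A) (B - A)"
    unfolding ZV minner_projection[OF U BA] using minner_self_nonneg by simp
  also have "\<dots> = (tensor_norm N d (\<lambda>s. tt_tensor N d X s - tt_tensor N d Y s))\<^sup>2"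
  proof -
    have "B - A = tensor_unfold N d j (\<lambda>s. tt_tensor N d Y s - tt_tensor N d X s)"
      unfolding A_def B_def tensor_unfold_def Let_def by (intro eq_matI) auto
    then have "minner (B - A) (B - A) = (tensor_norm N d (\<lambda>s. tt_tensor N d Y s - tt_tensor N d X s))\<^sup>2"
      using minner_tensor_unfold[of j N d] j by simp
    then show ?thesis by (simp add: tensor_norm_sq power2_commute)
  qed
  finally have "\<sigma>\<^sup>2 * minner (U - W * R) (U - W * R) \<le> 4 * (tensor_norm N d (\<lambda>s. tt_tensor N d X s - tt_tensor N d Y s))\<^sup>2"
    using mult_left_mono[OF Rle, of "\<sigma>\<^sup>2"] by (simp add: Z_def)
  moreover have "minner (U - W * R) (U - W * R) =
    (\<Sum>s\<in>multi_idx d 1 j. \<Sum>b<r j. (seg r X 0 s 0 b - (\<Sum>a<r j. seg r Y 0 s 0 a * R $$ (a, b)))\<^sup>2)"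
  proof -
    have WR: "W * R \<in> carrier_mat (length rs) (r j)" using W R by auto
    have "(U - W * R) $$ (p, b) = seg r X 0 (rs ! p) 0 b - (\<Sum>a<r j. seg r Y 0 (rs ! p) 0 a * R $$ (a, b))"
      if pb: "p < length rs" "b < r j" for p b
    proof -
      have "(W * R) $$ (p, b) = (\<Sum>a<r j. seg r Y 0 (rs ! p) 0 a * R $$ (a, b))"
        using pb R by (simp add: W_def scalar_prod_def lessThan_atLeast0)
      moreover have "(U - W * R) $$ (p, b) = U $$ (p, b) - (W * R) $$ (p, b)"
        using WR pb by (intro index_minus_mat) auto
      ultimately show ?thesis using pb by (simp add: U_def)
    qed
    then have "minner (U - W * R) (U - W * R) = (\<Sum>p<length rs. \<Sum>b<r j.
      (seg r X 0 (rs ! p) 0 b - (\<Sum>a<r j. seg r Y 0 (rs ! p) 0 a * R $$ (a, b)))\<^sup>2)"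
      unfolding minner_def carrier_matD[OF minus_carrier_mat[OF WR]] by (simp add: power2_eq_square)
    then show ?thesis unfolding rs_def sum_multi_idx_list[of "\<lambda>s. \<Sum>b<r j. (seg r X 0 s 0 b - (\<Sum>a<r j. seg r Y 0 s 0 a * R $$ (a, b)))\<^sup>2"] .
  qed
  ultimately show ?thesis using that[OF R] by (simp add: \<sigma>_def B_def)
qed

section \<open>Gauge invariance\<close>

lemma orth_family:
  assumes R: "R \<in> orth_families N r" and r: "r 0 = 1" "r N = 1" and i: "i \<le> N"
  shows "R i \<in> carrier_mat (r i) (r i)" "(R i)\<^sup>T * R i = 1\<^sub>m (r i)"
    "R i * (R i)\<^sup>T = 1\<^sub>m (r i)"
proof -
  show c: "R i \<in> carrier_mat (r i) (r i)" and o: "(R i)\<^sup>T * R i = 1\<^sub>m (r i)"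
    using R r i by (cases "i = 0 \<or> i = N"; force simp: orth_families_def)+
  show "R i * (R i)\<^sup>T = 1\<^sub>m (r i)" by (rule orthogonal_mat_right[OF c o])
qed

context
  fixes N :: nat and d r :: "nat \<Rightarrow> nat" and R :: "nat \<Rightarrow> real mat" and Y :: factors
  assumes R: "R \<in> orth_families N r" and r: "r 0 = 1" "r N = 1" and Y: "tt_factors N d r Y"
begin

lemma rotate_factors_carrier:
  assumes "j < N" "x < d (Suc j)"
  shows "rotate_factors R Y (Suc j) x \<in> carrier_mat (r j) (r (Suc j))"
  using orth_family(1)[OF R r, of j] orth_family(1)[OF R r, of "Suc j"] tt_factors_carrier[OF Y assms] assms
  by (auto simp: rotate_factors_def)

lemma tt_factors_rotate: "tt_factors N d r (rotate_factors R Y)"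
  unfolding tt_factors_def
proof (intro ballI allI impI)
  fix i x assume i: "i \<in> {1..N}" and x: "x < d i"
  obtain j where "i = Suc j" using i by (cases i) auto
  then show "rotate_factors R Y i x \<in> carrier_mat (r (i - 1)) (r i)"
    using rotate_factors_carrier[of j x] i x by simp
qed

lemma rotate_factors_gauge:
  assumes "j < N" "x < d (Suc j)"
  shows "R j * rotate_factors R Y (Suc j) x = Y (Suc j) x * R (Suc j)"
proof -
  have "R j * ((R j)\<^sup>T * (Y (Suc j) x * R (Suc j))) = Y (Suc j) x * R (Suc j)"
    using orth_family[OF R r, of j] orth_family(1)[OF R r, of "Suc j"] tt_factors_carrier[OF Y assms] assms
    by (intro mult_cancel_dim[OF orth_family(3)[OF R r, of j]]) auto
  then show ?thesis
    using orth_family(1)[OF R r, of j] orth_family(1)[OF R r, of "Suc j"] tt_factors_carrier[OF Y assms] assms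
    by (simp add: rotate_factors_def mult_assoc_dim)
qed

text \<open>Moving a rotation from left to right through each slice cancels all inner rotations, so
  only the two at the ends of the segment survive. At full length these are trivial and the tensor
  is unchanged.\<close>

lemma seg_rotate:
  assumes "j + length xs \<le> N" "\<And>k. k < length xs \<Longrightarrow> xs ! k < d (Suc (j + k))" "a < r j" "b < r (j + length xs)"
  shows "(\<Sum>c<r j. R j $$ (a, c) * seg r (rotate_factors R Y) j xs c b) =
    (\<Sum>c<r (j + length xs). seg r Y j xs a c * R (j + length xs) $$ (c, b))"
  using assms
proof (induction xs arbitrary: a j)
  case Nil
  have "(\<Sum>c<r j. R j $$ (a, c) * (if c = b then 1 else 0)) = (\<Sum>c<r j. if c = b then R j $$ (a, c) else 0)"
    "(\<Sum>c<r j. (if a = c then 1 else 0) * R j $$ (c, b)) = (\<Sum>c<r j. if c = a then R j $$ (c, b) else 0)"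
    by (intro sum.cong refl; simp)+
  then show ?case using Nil by simp
next
  case (Cons x xs)
  let ?Z = "rotate_factors R Y"
  have j: "j < N" and x: "x < d (Suc j)" using Cons.prems(1) Cons.prems(2)[of 0] by auto
  note Rj = orth_family(1)[OF R r less_imp_le[OF j]] and RSj = orth_family(1)[OF R r Suc_leI[OF j]]
  note Yc = tt_factors_carrier[OF Y j x] and Zc = rotate_factors_carrier[OF j x]
  have IH: "(\<Sum>c<r (Suc j). R (Suc j) $$ (e, c) * seg r ?Z (Suc j) xs c b) =
    (\<Sum>c<r (j + length (x # xs)). seg r Y (Suc j) xs e c * R (j + length (x # xs)) $$ (c, b))" if "e < r (Suc j)" for e
    using Cons.IH[of "Suc j" e] Cons.prems(1,4) Cons.prems(2)[of "Suc _"] that by simp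
  have "(\<Sum>c<r j. R j $$ (a, c) * seg r ?Z j (x # xs) c b) =
    (\<Sum>c<r j. \<Sum>e<r (Suc j). R j $$ (a, c) * ?Z (Suc j) x $$ (c, e) * seg r ?Z (Suc j) xs e b)"
    by (simp add: sum_distrib_left mult.assoc)
  also have "\<dots> = (\<Sum>e<r (Suc j). (R j * ?Z (Suc j) x) $$ (a, e) * seg r ?Z (Suc j) xs e b)"
    using Rj Zc Cons.prems(3)
    by (subst sum.swap) (auto simp: scalar_prod_def lessThan_atLeast0 sum_distrib_right intro!: sum.cong)
  also have "\<dots> = (\<Sum>e<r (Suc j). (Y (Suc j) x * R (Suc j)) $$ (a, e) * seg r ?Z (Suc j) xs e b)"
    unfolding rotate_factors_gauge[OF j x] ..
  also have "\<dots> = (\<Sum>f<r (Suc j). Y (Suc j) x $$ (a, f) * (\<Sum>e<r (Suc j). R (Suc j) $$ (f, e) * seg r ?Z (Suc j) xs e b))"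
    using Yc RSj Cons.prems(3) unfolding sum_distrib_left
    by (subst sum.swap) (auto simp: scalar_prod_def lessThan_atLeast0 sum_distrib_right mult.assoc intro!: sum.cong)
  also have "\<dots> = (\<Sum>f<r (Suc j). Y (Suc j) x $$ (a, f) *
      (\<Sum>c<r (j + length (x # xs)). seg r Y (Suc j) xs f c * R (j + length (x # xs)) $$ (c, b)))"
    using IH by (intro sum.cong refl) simp
  also have "\<dots> = (\<Sum>c<r (j + length (x # xs)). seg r Y j (x # xs) a c * R (j + length (x # xs)) $$ (c, b))"
    unfolding sum_distrib_left seg.simps sum_distrib_right by (subst sum.swap) (simp add: mult.assoc)
  finally show ?case .
qed

lemma seg_rotate_left:
  assumes "j \<le> N" "s \<in> multi_idx d 1 j" "b < r j"
  shows "seg r (rotate_factors R Y) 0 s 0 b = (\<Sum>c<r j. seg r Y 0 s 0 c * R j $$ (c, b))"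
proof -
  have "length s = j" "\<And>k. k < j \<Longrightarrow> s ! k < d (Suc k)" using assms(2) unfolding multi_idx_1_iff by auto
  moreover have "R 0 = 1\<^sub>m 1" using R by (simp add: orth_families_def)
  ultimately show ?thesis using seg_rotate[of 0 s 0 b] assms r by simp
qed

lemma seg_rotate_full:
  assumes "s \<in> multi_idx d 1 N"
  shows "seg r (rotate_factors R Y) 0 s 0 0 = seg r Y 0 s 0 0"
  using seg_rotate_left[OF _ assms, of 0] r R by (simp add: orth_families_def)

text \<open>The rotation on the left drops out of the Gram matrix of a slice, and the one on the
  right conjugates the Gram matrix of the unfolding, which is the identity.\<close>

lemma left_orthogonal_rotate:
  assumes "left_orthogonal N d r Y"
  shows "left_orthogonal N d r (rotate_factors R Y)"
  unfolding left_orthogonal_def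
proof
  fix i assume i: "i \<in> {1..N - 1}"
  then obtain j where j: "i = Suc j" by (cases i) auto
  have iN: "i < N" "j < N" using i j by auto
  let ?Z = "rotate_factors R Y"
  note Rj = orth_family[OF R r less_imp_le[OF iN(2)]] and Ri = orth_family[OF R r less_imp_le[OF iN(1)]]
  show "(left_unfold d r ?Z i)\<^sup>T * left_unfold d r ?Z i = 1\<^sub>m (r i)"
  proof (rule eq_matI)
    fix b b' assume "b < dim_row (1\<^sub>m (r i) :: real mat)" "b' < dim_col (1\<^sub>m (r i) :: real mat)"
    then have bb: "b < r i" "b' < r i" by auto
    have Yr: "(\<Sum>a<r j. ?Z i x $$ (a, b) * ?Z i x $$ (a, b')) =
      (\<Sum>a<r j. (\<Sum>c<r i. Y i x $$ (a, c) * R i $$ (c, b)) * (\<Sum>c<r i. Y i x $$ (a, c) * R i $$ (c, b')))" if x: "x < d i" for x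
    proof -
      note Yc = tt_factors_carrier[OF Y iN(2), of x, folded j, OF x]
      note Zc = rotate_factors_carrier[OF iN(2), of x, folded j, OF x]
      have "(?Z i x)\<^sup>T * ?Z i x = (?Z i x)\<^sup>T * ((R j)\<^sup>T * (R j * ?Z i x))"
        using mult_cancel_dim[OF Rj(2), of "?Z i x"] Rj(1) Zc by simp
      also have "\<dots> = (R j * ?Z i x)\<^sup>T * (R j * ?Z i x)"
        using Rj(1) Zc by (simp add: transpose_mult_dim mult_assoc_dim)
      also have "R j * ?Z i x = Y i x * R i"
        using rotate_factors_gauge[OF iN(2), of x] x j by simp
      finally have "((?Z i x)\<^sup>T * ?Z i x) $$ (b, b') = ((Y i x * R i)\<^sup>T * (Y i x * R i)) $$ (b, b')"
        by simp
      moreover have "((?Z i x)\<^sup>T * ?Z i x) $$ (b, b') = (\<Sum>a<r j. ?Z i x $$ (a, b) * ?Z i x $$ (a, b'))"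
        using Zc bb by (simp add: scalar_prod_def lessThan_atLeast0)
      moreover have "((Y i x * R i)\<^sup>T * (Y i x * R i)) $$ (b, b') =
        (\<Sum>a<r j. (\<Sum>c<r i. Y i x $$ (a, c) * R i $$ (c, b)) * (\<Sum>c<r i. Y i x $$ (a, c) * R i $$ (c, b')))"
        using Yc Ri(1) bb by (simp add: scalar_prod_def lessThan_atLeast0)
      ultimately show ?thesis by simp
    qed
    have "((left_unfold d r ?Z i)\<^sup>T * left_unfold d r ?Z i) $$ (b, b') =
      (\<Sum>p<d i * r (i - 1). left_unfold d r ?Z i $$ (p, b) * left_unfold d r ?Z i $$ (p, b'))"
      using bb carrier_matD[OF left_unfold_carrier[of d r ?Z i]] by (simp add: scalar_prod_def lessThan_atLeast0)
    also have "\<dots> = (\<Sum>x<d i. \<Sum>a<r (i - 1). ?Z i x $$ (a, b) * ?Z i x $$ (a, b'))"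
      unfolding sum_mult_split using bb
      by (intro sum.cong refl) (simp add: left_unfold_index[unfolded One_nat_def])
    also have "\<dots> = (\<Sum>x<d i. \<Sum>a<r (i - 1). (\<Sum>c<r i. Y i x $$ (a, c) * R i $$ (c, b)) * (\<Sum>c<r i. Y i x $$ (a, c) * R i $$ (c, b')))"
      using Yr j by simp
    also have "\<dots> = (\<Sum>c<r i. R i $$ (c, b) * R i $$ (c, b'))"
      using i by (intro fac_orthogonal left_orthogonalD[OF assms]) auto
    also have "\<dots> = ((R i)\<^sup>T * R i) $$ (b, b')"
      using Ri(1) bb by (simp add: scalar_prod_def lessThan_atLeast0)
    finally show "((left_unfold d r ?Z i)\<^sup>T * left_unfold d r ?Z i) $$ (b, b') = 1\<^sub>m (r i) $$ (b, b')"
      unfolding Ri(2) .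
  qed (auto simp: left_unfold_def)
qed

end

section \<open>The distance in terms of slices\<close>

text \<open>The objective of the distance at one alignment: \<open>Z\<close> stands for the already
  rotated target and \<open>w\<close> for the squared largest singular value.\<close>

definition aligned_dist2 :: "nat \<Rightarrow> (nat \<Rightarrow> nat) \<Rightarrow> (nat \<Rightarrow> nat) \<Rightarrow> real \<Rightarrow> factors \<Rightarrow> factors \<Rightarrow> real" where
  "aligned_dist2 N d r w X Z =
    (\<Sum>i = 1..N - 1. w * fac_inner d r i (fac_diff X Z i) (fac_diff X Z i)) +
    fac_inner d r N (fac_diff X Z N) (fac_diff X Z N)"

lemma fac_inner_nonneg [simp]: "0 \<le> fac_inner d r i V V"
  unfolding fac_inner_def by (intro sum_nonneg) auto

lemma aligned_dist2_nonneg: "0 \<le> w \<Longrightarrow> 0 \<le> aligned_dist2 N d r w X Z"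
  unfolding aligned_dist2_def by (intro add_nonneg_nonneg sum_nonneg mult_nonneg_nonneg) auto

lemma left_unfold_diff:
  assumes "tt_factors N d r X" "tt_factors N d r Z" "1 \<le> i" "i \<le> N"
  shows "left_unfold d r X i - left_unfold d r Z i = left_unfold d r (fac_diff X Z) i"
proof (rule left_unfold_ext)
  fix x a b assume xab: "x < d i" "a < r (i - 1)" "b < r i"
  then have "x * r (i - 1) + a < d i * r (i - 1)"
    by (metis add.commute add_less_cancel_left less_le_trans mult_Suc mult_le_mono1 Suc_leI)
  then have "(left_unfold d r X i - left_unfold d r Z i) $$ (x * r (i - 1) + a, b) =
    left_unfold d r X i $$ (x * r (i - 1) + a, b) - left_unfold d r Z i $$ (x * r (i - 1) + a, b)"
    using xab carrier_matD[OF left_unfold_carrier[of d r Z i]] by (intro index_minus_mat) auto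
  then show "(left_unfold d r X i - left_unfold d r Z i) $$ (x * r (i - 1) + a, b) =
    left_unfold d r (fac_diff X Z) i $$ (x * r (i - 1) + a, b)"
    using fac_diff_index[OF assms xab] left_unfold_index[of x d i a r b, OF xab] by simp
qed (rule minus_carrier_mat[OF left_unfold_carrier], rule left_unfold_carrier)

lemma tt_dist2_eq:
  assumes X: "tt_factors N d r X" and Xs: "tt_factors N d r Xs" and r: "r 0 = 1" "r N = 1" and N: "1 \<le> N"
  shows "tt_dist2 N d r X Xs =
    (INF R\<in>orth_families N r. aligned_dist2 N d r ((sigma_max N d (tt_tensor N d Xs))\<^sup>2) X (rotate_factors R Xs))"
  unfolding tt_dist2_def
proof (rule INF_cong[OF refl])
  fix R assume R: "R \<in> orth_families N r"
  note Z = tt_factors_rotate[OF R r Xs]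
  have F: "(fro_norm (left_unfold d r X i - left_unfold d r (rotate_factors R Xs) i))\<^sup>2 =
    fac_inner d r i (fac_diff X (rotate_factors R Xs) i) (fac_diff X (rotate_factors R Xs) i)" if "1 \<le> i" "i \<le> N" for i
    unfolding left_unfold_diff[OF X Z that] fro_norm_sq minner_left_unfold ..
  show "(\<Sum>i = 1..N - 1. (sigma_max N d (tt_tensor N d Xs))\<^sup>2 *
       (fro_norm (left_unfold d r X i - left_unfold d r (rotate_factors R Xs) i))\<^sup>2) +
      (fro_norm (left_unfold d r X N - left_unfold d r (rotate_factors R Xs) N))\<^sup>2 =
    aligned_dist2 N d r ((sigma_max N d (tt_tensor N d Xs))\<^sup>2) X (rotate_factors R Xs)"
    unfolding aligned_dist2_def using N
    by (intro arg_cong2[where f = "(+)"] sum.cong arg_cong2[where f = "(*)"] refl F) auto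
qed

lemma orth_families_nonempty: "r 0 = 1 \<Longrightarrow> r N = 1 \<Longrightarrow> (\<lambda>i. 1\<^sub>m (r i)) \<in> orth_families N r"
  by (auto simp: orth_families_def)

lemma tt_dist2_le:
  assumes X: "tt_factors N d r X" and Xs: "tt_factors N d r Xs" and r: "r 0 = 1" "r N = 1" and N: "1 \<le> N"
    and R: "R \<in> orth_families N r"
  shows "tt_dist2 N d r X Xs \<le> aligned_dist2 N d r ((sigma_max N d (tt_tensor N d Xs))\<^sup>2) X (rotate_factors R Xs)"
  unfolding tt_dist2_eq[OF X Xs r N]
  using R by (intro cINF_lower bdd_belowI2[where m = 0] aligned_dist2_nonneg) auto

lemma tt_dist2_greatest:
  assumes X: "tt_factors N d r X" and Xs: "tt_factors N d r Xs" and r: "r 0 = 1" "r N = 1" and N: "1 \<le> N"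
    and le: "\<And>R. R \<in> orth_families N r \<Longrightarrow>
      c \<le> aligned_dist2 N d r ((sigma_max N d (tt_tensor N d Xs))\<^sup>2) X (rotate_factors R Xs)"
  shows "c \<le> tt_dist2 N d r X Xs"
  unfolding tt_dist2_eq[OF X Xs r N]
  using le orth_families_nonempty[of r N] r by (intro cINF_greatest) auto

section \<open>Lower bound for the tensor error\<close>

definition iface_dist2 :: "(nat \<Rightarrow> nat) \<Rightarrow> (nat \<Rightarrow> nat) \<Rightarrow> factors \<Rightarrow> factors \<Rightarrow> nat \<Rightarrow> real" where
  "iface_dist2 d r X Z j = (\<Sum>s\<in>multi_idx d 1 j. \<Sum>b<r j. (seg r X 0 s 0 b - seg r Z 0 s 0 b)\<^sup>2)"

text \<open>The left interface of \<open>X\<close> applied to the slice difference equals the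
  difference of the longer interfaces minus the difference of the shorter ones times the slice of
  \<open>Z\<close>. As that interface is isometric, the norm of the slice difference can be read
  off.\<close>

lemma slice_diff_bound:
  assumes X: "tt_factors N d r X" "left_orthogonal N d r X" and Z: "tt_factors N d r Z"
    and r0: "r 0 = 1" and j: "j < N"
  shows "fac_inner d r (Suc j) (fac_diff X Z (Suc j)) (fac_diff X Z (Suc j)) \<le> 2 * iface_dist2 d r X Z (Suc j) +
    2 * (\<Sum>s\<in>multi_idx d 1 j. \<Sum>x<d (Suc j). \<Sum>b<r (Suc j).
      (\<Sum>a<r j. (seg r X 0 s 0 a - seg r Z 0 s 0 a) * Z (Suc j) x $$ (a, b))\<^sup>2)"
proof -
  define D where "D x a b = fac_diff X Z (Suc j) x $$ (a, b)" for x a b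
  define p where "p s x b = seg r X 0 (s @ [x]) 0 b - seg r Z 0 (s @ [x]) 0 b" for s x b
  define q where "q s x b = (\<Sum>a<r j. (seg r X 0 s 0 a - seg r Z 0 s 0 a) * Z (Suc j) x $$ (a, b))" for s x b
  have D: "(\<Sum>a<r j. seg r X 0 s 0 a * D x a b) = p s x b - q s x b"
    if s: "s \<in> multi_idx d 1 j" and x: "x < d (Suc j)" and b: "b < r (Suc j)" for s x b
  proof -
    have len: "length s = j" using s by (simp add: multi_idx_1_iff[unfolded One_nat_def])
    have "D x a b = X (Suc j) x $$ (a, b) - Z (Suc j) x $$ (a, b)" if "a < r j" for a
      unfolding D_def using j x b that by (intro fac_diff_index[OF X(1) Z]) auto
    then have "(\<Sum>a<r j. seg r X 0 s 0 a * D x a b) =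
      (\<Sum>a<r j. seg r X 0 s 0 a * X (Suc j) x $$ (a, b)) - (\<Sum>a<r j. seg r X 0 s 0 a * Z (Suc j) x $$ (a, b))"
      by (simp add: right_diff_distrib sum_subtractf)
    moreover have "seg r Y 0 (s @ [x]) 0 b = (\<Sum>a<r j. seg r Y 0 s 0 a * Y (Suc j) x $$ (a, b))" for Y
      using seg_snoc[of 0 r 0 b s Y x] r0 b len by simp
    ultimately show ?thesis by (simp add: p_def q_def left_diff_distrib sum_subtractf)
  qed
  have iso: "(\<Sum>s\<in>multi_idx d 1 j. (\<Sum>a<r j. seg r X 0 s 0 a * D x a b)\<^sup>2) = (\<Sum>a<r j. (D x a b)\<^sup>2)" for x b
    using left_interface_orthonormal[of r j d X "\<lambda>a. D x a b" "\<lambda>a. D x a b", OF r0] left_orthogonalD[OF X(2)] j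
    by (simp add: power2_eq_square)
  have "fac_inner d r (Suc j) (fac_diff X Z (Suc j)) (fac_diff X Z (Suc j)) = (\<Sum>x<d (Suc j). \<Sum>a<r j. \<Sum>b<r (Suc j). (D x a b)\<^sup>2)"
    by (simp add: fac_inner_def D_def power2_eq_square)
  also have "\<dots> = (\<Sum>x<d (Suc j). \<Sum>b<r (Suc j). \<Sum>a<r j. (D x a b)\<^sup>2)"
    by (rule sum.cong[OF refl sum.swap])
  also have "\<dots> = (\<Sum>x<d (Suc j). \<Sum>b<r (Suc j). \<Sum>s\<in>multi_idx d 1 j. (\<Sum>a<r j. seg r X 0 s 0 a * D x a b)\<^sup>2)"
    by (simp only: iso)
  also have "\<dots> = (\<Sum>s\<in>multi_idx d 1 j. \<Sum>x<d (Suc j). \<Sum>b<r (Suc j). (\<Sum>a<r j. seg r X 0 s 0 a * D x a b)\<^sup>2)"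
    by (rule sum_swap3[symmetric])
  also have "\<dots> = (\<Sum>s\<in>multi_idx d 1 j. \<Sum>x<d (Suc j). \<Sum>b<r (Suc j). (p s x b - q s x b)\<^sup>2)"
    using D by (intro sum.cong refl) simp
  also have "\<dots> \<le> (\<Sum>s\<in>multi_idx d 1 j. \<Sum>x<d (Suc j). \<Sum>b<r (Suc j). 2 * (p s x b)\<^sup>2 + 2 * (q s x b)\<^sup>2)"
  proof (intro sum_mono)
    fix s x b
    show "(p s x b - q s x b)\<^sup>2 \<le> 2 * (p s x b)\<^sup>2 + 2 * (q s x b)\<^sup>2"
      using zero_le_power2[of "p s x b + q s x b"] by (simp add: power2_eq_square algebra_simps)
  qed
  also have "\<dots> = 2 * (\<Sum>s\<in>multi_idx d 1 j. \<Sum>x<d (Suc j). \<Sum>b<r (Suc j). (p s x b)\<^sup>2) +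
    2 * (\<Sum>s\<in>multi_idx d 1 j. \<Sum>x<d (Suc j). \<Sum>b<r (Suc j). (q s x b)\<^sup>2)"
    by (simp add: sum.distrib sum_distrib_left)
  also have "(\<Sum>s\<in>multi_idx d 1 j. \<Sum>x<d (Suc j). \<Sum>b<r (Suc j). (p s x b)\<^sup>2) = iface_dist2 d r X Z (Suc j)"
    unfolding iface_dist2_def using sum_multi_idx_snoc[of 0 j] by (simp add: p_def)
  finally show ?thesis by (simp add: q_def)
qed

lemma iface_dist2_0: "r 0 = 1 \<Longrightarrow> iface_dist2 d r X Z 0 = 0"
  using multi_idx_empty[of d 0] by (simp add: iface_dist2_def)

text \<open>A left-orthogonal factor has squared Frobenius norm equal to its number of columns; this
  is how the ranks enter the constants.\<close>

lemma slice_diff_bound_orthogonal: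
  assumes X: "tt_factors N d r X" "left_orthogonal N d r X" and Z: "tt_factors N d r Z" "left_orthogonal N d r Z"
    and r0: "r 0 = 1" and j: "Suc j < N"
  shows "fac_inner d r (Suc j) (fac_diff X Z (Suc j)) (fac_diff X Z (Suc j)) \<le>
    2 * iface_dist2 d r X Z (Suc j) + 2 * (iface_dist2 d r X Z j * real (r (Suc j)))"
proof -
  define e where "e s a = seg r X 0 s 0 a - seg r Z 0 s 0 a" for s a
  have "minner (left_unfold d r Z (Suc j)) (left_unfold d r Z (Suc j)) = real (r (Suc j))"
    using left_orthogonalD[OF Z(2), of "Suc j"] j by (intro minner_self_orthonormal[OF left_unfold_carrier]) auto
  then have rr: "fac_inner d r (Suc j) (Z (Suc j)) (Z (Suc j)) = real (r (Suc j))"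
    by (simp add: minner_left_unfold)
  have "(\<Sum>s\<in>multi_idx d 1 j. \<Sum>x<d (Suc j). \<Sum>b<r (Suc j). (\<Sum>a<r j. e s a * Z (Suc j) x $$ (a, b))\<^sup>2) \<le>
    (\<Sum>s\<in>multi_idx d 1 j. \<Sum>x<d (Suc j). \<Sum>b<r (Suc j). (\<Sum>a<r j. (e s a)\<^sup>2) * (\<Sum>a<r j. (Z (Suc j) x $$ (a, b))\<^sup>2))"
    by (intro sum_mono sum_Cauchy_Schwarz)
  also have "\<dots> = (\<Sum>s\<in>multi_idx d 1 j. (\<Sum>a<r j. (e s a)\<^sup>2) * (\<Sum>x<d (Suc j). \<Sum>b<r (Suc j). \<Sum>a<r j. (Z (Suc j) x $$ (a, b))\<^sup>2))"
    by (simp add: sum_distrib_left)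
  also have "(\<Sum>x<d (Suc j). \<Sum>b<r (Suc j). \<Sum>a<r j. (Z (Suc j) x $$ (a, b))\<^sup>2) = fac_inner d r (Suc j) (Z (Suc j)) (Z (Suc j))"
    unfolding fac_inner_def power2_eq_square diff_Suc_1 by (rule sum.cong[OF refl sum.swap])
  also have "(\<Sum>s\<in>multi_idx d 1 j. (\<Sum>a<r j. (e s a)\<^sup>2) * fac_inner d r (Suc j) (Z (Suc j)) (Z (Suc j))) =
    iface_dist2 d r X Z j * real (r (Suc j))"
    unfolding rr by (simp add: iface_dist2_def e_def sum_distrib_right)
  finally show ?thesis
    using slice_diff_bound[OF X Z(1) r0, of j] j by (simp add: e_def)
qed

text \<open>The last factor is not orthogonal, but it is itself a right interface, whose operator
  norm replaces the Frobenius norm used for the other factors.\<close>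

lemma slice_diff_bound_last:
  assumes X: "tt_factors N d r X" "left_orthogonal N d r X" and Z: "tt_factors N d r Z"
    and r: "r 0 = 1" "r N = 1" and N: "N = Suc j" and M: "rbound N d r Z j M"
  shows "fac_inner d r N (fac_diff X Z N) (fac_diff X Z N) \<le>
    2 * (\<Sum>s\<in>multi_idx d 1 N. (seg r X 0 s 0 0 - seg r Z 0 s 0 0)\<^sup>2) + 2 * (M * iface_dist2 d r X Z j)"
proof -
  define e where "e s a = seg r X 0 s 0 a - seg r Z 0 s 0 a" for s a
  have "(\<Sum>x<d (Suc j). \<Sum>b<r (Suc j). (\<Sum>a<r j. e s a * Z (Suc j) x $$ (a, b))\<^sup>2) \<le> M * (\<Sum>a<r j. (e s a)\<^sup>2)" for s
  proof -
    have "(\<Sum>t\<in>multi_idx d (Suc j) N. (\<Sum>a<r j. e s a * seg r Z j t a 0)\<^sup>2) =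
      (\<Sum>x<d (Suc j). (\<Sum>a<r j. e s a * seg r Z j [x] a 0)\<^sup>2)"
      unfolding N by (rule sum_multi_idx_single)
    also have "\<dots> = (\<Sum>x<d (Suc j). \<Sum>b<r (Suc j). (\<Sum>a<r j. e s a * Z (Suc j) x $$ (a, b))\<^sup>2)"
      using r N by (simp add: seg_single del: seg.simps)
    finally show ?thesis using M[unfolded rbound_def, rule_format, of "e s"] by simp
  qed
  then have "(\<Sum>s\<in>multi_idx d 1 j. \<Sum>x<d (Suc j). \<Sum>b<r (Suc j). (\<Sum>a<r j. e s a * Z (Suc j) x $$ (a, b))\<^sup>2) \<le>
    (\<Sum>s\<in>multi_idx d 1 j. M * (\<Sum>a<r j. (e s a)\<^sup>2))" by (intro sum_mono)
  also have "\<dots> = M * iface_dist2 d r X Z j" by (simp add: iface_dist2_def e_def sum_distrib_left)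
  finally show ?thesis
    using slice_diff_bound[OF X Z r(1), of j] r N by (simp add: e_def iface_dist2_def)
qed

lemma sum_square_le_card:
  fixes f :: "nat \<Rightarrow> real"
  shows "(\<Sum>k\<in>{1..n}. f k)\<^sup>2 \<le> real n * (\<Sum>k\<in>{1..n}. (f k)\<^sup>2)"
proof -
  have eq: "(\<Sum>k\<in>{1..n}. g k) = (\<Sum>k<n. g (Suc k))" for g :: "nat \<Rightarrow> real"
    using sum.shift_bounds_cl_Suc_ivl[of g 0 "n - 1"] by (cases n) (simp_all add: lessThan_Suc_atMost atLeast0AtMost)
  have "(\<Sum>k<n. 1 * f (Suc k))\<^sup>2 \<le> (\<Sum>k<n. 1\<^sup>2) * (\<Sum>k<n. (f (Suc k))\<^sup>2)"
    by (rule sum_Cauchy_Schwarz)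
  then show ?thesis unfolding eq by simp
qed

text \<open>Every index belongs to \<open>n - 1\<close> of the unordered pairs.\<close>

lemma sum_pairs_add:
  fixes b :: "nat \<Rightarrow> real"
  assumes "1 \<le> n"
  shows "(\<Sum>i\<in>{1..n}. \<Sum>j\<in>{i<..n}. b i + b j) = real (n - 1) * (\<Sum>i\<in>{1..n}. b i)"
  using assms
proof (induction n rule: dec_induct)
  case (step n)
  have "(\<Sum>j\<in>{i<..Suc n}. b i + b j) = (\<Sum>j\<in>{i<..n}. b i + b j) + (b i + b (Suc n))" if "i \<in> {1..n}" for i
  proof -
    have "{i<..Suc n} = insert (Suc n) {i<..n}" using that by auto
    then show ?thesis by (simp add: algebra_simps)
  qed
  then have "(\<Sum>i\<in>{1..n}. \<Sum>j\<in>{i<..Suc n}. b i + b j) =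
    (\<Sum>i\<in>{1..n}. (\<Sum>j\<in>{i<..n}. b i + b j) + (b i + b (Suc n)))" by (rule sum.cong[OF refl])
  also have "\<dots> = real (n - 1) * (\<Sum>i\<in>{1..n}. b i) + (\<Sum>i\<in>{1..n}. b i) + real n * b (Suc n)"
    using step by (simp add: sum.distrib)
  finally show ?case using step(1) by (simp add: of_nat_diff algebra_simps)
qed simp

lemma rbound_mono:
  assumes "rbound N d r Y j M" "M \<le> M'"
  shows "rbound N d r Y j M'"
  unfolding rbound_def
proof
  fix u :: "nat \<Rightarrow> real"
  have "(\<Sum>t\<in>multi_idx d (Suc j) N. (\<Sum>a<r j. u a * seg r Y j t a 0)\<^sup>2) \<le> M * (\<Sum>a<r j. (u a)\<^sup>2)"
    using assms(1) unfolding rbound_def by blast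
  also have "\<dots> \<le> M' * (\<Sum>a<r j. (u a)\<^sup>2)" by (intro mult_right_mono assms(2) sum_nonneg) auto
  finally show "(\<Sum>t\<in>multi_idx d (Suc j) N. (\<Sum>a<r j. u a * seg r Y j t a 0)\<^sup>2) \<le> M' * (\<Sum>a<r j. (u a)\<^sup>2)" .
qed

section \<open>Comparison of tensor error and distance\<close>

locale tt_ground =
  fixes N :: nat and d r :: "nat \<Rightarrow> nat" and Xs :: factors
  assumes N: "2 \<le> N" and d1: "\<forall>i\<in>{1..N}. 1 \<le> d i" and r1: "\<forall>i\<in>{1..N - 1}. 1 \<le> r i"
    and r0: "r 0 = 1" and rN: "r N = 1" and Xs: "tt_factors N d r Xs" "left_orthogonal N d r Xs"
    and rank: "\<forall>i\<in>{1..N - 1}. tt_rank N d (tt_tensor N d Xs) i = r i"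
begin

abbreviation "Xstar \<equiv> tt_tensor N d Xs"
abbreviation "smax \<equiv> sigma_max N d Xstar"
abbreviation "smin \<equiv> sigma_min N d Xstar"

definition err2 :: "factors \<Rightarrow> real" where
  "err2 X = (tensor_norm N d (\<lambda>s. tt_tensor N d X s - Xstar s))\<^sup>2"

lemma err2_nonneg: "0 \<le> err2 X" by (simp add: err2_def)

lemma err2_seg:
  assumes "tt_factors N d r X"
  shows "err2 X = (\<Sum>s\<in>multi_idx d 1 N. (seg r X 0 s 0 0 - seg r Xs 0 s 0 0)\<^sup>2)"
  unfolding err2_def tensor_norm_sq
  using tt_tensor_seg[OF assms r0 rN] tt_tensor_seg[OF Xs(1) r0 rN] by (intro sum.cong refl) simp

lemma unfold_carrier:
  "tensor_unfold N d j Xstar \<in> carrier_mat (length (multi_idx_list d 1 j)) (length (multi_idx_list d (Suc j) N))"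
  by (rule tensor_unfold_dim)

lemma cols_pos: "j < N \<Longrightarrow> 1 \<le> length (multi_idx_list d (Suc j) N)"
  using multi_idx_list_nonempty[OF d1] by (simp add: Suc_le_eq)

lemma rank_le_cols_j: "j \<in> {1..N - 1} \<Longrightarrow> r j \<le> length (multi_idx_list d (Suc j) N)"
  using rank rank_le_cols[of "tensor_unfold N d j Xstar"] carrier_matD[OF unfold_carrier[of j]]
  by (auto simp: tt_rank_def)

lemma smax_ge: "j \<in> {1..N - 1} \<Longrightarrow> singular_value (tensor_unfold N d j Xstar) 1 \<le> smax"
  unfolding sigma_max_def by (intro Max_ge) auto

lemma smin_le: "j \<in> {1..N - 1} \<Longrightarrow> smin \<le> singular_value (tensor_unfold N d j Xstar) (r j)"
  unfolding sigma_min_def using rank by (intro Min_le) auto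

lemma smin_nonneg: "0 \<le> smin"
proof -
  have "0 \<le> singular_value (tensor_unfold N d i Xstar) (tt_rank N d Xstar i)" if "i \<in> {1..N - 1}" for i
    using singular_value_nonneg[OF unfold_carrier] rank_le_cols_j[OF that] r1 rank that by auto
  then show ?thesis unfolding sigma_min_def using N by (subst Min_ge_iff) auto
qed

lemma smin_le_smax: "smin \<le> smax"
proof -
  have 1: "1 \<in> {1..N - 1}" using N by auto
  have "singular_value (tensor_unfold N d 1 Xstar) (r 1) \<le> singular_value (tensor_unfold N d 1 Xstar) 1"
    using r1 1 by (intro singular_value_antimono[OF unfold_carrier] rank_le_cols_j) auto
  then show ?thesis using smax_ge[OF 1] smin_le[OF 1] by linarith
qed

lemma singular_value_1_sq_le: "j \<in> {1..N - 1} \<Longrightarrow> (singular_value (tensor_unfold N d j Xstar) 1)\<^sup>2 \<le> smax\<^sup>2"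
  using smax_ge singular_value_nonneg[OF unfold_carrier, of 1] cols_pos[of j] by (intro power_mono) auto

lemma unfold_bound:
  assumes j: "j \<in> {1..N - 1}"
  shows "(\<Sum>t\<in>multi_idx d (Suc j) N. (\<Sum>s\<in>multi_idx d 1 j. z s * Xstar (s @ t))\<^sup>2) \<le> smax\<^sup>2 * (\<Sum>s\<in>multi_idx d 1 j. (z s)\<^sup>2)"
proof -
  have "(\<Sum>t\<in>multi_idx d (Suc j) N. (\<Sum>s\<in>multi_idx d 1 j. z s * Xstar (s @ t))\<^sup>2) \<le>
    (singular_value (tensor_unfold N d j Xstar) 1)\<^sup>2 * (\<Sum>s\<in>multi_idx d 1 j. (z s)\<^sup>2)"
    using j by (intro tensor_unfold_bound[OF d1]) auto
  also have "\<dots> \<le> smax\<^sup>2 * (\<Sum>s\<in>multi_idx d 1 j. (z s)\<^sup>2)"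
    by (intro mult_right_mono singular_value_1_sq_le[OF j] sum_nonneg) auto
  finally show ?thesis .
qed

lemma append_multi_idx:
  assumes "j \<le> N" "s \<in> multi_idx d 1 j" "t \<in> multi_idx d (Suc j) N"
  shows "s @ t \<in> multi_idx d 1 N"
  using multi_idx_append[of s d 0 j t "N - j"] assms by simp

text \<open>One number in two roles: the weight of block \<open>j\<close> in the distance, and the
  squared bound on the right interface after mode \<open>j\<close> of the target.\<close>

definition weight :: "nat \<Rightarrow> real" where
  "weight j = (if j < N then smax\<^sup>2 else 1)"

lemma weight_nonneg [simp]: "0 \<le> weight j" by (simp add: weight_def)

context
  fixes R assumes R: "R \<in> orth_families N r"
begin

abbreviation "Z \<equiv> rotate_factors R Xs"

lemma Z: "tt_factors N d r Z" "left_orthogonal N d r Z"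
  using tt_factors_rotate[OF R r0 rN Xs(1)] left_orthogonal_rotate[OF R r0 rN Xs(1) Xs(2)] by auto

lemma seg_Z: "s \<in> multi_idx d 1 N \<Longrightarrow> seg r Z 0 s 0 0 = seg r Xs 0 s 0 0"
  by (rule seg_rotate_full[OF R r0 rN Xs(1)])

lemma rbound_Z:
  assumes "1 \<le> j" "j \<le> N"
  shows "rbound N d r Z j (weight j)"
proof (cases "j = N")
  case True
  then show ?thesis using rbound_N[of r N, OF rN] by (simp add: weight_def)
next
  case False
  then have j: "j < N" using assms by simp
  have "rbound N d r Z j (smax\<^sup>2)"
  proof (rule rbound_of_unfold[of r, OF r0 assms(2)])
    fix i assume "1 \<le> i" "i \<le> j"
    then show "(left_unfold d r Z i)\<^sup>T * left_unfold d r Z i = 1\<^sub>m (r i)"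
      using left_orthogonalD[OF Z(2), of i] j by simp
  next
    fix z
    have "(\<Sum>t\<in>multi_idx d (Suc j) N. (\<Sum>s\<in>multi_idx d 1 j. z s * seg r Z 0 (s @ t) 0 0)\<^sup>2) =
      (\<Sum>t\<in>multi_idx d (Suc j) N. (\<Sum>s\<in>multi_idx d 1 j. z s * Xstar (s @ t))\<^sup>2)"
      using append_multi_idx[OF assms(2)] seg_Z tt_tensor_seg[OF Xs(1) r0 rN]
      by (intro sum.cong refl arg_cong[where f = "\<lambda>x. x\<^sup>2"]) simp
    then show "(\<Sum>t\<in>multi_idx d (Suc j) N. (\<Sum>s\<in>multi_idx d 1 j. z s * seg r Z 0 (s @ t) 0 0)\<^sup>2) \<le>
      smax\<^sup>2 * (\<Sum>s\<in>multi_idx d 1 j. (z s)\<^sup>2)"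
      using unfold_bound[of j z] assms j by simp
  qed
  then show ?thesis using j by (simp add: weight_def)
qed

lemma aligned_dist2_weight:
  "aligned_dist2 N d r (smax\<^sup>2) X Y = (\<Sum>i\<in>{1..N}. weight i * fac_inner d r i (fac_diff X Y i) (fac_diff X Y i))"
proof -
  have "{1..N} = insert N {1..N - 1}" using N by auto
  moreover have "N \<notin> {1..N - 1}" using N by auto
  ultimately have "(\<Sum>i\<in>{1..N}. weight i * fac_inner d r i (fac_diff X Y i) (fac_diff X Y i)) =
    weight N * fac_inner d r N (fac_diff X Y N) (fac_diff X Y N) +
    (\<Sum>i\<in>{1..N - 1}. weight i * fac_inner d r i (fac_diff X Y i) (fac_diff X Y i))" by simp
  moreover have "(\<Sum>i\<in>{1..N - 1}. weight i * fac_inner d r i (fac_diff X Y i) (fac_diff X Y i)) =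
    (\<Sum>i\<in>{1..N - 1}. smax\<^sup>2 * fac_inner d r i (fac_diff X Y i) (fac_diff X Y i))"
    using N by (intro sum.cong refl) (auto simp: weight_def)
  ultimately show ?thesis by (simp add: aligned_dist2_def weight_def)
qed

lemma rbound_mix:
  assumes "1 \<le> j" "j \<le> N"
  shows "rbound N d r (mix X Z j) j (weight j)"
  using rbound_cong[OF rbound_Z[OF assms] assms(2), of "mix X Z j"] by (auto simp: mix_def)

text \<open>The error telescopes into \<open>N\<close> tensors with one replaced factor each, and
  squaring this sum costs the factor \<open>N\<close>. The factors of \<open>X\<close> stand on the
  left and those of \<open>Z\<close> on the right, so no basin condition enters.\<close>

lemma err2_le_aligned:
  assumes X: "tt_factors N d r X" "left_orthogonal N d r X"
  shows "err2 X \<le> real N * aligned_dist2 N d r (smax\<^sup>2) X Z"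
proof -
  let ?T = "\<lambda>k s. seg r ((mix X Z k)(k := fac_diff X Z k)) 0 s 0 0"
  have "err2 X = (\<Sum>s\<in>multi_idx d 1 N. (\<Sum>k\<in>{1..N}. ?T k s)\<^sup>2)"
    unfolding err2_seg[OF X(1)]
  proof (intro sum.cong refl)
    fix s assume s: "s \<in> multi_idx d 1 N"
    have "{0<..N} = {1..N}" by auto
    then show "(seg r X 0 s 0 0 - seg r Xs 0 s 0 0)\<^sup>2 = (\<Sum>k\<in>{1..N}. ?T k s)\<^sup>2"
      using seg_telescope[OF X(1) Z(1) r0 s, of 0] seg_Z[OF s] by simp
  qed
  also have "\<dots> \<le> (\<Sum>s\<in>multi_idx d 1 N. real N * (\<Sum>k\<in>{1..N}. (?T k s)\<^sup>2))"
    by (intro sum_mono sum_square_le_card)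
  also have "\<dots> = real N * (\<Sum>k\<in>{1..N}. \<Sum>s\<in>multi_idx d 1 N. (?T k s)\<^sup>2)"
    by (subst sum.swap) (simp add: sum_distrib_left)
  also have "\<dots> \<le> real N * (\<Sum>k\<in>{1..N}. weight k * fac_inner d r k (fac_diff X Z k) (fac_diff X Z k))"
  proof (intro mult_left_mono sum_mono)
    fix k assume k: "k \<in> {1..N}"
    show "(\<Sum>s\<in>multi_idx d 1 N. (?T k s)\<^sup>2) \<le> weight k * fac_inner d r k (fac_diff X Z k) (fac_diff X Z k)"
      using k by (intro seg_norm_upd[of r, OF r0 _ _ X(2)] rbound_mix) (auto simp: mix_def)
  qed simp
  finally show ?thesis unfolding aligned_dist2_weight .
qed

end

text \<open>The right interfaces of an iterate are controlled by its unfoldings, which differ from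
  those of the target by at most half of \<open>smax\<close> in operator norm.\<close>

lemma rbound_X:
  assumes X: "tt_factors N d r X" "left_orthogonal N d r X" and err: "err2 X \<le> smax\<^sup>2 / 4"
    and j: "1 \<le> j" "j \<le> N"
  shows "rbound N d r X j (9/4 * weight j)"
proof (cases "j = N")
  case True
  have "rbound N d r X N 1" by (rule rbound_N[of r N, OF rN])
  then have "rbound N d r X N (9/4)" by (rule rbound_mono) simp
  then show ?thesis unfolding True by (simp add: weight_def)
next
  case False
  then have jN: "j < N" using j by simp
  have "rbound N d r X j (9/4 * smax\<^sup>2)"
  proof (rule rbound_of_unfold[of r, OF r0 j(2)])
    fix i assume "1 \<le> i" "i \<le> j"
    then show "(left_unfold d r X i)\<^sup>T * left_unfold d r X i = 1\<^sub>m (r i)"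
      using left_orthogonalD[OF X(2), of i] jN by simp
  next
    fix z
    let ?f = "\<lambda>t. \<Sum>s\<in>multi_idx d 1 j. z s * Xstar (s @ t)"
    let ?g = "\<lambda>t. \<Sum>s\<in>multi_idx d 1 j. z s * (tt_tensor N d X (s @ t) - Xstar (s @ t))"
    have "(\<Sum>t\<in>multi_idx d (Suc j) N. (\<Sum>s\<in>multi_idx d 1 j. z s * seg r X 0 (s @ t) 0 0)\<^sup>2) =
      (\<Sum>t\<in>multi_idx d (Suc j) N. (?f t + ?g t)\<^sup>2)"
      using append_multi_idx[OF j(2)] tt_tensor_seg[OF X(1) r0 rN]
      by (intro sum.cong refl arg_cong[where f = "\<lambda>x. x\<^sup>2"])
        (simp add: sum.distrib[symmetric] distrib_left[symmetric])
    also have "\<dots> \<le> (9/4 * smax\<^sup>2) * (\<Sum>s\<in>multi_idx d 1 j. (z s)\<^sup>2)"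
    proof (rule sum_square_perturb)
      show "(\<Sum>t\<in>multi_idx d (Suc j) N. (?f t)\<^sup>2) \<le> smax\<^sup>2 * (\<Sum>s\<in>multi_idx d 1 j. (z s)\<^sup>2)"
        using unfold_bound[of j z] j jN by simp
      show "(\<Sum>t\<in>multi_idx d (Suc j) N. (?g t)\<^sup>2) \<le> err2 X * (\<Sum>s\<in>multi_idx d 1 j. (z s)\<^sup>2)"
        unfolding err2_def by (rule unfold_Cauchy_Schwarz[OF j(2)])
    qed (use err in \<open>auto intro: sum_nonneg\<close>)
    finally show "(\<Sum>t\<in>multi_idx d (Suc j) N. (\<Sum>s\<in>multi_idx d 1 j. z s * seg r X 0 (s @ t) 0 0)\<^sup>2) \<le>
      (9/4 * smax\<^sup>2) * (\<Sum>s\<in>multi_idx d 1 j. (z s)\<^sup>2)" .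
  qed
  then show ?thesis using jN by (simp add: weight_def)
qed

lemma tt_dist2_le_err2:
  assumes X: "tt_factors N d r X" "left_orthogonal N d r X"
  shows "smin\<^sup>2 * tt_dist2 N d r X Xs \<le>
    8 * (real N + 1 + (\<Sum>i = 2..N - 1. real (r i))) * (smax\<^sup>2 * err2 X)"
proof -
  define P where "P j Q \<longleftrightarrow> Q \<in> carrier_mat (r j) (r j) \<and> Q\<^sup>T * Q = 1\<^sub>m (r j) \<and>
    smin\<^sup>2 * (\<Sum>s\<in>multi_idx d 1 j. \<Sum>b<r j. (seg r X 0 s 0 b - (\<Sum>a<r j. seg r Xs 0 s 0 a * Q $$ (a, b)))\<^sup>2) \<le> 4 * err2 X"
    for j Q
  have "\<exists>Q. P j Q" if j: "j \<in> {1..N - 1}" for j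
  proof -
    have j': "1 \<le> j" "j < N" "1 \<le> r j" using j r1 by auto
    obtain Q where Q: "Q \<in> carrier_mat (r j) (r j)" "Q\<^sup>T * Q = 1\<^sub>m (r j)"
      "(singular_value (tensor_unfold N d j Xstar) (r j))\<^sup>2 *
      (\<Sum>s\<in>multi_idx d 1 j. \<Sum>b<r j. (seg r X 0 s 0 b - (\<Sum>a<r j. seg r Xs 0 s 0 a * Q $$ (a, b)))\<^sup>2) \<le> 4 * err2 X"
      unfolding err2_def using interface_alignment[OF X Xs r0 rN j' rank[rule_format, OF j]] by blast
    have "smin\<^sup>2 \<le> (singular_value (tensor_unfold N d j Xstar) (r j))\<^sup>2"
      using smin_le[OF j] smin_nonneg by (intro power_mono)
    then have "smin\<^sup>2 * (\<Sum>s\<in>multi_idx d 1 j. \<Sum>b<r j. (seg r X 0 s 0 b - (\<Sum>a<r j. seg r Xs 0 s 0 a * Q $$ (a, b)))\<^sup>2) \<le>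
      (singular_value (tensor_unfold N d j Xstar) (r j))\<^sup>2 *
      (\<Sum>s\<in>multi_idx d 1 j. \<Sum>b<r j. (seg r X 0 s 0 b - (\<Sum>a<r j. seg r Xs 0 s 0 a * Q $$ (a, b)))\<^sup>2)"
      by (intro mult_right_mono sum_nonneg) auto
    then show ?thesis using Q unfolding P_def by (intro exI[of _ Q]) auto
  qed
  then have "\<forall>j\<in>{1..N - 1}. \<exists>Q. P j Q" by blast
  then obtain Q where Q: "\<forall>j\<in>{1..N - 1}. P j (Q j)" using bchoice by metis
  \<comment> \<open>The alignments of different interfaces are chosen independently, because an
    admissible family couples them only through the fixed ends.\<close>
  define R where "R j = (if j \<in> {1..N - 1} then Q j else 1\<^sub>m 1)" for j
  have R: "R \<in> orth_families N r" using Q N by (auto simp: orth_families_def R_def P_def)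
  let ?Z = "rotate_factors R Xs"
  note Z = Z[OF R]
  define T where "T = iface_dist2 d r X ?Z"
  define e where "e = err2 X"
  \<comment> \<open>To the left of the first factor there is no interface error, which is why the
    sum of the ranks starts at 2.\<close>
  have T0: "T 0 = 0" unfolding T_def by (rule iface_dist2_0[of r, OF r0])
  have T: "smin\<^sup>2 * T j \<le> 4 * e" if j: "j \<in> {1..N - 1}" for j
  proof -
    have jN: "j \<le> N" using j by auto
    have "T j = (\<Sum>s\<in>multi_idx d 1 j. \<Sum>b<r j. (seg r X 0 s 0 b - (\<Sum>a<r j. seg r Xs 0 s 0 a * Q j $$ (a, b)))\<^sup>2)"
      unfolding T_def iface_dist2_def
    proof (intro sum.cong refl)
      fix s b assume "s \<in> multi_idx d 1 j" "b \<in> {..<r j}"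
      then have "seg r ?Z 0 s 0 b = (\<Sum>a<r j. seg r Xs 0 s 0 a * Q j $$ (a, b))"
        using seg_rotate_left[OF R r0 rN Xs(1) jN, of s b] j by (simp add: R_def)
      then show "(seg r X 0 s 0 b - seg r ?Z 0 s 0 b)\<^sup>2 = (seg r X 0 s 0 b - (\<Sum>a<r j. seg r Xs 0 s 0 a * Q j $$ (a, b)))\<^sup>2"
        by simp
    qed
    then show ?thesis using Q j by (simp add: e_def P_def)
  qed
  let ?f = "\<lambda>i. fac_inner d r i (fac_diff X ?Z i) (fac_diff X ?Z i)"
  have e0: "0 \<le> e" by (simp add: e_def err2_nonneg)
  have f: "smin\<^sup>2 * ?f i \<le> 8 * e + (if i = 1 then 0 else 8 * (real (r i) * e))" if i: "i \<in> {1..N - 1}" for i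
  proof -
    obtain j where j: "i = Suc j" using i by (cases i) auto
    have "?f i \<le> 2 * T i + 2 * (T j * real (r i))"
      unfolding T_def j using i j by (intro slice_diff_bound_orthogonal[OF X Z r0]) auto
    then have "smin\<^sup>2 * ?f i \<le> smin\<^sup>2 * (2 * T i + 2 * (T j * real (r i)))"
      by (intro mult_left_mono) auto
    also have "\<dots> = 2 * (smin\<^sup>2 * T i) + 2 * (real (r i) * (smin\<^sup>2 * T j))" by (simp add: algebra_simps)
    also have "\<dots> \<le> 2 * (4 * e) + (if i = 1 then 0 else 2 * (real (r i) * (4 * e)))"
    proof (cases "i = 1")
      case True
      then show ?thesis using T[OF i] T0 j by (simp add: mult.commute)
    next
      case False
      then have "j \<in> {1..N - 1}" using i j by auto
      then have "real (r i) * (smin\<^sup>2 * T j) \<le> real (r i) * (4 * e)" using T by (intro mult_left_mono) auto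
      then have "2 * (smin\<^sup>2 * T i) + 2 * (real (r i) * (smin\<^sup>2 * T j)) \<le> 2 * (4 * e) + 2 * (real (r i) * (4 * e))"
        using T[OF i] by linarith
      then show ?thesis using False by (simp only: if_False)
    qed
    also have "\<dots> = 8 * e + (if i = 1 then 0 else 8 * (real (r i) * e))" by simp
    finally show ?thesis .
  qed
  have last: "smin\<^sup>2 * ?f N \<le> 10 * (smax\<^sup>2 * e)"
  proof -
    obtain j where j: "N = Suc j" using N by (cases N) auto
    have jj: "j \<in> {1..N - 1}" and jN: "j < N" using N j by auto
    have rb: "rbound N d r ?Z j (smax\<^sup>2)" using rbound_Z[OF R, of j] jj jN by (simp add: weight_def)
    have "?f N \<le> 2 * e + 2 * (smax\<^sup>2 * T j)"
      using slice_diff_bound_last[OF X Z(1) r0 rN j rb] seg_Z[OF R]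
      by (simp add: T_def e_def err2_seg[OF X(1)])
    then have "smin\<^sup>2 * ?f N \<le> smin\<^sup>2 * (2 * e + 2 * (smax\<^sup>2 * T j))" by (intro mult_left_mono) auto
    also have "\<dots> = 2 * (smin\<^sup>2 * e) + 2 * (smax\<^sup>2 * (smin\<^sup>2 * T j))" by (simp add: algebra_simps)
    also have "\<dots> \<le> 2 * (smax\<^sup>2 * e) + 2 * (smax\<^sup>2 * (4 * e))"
      using T[OF jj] smin_le_smax smin_nonneg e0
      by (intro add_mono mult_left_mono mult_right_mono power_mono) auto
    also have "\<dots> = 10 * (smax\<^sup>2 * e)" by simp
    finally show ?thesis .
  qed
  have "smin\<^sup>2 * tt_dist2 N d r X Xs \<le> smin\<^sup>2 * aligned_dist2 N d r (smax\<^sup>2) X ?Z"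
    using N by (intro mult_left_mono tt_dist2_le[OF X(1) Xs(1) r0 rN _ R]) auto
  also have "\<dots> = smax\<^sup>2 * (\<Sum>i = 1..N - 1. smin\<^sup>2 * ?f i) + smin\<^sup>2 * ?f N"
    by (simp add: aligned_dist2_def sum_distrib_left distrib_left mult.left_commute)
  also have "\<dots> \<le> smax\<^sup>2 * (\<Sum>i = 1..N - 1. 8 * e + (if i = 1 then 0 else 8 * (real (r i) * e))) + 10 * (smax\<^sup>2 * e)"
    using f last by (intro add_mono mult_left_mono sum_mono) auto
  also have "(\<Sum>i = 1..N - 1. 8 * e + (if i = 1 then 0 else 8 * (real (r i) * e))) =
    8 * real (N - 1) * e + 8 * (\<Sum>i = 2..N - 1. real (r i)) * e"
  proof -
    have "{1..N - 1} = insert 1 {2..N - 1}" using N by auto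
    then have "(\<Sum>i = 1..N - 1. if i = 1 then 0 else 8 * (real (r i) * e)) =
      (\<Sum>i\<in>{2..N - 1}. if i = 1 then 0 else 8 * (real (r i) * e))" by simp
    also have "\<dots> = (\<Sum>i = 2..N - 1. 8 * (real (r i) * e))" by (intro sum.cong refl) auto
    finally show ?thesis by (simp add: sum.distrib sum_distrib_left sum_distrib_right mult.assoc)
  qed
  \<comment> \<open>The first N - 1 blocks give 8 each plus the rank terms, the last gives 10;
    rounding the surplus 2 up to 8 produces the \<open>N + 1\<close> of the constant.\<close>
  also have "smax\<^sup>2 * (8 * real (N - 1) * e + 8 * (\<Sum>i = 2..N - 1. real (r i)) * e) + 10 * (smax\<^sup>2 * e) =
    (8 * (real N + (\<Sum>i = 2..N - 1. real (r i))) + 2) * (smax\<^sup>2 * e)"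
    using N by (simp add: of_nat_diff algebra_simps)
  also have "\<dots> \<le> (8 * (real N + 1 + (\<Sum>i = 2..N - 1. real (r i)))) * (smax\<^sup>2 * e)"
    using e0 by (intro mult_right_mono) auto
  finally show ?thesis by (simp add: e_def mult.assoc)
qed

end

section \<open>One step of the method\<close>

lemma left_unfold_mult:
  assumes "tt_factors N d r X" "1 \<le> i" "i \<le> N" "P \<in> carrier_mat (r i) (r i)"
  shows "left_unfold d r X i * P = left_unfold d r (\<lambda>i x. X i x * P) i"
proof (rule left_unfold_ext)
  fix x a b assume xab: "x < d i" "a < r (i - 1)" "b < r i"
  then have p: "x * r (i - 1) + a < d i * r (i - 1)"
    by (metis add.commute add_less_cancel_left less_le_trans mult_Suc mult_le_mono1 Suc_leI)
  have Xc: "X i x \<in> carrier_mat (r (i - 1)) (r i)" using assms xab by (auto simp: tt_factors_def)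
  have "(left_unfold d r X i * P) $$ (x * r (i - 1) + a, b) =
    (\<Sum>c<r i. left_unfold d r X i $$ (x * r (i - 1) + a, c) * P $$ (c, b))"
    using p xab assms(4) carrier_matD[OF left_unfold_carrier[of d r X i]] by (simp add: scalar_prod_def lessThan_atLeast0)
  also have "\<dots> = (\<Sum>c<r i. X i x $$ (a, c) * P $$ (c, b))"
    using left_unfold_index[of x d i a r, OF xab(1,2)] by (intro sum.cong refl) auto
  also have "\<dots> = (X i x * P) $$ (a, b)"
    using Xc xab assms(4) by (simp add: scalar_prod_def lessThan_atLeast0)
  also have "\<dots> = left_unfold d r (\<lambda>i x. X i x * P) i $$ (x * r (i - 1) + a, b)"
    using left_unfold_index[of x d i a r b, OF xab] by simp
  finally show "(left_unfold d r X i * P) $$ (x * r (i - 1) + a, b) =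
    left_unfold d r (\<lambda>i x. X i x * P) i $$ (x * r (i - 1) + a, b)" .
qed (rule mult_carrier_mat[OF left_unfold_carrier[of d r X i] assms(4)], rule left_unfold_carrier)

lemma minner_gram_le:
  assumes "A \<in> carrier_mat p n"
  shows "minner (A\<^sup>T * A) (A\<^sup>T * A) \<le> (minner A A)\<^sup>2"
proof -
  have "minner (A\<^sup>T * A) (A\<^sup>T * A) = (\<Sum>a<n. \<Sum>b<n. (\<Sum>k<p. A $$ (k, a) * A $$ (k, b))\<^sup>2)"
    using assms by (simp add: minner_def scalar_prod_def lessThan_atLeast0 power2_eq_square)
  also have "\<dots> \<le> (\<Sum>a<n. \<Sum>b<n. (\<Sum>k<p. (A $$ (k, a))\<^sup>2) * (\<Sum>k<p. (A $$ (k, b))\<^sup>2))"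
    by (intro sum_mono sum_Cauchy_Schwarz)
  also have "\<dots> = (\<Sum>a<n. \<Sum>k<p. (A $$ (k, a))\<^sup>2)\<^sup>2"
    by (simp add: sum_product power2_eq_square)
  also have "(\<Sum>a<n. \<Sum>k<p. (A $$ (k, a))\<^sup>2) = minner A A"
    using assms by (subst sum.swap) (simp add: minner_def power2_eq_square)
  finally show ?thesis .
qed

lemma dual_sum_add: "dual_sum N d m A g (\<lambda>s. T s + T' s) = dual_sum N d m A g T + dual_sum N d m A g T'"
  by (simp add: dual_sum_def tensor_inner_def algebra_simps sum.distrib sum_distrib_left)

lemma dual_sum_sum:
  "dual_sum N d m A g (\<lambda>s. \<Sum>i\<in>I. T i s) = (\<Sum>i\<in>I. dual_sum N d m A g (T i))"
  by (induction I rule: infinite_finite_induct)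
    (simp_all add: dual_sum_add, simp_all add: dual_sum_def tensor_inner_def)

lemma dual_sum_cong:
  "(\<And>s. s \<in> multi_idx d 1 N \<Longrightarrow> T s = T' s) \<Longrightarrow> dual_sum N d m A g T = dual_sum N d m A g T'"
proof -
  assume "\<And>s. s \<in> multi_idx d 1 N \<Longrightarrow> T s = T' s"
  then have "tensor_inner N d B T = tensor_inner N d B T'" for B by (rule tensor_inner_cong)
  then show ?thesis by (simp add: dual_sum_def)
qed

section \<open>Descent inequality for a single iterate\<close>

locale tt_recovery = tt_ground +
  fixes m :: nat and A :: "nat \<Rightarrow> tensor" and sv y :: "real vec" and \<delta> :: real and K :: nat
  assumes m: "0 < m" and sv: "sv \<in> carrier_vec m"
    and y: "y = measure_op N d m A (tt_tensor N d Xs) + sv"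
    and K: "\<forall>i\<in>{1..N - 1}. r i \<le> K" and rip: "l1l2_rip N d m A K \<delta>"
    and sharp: "sharpness N d r m A (tt_tensor N d Xs) sv \<delta>"
begin

definition "\<alpha> = (1 - 2 * nonzero_frac sv) * sqrt (2 / pi) - \<delta>"
definition "\<beta> = sqrt (2 / pi) + \<delta>"

lemma beta_pos: "0 < \<beta>"
  using rip by (simp add: \<beta>_def l1l2_rip_def add_nonneg_pos)

lemma alpha_le_beta: "\<alpha> \<le> \<beta>"
proof -
  have "0 \<le> nonzero_frac sv" by (simp add: nonzero_frac_def)
  then have "(1 - 2 * nonzero_frac sv) * sqrt (2 / pi) \<le> 1 * sqrt (2 / pi)" by (intro mult_right_mono) auto
  moreover have "0 < \<delta>" using rip by (simp add: l1l2_rip_def)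
  ultimately show ?thesis unfolding \<alpha>_def \<beta>_def by linarith
qed

text \<open>Coefficients bounded by 1 reduce the pairing to the scaled l1 norm of the measurements,
  and the RIP turns this into the tensor norm, here bounded by \<open>c\<close>.\<close>

lemma rip_dual:
  assumes Y: "tt_factors N d r Y" and g: "\<And>k. \<bar>g k\<bar> \<le> 1"
    and le: "(\<Sum>s\<in>multi_idx d 1 N. (seg r Y 0 s 0 0)\<^sup>2) \<le> c\<^sup>2" and c: "0 \<le> c"
  shows "\<bar>dual_sum N d m A g (\<lambda>s. seg r Y 0 s 0 0)\<bar> \<le> \<beta> * c"
proof -
  define T where "T = tt_tensor N d Y"
  have "dual_sum N d m A g (\<lambda>s. seg r Y 0 s 0 0) = dual_sum N d m A g T"
    using tt_tensor_seg[OF Y r0 rN] by (intro dual_sum_cong) (simp add: T_def)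
  also have "\<bar>\<dots>\<bar> = 1 / real m * \<bar>\<Sum>k<m. g k * tensor_inner N d (A k) T\<bar>"
    by (simp add: dual_sum_def abs_mult)
  also have "\<dots> \<le> 1 / real m * (\<Sum>k<m. \<bar>tensor_inner N d (A k) T\<bar>)"
  proof (intro mult_left_mono order_trans[OF sum_abs] sum_mono)
    show "\<bar>g k * tensor_inner N d (A k) T\<bar> \<le> \<bar>tensor_inner N d (A k) T\<bar>" for k
      using mult_right_mono[OF g[of k], of "\<bar>tensor_inner N d (A k) T\<bar>"] by (simp add: abs_mult)
  qed simp
  also have "\<dots> = 1 / real m * l1_norm (measure_op N d m A T)"
    by (simp add: l1_norm_def measure_op_def)
  also have "\<dots> \<le> \<beta> * tensor_norm N d T"
  proof -
    have "has_tt_format N d r T" using Y r0 rN by (auto simp: has_tt_format_def T_def)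
    then show ?thesis using rip K unfolding l1l2_rip_def \<beta>_def by blast
  qed
  also have "tensor_norm N d T \<le> c"
  proof (rule power2_le_imp_le[OF _ c])
    have "(tensor_norm N d T)\<^sup>2 = (\<Sum>s\<in>multi_idx d 1 N. (seg r Y 0 s 0 0)\<^sup>2)"
      unfolding tensor_norm_sq using tt_tensor_seg[OF Y r0 rN] by (intro sum.cong refl) (simp add: T_def)
    then show "(tensor_norm N d T)\<^sup>2 \<le> c\<^sup>2" using le by simp
  qed
  finally show ?thesis using beta_pos by (simp add: mult_left_mono)
qed

context
  fixes X :: factors and R :: "nat \<Rightarrow> real mat"
  assumes X: "tt_factors N d r X" "left_orthogonal N d r X"
    and err: "err2 X \<le> smax\<^sup>2 / 4" and smax: "0 < smax" and R: "R \<in> orth_families N r"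
begin

private abbreviation "Zr \<equiv> rotate_factors R Xs"
private abbreviation "\<Delta> \<equiv> fac_diff X Zr"
private abbreviation "f i \<equiv> fac_inner d r i (\<Delta> i) (\<Delta> i)"
private abbreviation "G \<equiv> tt_subgrad N d r m A y X"
private abbreviation "g k \<equiv> sgn (tensor_inner N d (A k) (tt_tensor N d X) - y $ k)"
private abbreviation "dual \<equiv> dual_sum N d m A g"
private abbreviation "D \<equiv> aligned_dist2 N d r (smax\<^sup>2) X Zr"

private lemma g1: "\<bar>g k\<bar> \<le> 1" by (simp add: sgn_if)

private lemma Zr: "tt_factors N d r Zr" "left_orthogonal N d r Zr" by (rule Z[OF R])+

private lemma fac_in: "tt_factors N d r Y \<Longrightarrow> 1 \<le> i \<Longrightarrow> i \<le> N \<Longrightarrow> x < d i \<Longrightarrow> Y i x \<in> carrier_mat (r (i - 1)) (r i)"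
  by (auto simp: tt_factors_def)

private lemma Delta: "tt_factors N d r \<Delta>" by (rule tt_factors_diff[OF X(1) Zr(1)])

lemma dual_single_bound:
  assumes i: "1 \<le> i" "i \<le> N" and V: "\<And>x. x < d i \<Longrightarrow> V x \<in> carrier_mat (r (i - 1)) (r i)"
  shows "\<bar>dual (\<lambda>s. seg r (X(i := V)) 0 s 0 0)\<bar> \<le> \<beta> * sqrt (9/4 * weight i * fac_inner d r i V V)"
proof (rule rip_dual[OF tt_factors_upd[OF X(1) V] g1])
  have "(\<Sum>s\<in>multi_idx d 1 N. (seg r (X(i := V)) 0 s 0 0)\<^sup>2) \<le> 9/4 * weight i * fac_inner d r i V V"
    using i by (intro seg_norm_upd[of r, OF r0 _ _ X(2)] rbound_X[OF X err]) auto
  then show "(\<Sum>s\<in>multi_idx d 1 N. (seg r (X(i := V)) 0 s 0 0)\<^sup>2) \<le> (sqrt (9/4 * weight i * fac_inner d r i V V))\<^sup>2"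
    by (simp add: real_sqrt_pow2)
qed auto

text \<open>To the right of the last mode the interface is trivial, so the factor 9/4 of the general
  bound is avoided.\<close>

lemma dual_last_bound:
  assumes V: "\<And>x. x < d N \<Longrightarrow> V x \<in> carrier_mat (r (N - 1)) (r N)"
  shows "\<bar>dual (\<lambda>s. seg r (X(N := V)) 0 s 0 0)\<bar> \<le> \<beta> * sqrt (fac_inner d r N V V)"
proof (rule rip_dual[OF tt_factors_upd[OF X(1) V] g1])
  have "(\<Sum>s\<in>multi_idx d 1 N. (seg r (X(N := V)) 0 s 0 0)\<^sup>2) \<le> 1 * fac_inner d r N V V"
    using N rbound_N[of r N, OF rN] by (intro seg_norm_upd[of r, OF r0 _ _ X(2)]) auto
  then show "(\<Sum>s\<in>multi_idx d 1 N. (seg r (X(N := V)) 0 s 0 0)\<^sup>2) \<le> (sqrt (fac_inner d r N V V))\<^sup>2"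
    by (simp add: real_sqrt_pow2)
qed auto

private lemma G_carrier: "G i x \<in> carrier_mat (r (i - 1)) (r i)"
  by (simp add: tt_subgrad_def)

private lemma le_of_sq: "(x::real) \<le> b * sqrt (c * x) \<Longrightarrow> 0 \<le> x \<Longrightarrow> 0 \<le> c \<Longrightarrow> 0 \<le> b \<Longrightarrow> x \<le> b\<^sup>2 * c"
proof -
  assume a: "x \<le> b * sqrt (c * x)" "0 \<le> x" "0 \<le> c" "0 \<le> b"
  have "x\<^sup>2 \<le> (b * sqrt (c * x))\<^sup>2" using a by (intro power_mono) auto
  also have "\<dots> = (b\<^sup>2 * c) * x" using a by (simp add: power_mult_distrib)
  finally have "x * x \<le> (b\<^sup>2 * c) * x" by (simp add: power2_eq_square)
  then show "x \<le> b\<^sup>2 * c" using a by (cases "x = 0") auto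
qed

text \<open>Testing the subgradient block against itself: its squared norm is a dual pairing,
  bounded by a multiple of its norm.\<close>

lemma subgrad_norm: "1 \<le> i \<Longrightarrow> i \<le> N \<Longrightarrow> fac_inner d r i (G i) (G i) \<le> \<beta>\<^sup>2 * (9/4 * weight i)"
proof (rule le_of_sq)
  assume i: "1 \<le> i" "i \<le> N"
  have "fac_inner d r i (G i) (G i) = dual (\<lambda>s. seg r (X(i := G i)) 0 s 0 0)"
    by (rule fac_inner_subgrad[OF X(1) r0 rN i])
  also have "\<dots> \<le> \<beta> * sqrt (9/4 * weight i * fac_inner d r i (G i) (G i))"
    using dual_single_bound[OF i G_carrier] by (rule abs_le_D1)
  finally show "fac_inner d r i (G i) (G i) \<le> \<beta> * sqrt (9/4 * weight i * fac_inner d r i (G i) (G i))" .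
qed (use beta_pos in auto)

lemma subgrad_norm_last: "fac_inner d r N (G N) (G N) \<le> \<beta>\<^sup>2 * 1"
proof (rule le_of_sq)
  have "fac_inner d r N (G N) (G N) = dual (\<lambda>s. seg r (X(N := G N)) 0 s 0 0)"
    using N by (intro fac_inner_subgrad[OF X(1) r0 rN]) auto
  also have "\<dots> \<le> \<beta> * sqrt (fac_inner d r N (G N) (G N))"
    using dual_last_bound[OF G_carrier] by (rule abs_le_D1)
  finally show "fac_inner d r N (G N) (G N) \<le> \<beta> * sqrt (1 * fac_inner d r N (G N) (G N))" by simp
qed (use beta_pos in auto)

private abbreviation "pr i \<equiv> (left_unfold d r \<Delta> i)\<^sup>T * left_unfold d r \<Delta> i"

private lemma pr_carrier: "pr i \<in> carrier_mat (r i) (r i)"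
  by (rule mult_carrier_mat[OF _ left_unfold_carrier[of d r \<Delta> i]])
    (simp only: transpose_carrier_mat left_unfold_carrier)

private lemma unfold_diff: "1 \<le> i \<Longrightarrow> i \<le> N \<Longrightarrow> left_unfold d r X i - left_unfold d r Zr i = left_unfold d r \<Delta> i"
  by (rule left_unfold_diff[OF X(1) Zr(1)])

text \<open>The normal part of the difference is again a trial direction for factor
  \<open>i\<close>. Its norm is that of the Gram matrix of the difference, which is at most the
  squared norm \<open>f i\<close>.\<close>

lemma normal_term:
  assumes i: "1 \<le> i" "i < N"
  shows "minner (left_unfold d r G i) (left_unfold d r X i * pr i) \<le> 3/2 * \<beta> * (weight i * f i) / smax"
proof -
  let ?V = "\<lambda>x. X i x * pr i"
  have V: "?V x \<in> carrier_mat (r (i - 1)) (r i)" if "x < d i" for x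
    using fac_in[OF X(1) i(1) _ that] i by (intro mult_carrier_mat[OF _ pr_carrier]) auto
  have lu: "left_unfold d r X i * pr i = left_unfold d r (\<lambda>j x. X j x * pr i) i"
    using i by (intro left_unfold_mult[OF X(1)] pr_carrier) auto
  have "fac_inner d r i ?V ?V = minner (left_unfold d r X i * pr i) (left_unfold d r X i * pr i)"
    unfolding lu minner_left_unfold ..
  also have "\<dots> = minner (pr i) (pr i)"
    by (rule minner_isometry[OF left_unfold_carrier[of d r X i] left_orthogonalD[OF X(2) i] pr_carrier pr_carrier])
  also have "\<dots> \<le> (f i)\<^sup>2"
    using minner_gram_le[OF left_unfold_carrier[of d r \<Delta> i]] by (simp add: minner_left_unfold)
  finally have VV: "fac_inner d r i ?V ?V \<le> (f i)\<^sup>2" .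
  have "minner (left_unfold d r G i) (left_unfold d r X i * pr i) = fac_inner d r i (G i) ?V"
    unfolding lu minner_left_unfold ..
  also have "\<dots> = dual (\<lambda>s. seg r (X(i := ?V)) 0 s 0 0)"
    using i by (intro fac_inner_subgrad[OF X(1) r0 rN]) auto
  also have "\<dots> \<le> \<beta> * sqrt (9/4 * weight i * fac_inner d r i ?V ?V)"
    by (rule abs_le_D1, rule dual_single_bound[OF i(1) less_imp_le[OF i(2)] V])
  also have "\<dots> \<le> \<beta> * sqrt (9/4 * weight i * (f i)\<^sup>2)"
    using VV beta_pos by (intro mult_left_mono real_sqrt_le_mono) auto
  also have "9/4 * weight i * (f i)\<^sup>2 = (3/2 * smax * f i)\<^sup>2"
    using i by (simp add: weight_def power_mult_distrib power2_eq_square)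
  also have "\<beta> * sqrt ((3/2 * smax * f i)\<^sup>2) = 3/2 * \<beta> * (weight i * f i) / smax"
  proof -
    have nn: "0 \<le> 3/2 * smax * f i" using smax by simp
    show ?thesis unfolding real_sqrt_abs abs_of_nonneg[OF nn] using i smax by (simp add: weight_def power2_eq_square)
  qed
  finally show ?thesis .
qed

private abbreviation "cross i j \<equiv> (mix X Zr j)(i := \<Delta> i, j := \<Delta> j)"

text \<open>Two replaced factors give the geometric mean of the weighted blocks divided by
  \<open>smax\<close>, and the arithmetic mean bounds it. Since \<open>i\<close> is below
  \<open>j\<close>, block \<open>i\<close> always carries the weight \<open>smax\<close>
  squared.\<close>

lemma cross_bound:
  assumes ij: "1 \<le> i" "i < j" "j \<le> N"
  shows "\<bar>dual (\<lambda>s. seg r (cross i j) 0 s 0 0)\<bar> \<le> \<beta> * ((weight i * f i + weight j * f j) / (2 * smax))"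
proof (rule rip_dual[OF _ g1])
  show "tt_factors N d r (cross i j)"
    using ij fac_in[OF Delta] by (intro tt_factors_upd tt_factors_mix X(1) Zr(1)) auto
  have wi: "weight i = smax\<^sup>2" using ij by (simp add: weight_def)
  define a where "a = weight i * f i"
  define b where "b = weight j * f j"
  have ab: "0 \<le> a" "0 \<le> b" by (auto simp: a_def b_def)
  show "0 \<le> (weight i * f i + weight j * f j) / (2 * smax)" using smax by simp
  have "(\<Sum>s\<in>multi_idx d 1 N. (seg r (cross i j) 0 s 0 0)\<^sup>2) \<le> f i * weight j * f j"
    using ij rbound_mix[OF R, of j X] by (intro seg_norm_upd2[of r, OF r0 ij X(2)]) (auto simp: mix_def)
  also have "\<dots> = a * b / smax\<^sup>2" using smax by (simp add: a_def b_def wi)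
  also have "\<dots> \<le> (a + b)\<^sup>2 / 4 / smax\<^sup>2"
    using zero_le_power2[of "a - b"] by (intro divide_right_mono) (auto simp: power2_eq_square algebra_simps)
  also have "\<dots> = ((weight i * f i + weight j * f j) / (2 * smax))\<^sup>2"
    by (simp add: a_def b_def power_divide power_mult_distrib)
  finally show "(\<Sum>s\<in>multi_idx d 1 N. (seg r (cross i j) 0 s 0 0)\<^sup>2) \<le> ((weight i * f i + weight j * f j) / (2 * smax))\<^sup>2" .
qed

text \<open>Two telescopings: the error is a sum of single replacements inside mixtures, and
  exchanging each mixture for \<open>X\<close> leaves, by a second telescoping to the right of
  \<open>i\<close>, terms with two replaced factors.\<close>

lemma first_order_identity:
  assumes s: "s \<in> multi_idx d 1 N"
  shows "(\<Sum>i\<in>{1..N}. seg r (X(i := \<Delta> i)) 0 s 0 0) =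
    (tt_tensor N d X s - tt_tensor N d Xs s) + (\<Sum>i\<in>{1..N}. \<Sum>j\<in>{i<..N}. seg r (cross i j) 0 s 0 0)"
proof -
  have inner: "seg r (X(i := \<Delta> i)) 0 s 0 0 - seg r ((mix X Zr i)(i := \<Delta> i)) 0 s 0 0 =
    (\<Sum>j\<in>{i<..N}. seg r (cross i j) 0 s 0 0)" if i: "i \<in> {1..N}" for i
  proof -
    let ?X = "X(i := \<Delta> i)" and ?Z = "(mix X Zr i)(i := \<Delta> i)"
    have iN: "1 \<le> i" "i \<le> N" using i by auto
    have "seg r ?X 0 s 0 0 - seg r ?Z 0 s 0 0 = (\<Sum>j\<in>{i<..N}. seg r ((mix ?X ?Z j)(j := fac_diff ?X ?Z j)) 0 s 0 0)"
    proof (rule seg_telescope[of N d r, OF _ _ r0 s iN(2)])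
      show "tt_factors N d r ?X" "tt_factors N d r ?Z"
        using fac_in[OF Delta iN] by (auto intro!: tt_factors_upd tt_factors_mix X(1) Zr(1))
    qed (auto simp: mix_def)
    also have "\<dots> = (\<Sum>j\<in>{i<..N}. seg r (cross i j) 0 s 0 0)"
    proof (intro sum.cong refl)
      fix j assume j: "j \<in> {i<..N}"
      have "fac_diff ?X ?Z j = \<Delta> j" using j by (simp add: fac_diff_def mix_def fun_eq_iff)
      moreover have "(mix ?X ?Z j)(j := \<Delta> j) = cross i j" using j by (auto simp: mix_def fun_eq_iff)
      ultimately show "seg r ((mix ?X ?Z j)(j := fac_diff ?X ?Z j)) 0 s 0 0 = seg r (cross i j) 0 s 0 0" by simp
    qed
    finally show ?thesis .
  qed
  have "{0<..N} = {1..N}" by auto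
  then have "(\<Sum>i\<in>{1..N}. seg r ((mix X Zr i)(i := \<Delta> i)) 0 s 0 0) = seg r X 0 s 0 0 - seg r Zr 0 s 0 0"
    using seg_telescope[OF X(1) Zr(1) r0 s, of 0] by simp
  moreover have "(\<Sum>i\<in>{1..N}. seg r (X(i := \<Delta> i)) 0 s 0 0) - (\<Sum>i\<in>{1..N}. seg r ((mix X Zr i)(i := \<Delta> i)) 0 s 0 0) =
    (\<Sum>i\<in>{1..N}. \<Sum>j\<in>{i<..N}. seg r (cross i j) 0 s 0 0)"
    unfolding sum_subtractf[symmetric] by (rule sum.cong[OF refl inner])
  ultimately show ?thesis
    using seg_Z[OF R s] tt_tensor_seg[OF X(1) r0 rN s] tt_tensor_seg[OF Xs(1) r0 rN s] by simp
qed

text \<open>With \<open>a\<^sub>k = \<langle>A\<^sub>k, X - X\<^sup>*\<rangle>\<close> the residuals are \<open>a\<^sub>k - s\<^sub>k\<close>, and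
  \<open>sgn (a\<^sub>k - s\<^sub>k) a\<^sub>k \<ge> \<bar>a\<^sub>k - s\<^sub>k\<bar> - \<bar>s\<^sub>k\<bar>\<close>.\<close>

lemma dual_error_ge: "\<alpha> * sqrt (err2 X) \<le> dual (\<lambda>s. tt_tensor N d X s - tt_tensor N d Xs s)"
proof -
  let ?E = "\<lambda>s. tt_tensor N d X s - tt_tensor N d Xs s"
  have inner: "tensor_inner N d (A k) ?E = tensor_inner N d (A k) (tt_tensor N d X) - tensor_inner N d (A k) (tt_tensor N d Xs)" for k
    by (simp add: tensor_inner_def right_diff_distrib sum_subtractf)
  have "\<alpha> * tensor_norm N d ?E \<le> 1 / real m * l1_norm (measure_op N d m A ?E - sv) - 1 / real m * l1_norm sv"
  proof -
    have "has_tt_format N d r (tt_tensor N d X)" using X(1) r0 rN by (auto simp: has_tt_format_def)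
    then show ?thesis using sharp unfolding sharpness_def \<alpha>_def by blast
  qed
  also have "\<dots> = 1 / real m * (\<Sum>k<m. \<bar>tensor_inner N d (A k) ?E - sv $ k\<bar> - \<bar>sv $ k\<bar>)"
    using sv by (simp add: l1_norm_def measure_op_def sum_subtractf right_diff_distrib)
  also have "\<dots> \<le> 1 / real m * (\<Sum>k<m. g k * tensor_inner N d (A k) ?E)"
  proof (intro mult_left_mono sum_mono)
    fix k assume "k \<in> {..<m}"
    then have "y $ k = tensor_inner N d (A k) (tt_tensor N d Xs) + sv $ k"
      using sv by (simp add: y measure_op_def)
    then have "g k = sgn (tensor_inner N d (A k) ?E - sv $ k)" by (simp add: inner algebra_simps)
    then show "\<bar>tensor_inner N d (A k) ?E - sv $ k\<bar> - \<bar>sv $ k\<bar> \<le> g k * tensor_inner N d (A k) ?E"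
      by (auto simp: sgn_if)
  qed simp
  finally show ?thesis by (simp add: dual_sum_def err2_def tensor_norm_def sum_nonneg)
qed

text \<open>The curvature constant collects (N - 1)/2 from the cross terms, where each block occurs
  in N - 1 pairs, and 3/4 from the normal parts; together (2 N + 1)/4.\<close>

lemma descent_inner:
  "\<alpha> * sqrt (err2 X) - \<beta> * ((2 * real N + 1) / 4) * D / smax \<le>
    (\<Sum>i\<in>{1..N - 1}. minner (left_unfold d r G i) (left_unfold d r \<Delta> i)
      - 1/2 * minner (left_unfold d r G i) (left_unfold d r X i * pr i))
    + minner (left_unfold d r G N) (left_unfold d r \<Delta> N)"
proof -
  define b where "b i = weight i * f i" for i
  have b0: "0 \<le> b i" for i by (simp add: b_def)
  have Db: "D = (\<Sum>i\<in>{1..N}. b i)" unfolding aligned_dist2_weight[OF R] b_def ..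
  have N1: "{1..N} = insert N {1..N - 1}" "N \<notin> {1..N - 1}" using N by auto
  have "(\<Sum>i\<in>{1..N}. \<Sum>j\<in>{i<..N}. dual (\<lambda>s. seg r (cross i j) 0 s 0 0)) \<ge>
    (\<Sum>i\<in>{1..N}. \<Sum>j\<in>{i<..N}. - (\<beta> * ((b i + b j) / (2 * smax))))"
  proof (intro sum_mono)
    fix i j assume "i \<in> {1..N}" "j \<in> {i<..N}"
    then have "\<bar>dual (\<lambda>s. seg r (cross i j) 0 s 0 0)\<bar> \<le> \<beta> * ((b i + b j) / (2 * smax))"
      unfolding b_def by (intro cross_bound) auto
    then show "- (\<beta> * ((b i + b j) / (2 * smax))) \<le> dual (\<lambda>s. seg r (cross i j) 0 s 0 0)" by linarith
  qed
  moreover have "(\<Sum>i\<in>{1..N}. \<Sum>j\<in>{i<..N}. - (\<beta> * ((b i + b j) / (2 * smax)))) =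
    - (\<beta> / (2 * smax)) * (\<Sum>i\<in>{1..N}. \<Sum>j\<in>{i<..N}. b i + b j)"
    unfolding sum_distrib_left by (intro sum.cong refl) simp
  moreover have "(\<Sum>i\<in>{1..N}. \<Sum>j\<in>{i<..N}. b i + b j) = real (N - 1) * D"
    unfolding Db using N by (intro sum_pairs_add) auto
  ultimately have cross: "- (\<beta> / (2 * smax)) * (real (N - 1) * D) \<le>
    (\<Sum>i\<in>{1..N}. \<Sum>j\<in>{i<..N}. dual (\<lambda>s. seg r (cross i j) 0 s 0 0))" by simp
  have "(\<Sum>i\<in>{1..N - 1}. minner (left_unfold d r G i) (left_unfold d r X i * pr i)) \<le> (\<Sum>i\<in>{1..N - 1}. 3/2 * \<beta> * b i / smax)"
    unfolding b_def using N by (intro sum_mono normal_term) auto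
  also have "\<dots> = 3/2 * \<beta> / smax * (\<Sum>i\<in>{1..N - 1}. b i)" by (simp add: sum_distrib_left)
  also have "\<dots> \<le> 3/2 * \<beta> / smax * D"
    unfolding Db N1(1) using N1(2) b0 beta_pos smax by (intro mult_left_mono) auto
  finally have normal: "(\<Sum>i\<in>{1..N - 1}. minner (left_unfold d r G i) (left_unfold d r X i * pr i)) \<le> 3/2 * \<beta> / smax * D" .
  have fg: "minner (left_unfold d r G i) (left_unfold d r \<Delta> i) = dual (\<lambda>s. seg r (X(i := \<Delta> i)) 0 s 0 0)" if "i \<in> {1..N}" for i
    unfolding minner_left_unfold using that by (intro fac_inner_subgrad[OF X(1) r0 rN]) auto
  have "(\<Sum>i\<in>{1..N}. minner (left_unfold d r G i) (left_unfold d r \<Delta> i)) =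
    dual (\<lambda>s. \<Sum>i\<in>{1..N}. seg r (X(i := \<Delta> i)) 0 s 0 0)"
    unfolding dual_sum_sum by (rule sum.cong[OF refl fg])
  also have "\<dots> = dual (\<lambda>s. (tt_tensor N d X s - tt_tensor N d Xs s) + (\<Sum>i\<in>{1..N}. \<Sum>j\<in>{i<..N}. seg r (cross i j) 0 s 0 0))"
    by (rule dual_sum_cong[OF first_order_identity])
  also have "\<dots> = dual (\<lambda>s. tt_tensor N d X s - tt_tensor N d Xs s) +
      (\<Sum>i\<in>{1..N}. \<Sum>j\<in>{i<..N}. dual (\<lambda>s. seg r (cross i j) 0 s 0 0))"
    by (simp only: dual_sum_add dual_sum_sum)
  finally have "\<alpha> * sqrt (err2 X) - (\<beta> / (2 * smax)) * (real (N - 1) * D) \<le>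
    (\<Sum>i\<in>{1..N}. minner (left_unfold d r G i) (left_unfold d r \<Delta> i))"
    using dual_error_ge cross by linarith
  also have "\<dots> = (\<Sum>i\<in>{1..N - 1}. minner (left_unfold d r G i) (left_unfold d r \<Delta> i)) + minner (left_unfold d r G N) (left_unfold d r \<Delta> N)"
    unfolding N1(1) using N1(2) by simp
  finally have first: "\<alpha> * sqrt (err2 X) - (\<beta> / (2 * smax)) * (real (N - 1) * D) \<le>
    (\<Sum>i\<in>{1..N - 1}. minner (left_unfold d r G i) (left_unfold d r \<Delta> i)) + minner (left_unfold d r G N) (left_unfold d r \<Delta> N)" .
  have "\<alpha> * sqrt (err2 X) - (\<beta> / (2 * smax)) * (real (N - 1) * D) - 1/2 * (3/2 * \<beta> / smax * D) \<le>
    (\<Sum>i\<in>{1..N - 1}. minner (left_unfold d r G i) (left_unfold d r \<Delta> i)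
      - 1/2 * minner (left_unfold d r G i) (left_unfold d r X i * pr i))
    + minner (left_unfold d r G N) (left_unfold d r \<Delta> N)"
  proof -
    have "(\<Sum>i\<in>{1..N - 1}. minner (left_unfold d r G i) (left_unfold d r \<Delta> i)
        - 1/2 * minner (left_unfold d r G i) (left_unfold d r X i * pr i)) =
      (\<Sum>i\<in>{1..N - 1}. minner (left_unfold d r G i) (left_unfold d r \<Delta> i)) -
        1/2 * (\<Sum>i\<in>{1..N - 1}. minner (left_unfold d r G i) (left_unfold d r X i * pr i))"
      by (simp only: sum_subtractf sum_distrib_left)
    then show ?thesis using normal first by linarith
  qed
  moreover have "(\<beta> / (2 * smax)) * (real (N - 1) * D) + 1/2 * (3/2 * \<beta> / smax * D) = \<beta> * ((2 * real N + 1) / 4) * D / smax"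
    using smax N by (simp add: of_nat_diff field_simps)
  ultimately show ?thesis by linarith
qed

text \<open>The weight \<open>smax\<close> squared cancels the scaling of the step in the linear
  term and leaves the squared gradient over \<open>smax\<close> squared in the quadratic one, at
  most 9/4 of \<beta> squared per block. With \<beta> squared for the last block this sums to (9 N -
  5)/4.\<close>

lemma step_aligned:
  assumes \<mu>: "0 \<le> \<mu>"
    and X': "tt_factors N d r X'"
    and step: "\<And>i. i \<in> {1..N - 1} \<Longrightarrow> left_unfold d r X' i =
      polar_retr (left_unfold d r X i - (\<mu> / smax\<^sup>2) \<cdot>\<^sub>m stiefel_proj (left_unfold d r X i) (left_unfold d r G i))"
    and last: "left_unfold d r X' N = left_unfold d r X N - \<mu> \<cdot>\<^sub>m left_unfold d r G N"
  shows "aligned_dist2 N d r (smax\<^sup>2) X' Zr \<le> D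
    - 2 * \<mu> * (\<alpha> * sqrt (err2 X) - \<beta> * ((2 * real N + 1) / 4) * D / smax)
    + \<mu>\<^sup>2 * \<beta>\<^sup>2 * (9 * real N - 5) / 4"
proof -
  let ?w = "smax\<^sup>2"
  let ?f' = "\<lambda>i. fac_inner d r i (fac_diff X' Zr i) (fac_diff X' Zr i)"
  let ?q = "\<lambda>i. minner (left_unfold d r G i) (left_unfold d r \<Delta> i)"
  let ?p = "\<lambda>i. minner (left_unfold d r G i) (left_unfold d r X i * pr i)"
  have w: "0 < ?w" using smax by simp
  have fi: "?w * ?f' i \<le> ?w * f i - 2 * \<mu> * (?q i - 1/2 * ?p i) + \<mu>\<^sup>2 * (\<beta>\<^sup>2 * (9/4))" if i: "i \<in> {1..N - 1}" for i
  proof -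
    have i': "1 \<le> i" "i < N" "i \<le> N" using i by auto
    have "?f' i = minner (left_unfold d r X' i - left_unfold d r Zr i) (left_unfold d r X' i - left_unfold d r Zr i)"
      unfolding left_unfold_diff[OF X' Zr(1) i'(1,3)] minner_left_unfold ..
    also have "\<dots> \<le> f i - 2 * (\<mu> / ?w) * (?q i - 1/2 * ?p i) + (\<mu> / ?w)\<^sup>2 * fac_inner d r i (G i) (G i)"
      using stiefel_retraction_step(3)[OF left_unfold_carrier left_orthogonalD[OF X(2) i'(1,2)] left_unfold_carrier
          left_unfold_carrier left_orthogonalD[OF Zr(2) i'(1,2)] step[OF i]]
      unfolding unfold_diff[OF i'(1,3)] minner_left_unfold[of d r \<Delta> i \<Delta>] minner_left_unfold[of d r G i G] .
    finally have "?w * ?f' i \<le> ?w * (f i - 2 * (\<mu> / ?w) * (?q i - 1/2 * ?p i) + (\<mu> / ?w)\<^sup>2 * fac_inner d r i (G i) (G i))"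
      using w by (intro mult_left_mono) auto
    also have "\<dots> = ?w * f i - 2 * \<mu> * (?q i - 1/2 * ?p i) + \<mu>\<^sup>2 * (fac_inner d r i (G i) (G i) / ?w)"
      using smax by (simp add: algebra_simps power2_eq_square)
    also have "\<dots> \<le> ?w * f i - 2 * \<mu> * (?q i - 1/2 * ?p i) + \<mu>\<^sup>2 * (\<beta>\<^sup>2 * (9/4))"
      using subgrad_norm[OF i'(1,3)] w i' by (intro add_left_mono mult_left_mono) (auto simp: weight_def divide_simps)
    finally show ?thesis .
  qed
  have fN: "?f' N \<le> f N - 2 * \<mu> * ?q N + \<mu>\<^sup>2 * \<beta>\<^sup>2"
  proof -
    have N1: "1 \<le> N" "N \<le> N" using N by auto
    have "left_unfold d r X' N - left_unfold d r Zr N = left_unfold d r \<Delta> N - \<mu> \<cdot>\<^sub>m left_unfold d r G N"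
      unfolding last unfold_diff[OF N1, symmetric] by (intro eq_matI) (auto simp: left_unfold_def)
    then have "?f' N = minner (left_unfold d r \<Delta> N - \<mu> \<cdot>\<^sub>m left_unfold d r G N) (left_unfold d r \<Delta> N - \<mu> \<cdot>\<^sub>m left_unfold d r G N)"
      unfolding left_unfold_diff[OF X' Zr(1) N1] minner_left_unfold[symmetric] by simp
    also have "\<dots> = f N - 2 * (\<mu> * minner (left_unfold d r \<Delta> N) (left_unfold d r G N)) + \<mu> * (\<mu> * fac_inner d r N (G N) (G N))"
      by (subst minner_diff_sq[OF left_unfold_carrier smult_carrier_mat[OF left_unfold_carrier]])
        (simp add: minner_smult_left minner_smult_right[OF left_unfold_carrier left_unfold_carrier] minner_left_unfold)
    finally have e1: "?f' N = f N - 2 * (\<mu> * minner (left_unfold d r \<Delta> N) (left_unfold d r G N)) + \<mu> * (\<mu> * fac_inner d r N (G N) (G N))" .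
    have e2: "minner (left_unfold d r \<Delta> N) (left_unfold d r G N) = ?q N"
      by (rule minner_comm[OF left_unfold_carrier left_unfold_carrier])
    have e3: "\<mu> * (\<mu> * fac_inner d r N (G N) (G N)) \<le> \<mu>\<^sup>2 * \<beta>\<^sup>2"
      using subgrad_norm_last mult_left_mono[of "fac_inner d r N (G N) (G N)" "\<beta>\<^sup>2" "\<mu>\<^sup>2"]
      by (simp add: power2_eq_square mult.assoc)
    show ?thesis unfolding e1 e2 using e3 by linarith
  qed
  have "aligned_dist2 N d r ?w X' Zr = (\<Sum>i\<in>{1..N - 1}. ?w * ?f' i) + ?f' N"
    by (simp add: aligned_dist2_def)
  also have "\<dots> \<le> (\<Sum>i\<in>{1..N - 1}. ?w * f i - 2 * \<mu> * (?q i - 1/2 * ?p i) + \<mu>\<^sup>2 * (\<beta>\<^sup>2 * (9/4))) + (f N - 2 * \<mu> * ?q N + \<mu>\<^sup>2 * \<beta>\<^sup>2)"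
    using fi fN by (intro add_mono sum_mono) auto
  also have "\<dots> = D - 2 * \<mu> * ((\<Sum>i\<in>{1..N - 1}. ?q i - 1/2 * ?p i) + ?q N) + \<mu>\<^sup>2 * \<beta>\<^sup>2 * (9 * real N - 5) / 4"
  proof -
    define c where "c = \<mu>\<^sup>2 * (\<beta>\<^sup>2 * (9/4))"
    have c: "real (N - 1) * c + \<mu>\<^sup>2 * \<beta>\<^sup>2 = \<mu>\<^sup>2 * \<beta>\<^sup>2 * (9 * real N - 5) / 4"
      using N by (simp add: c_def of_nat_diff field_simps)
    have "(\<Sum>i\<in>{1..N - 1}. a i - k * z i + c) = (\<Sum>i\<in>{1..N - 1}. a i) - k * (\<Sum>i\<in>{1..N - 1}. z i) + real (N - 1) * c"
      for a z :: "nat \<Rightarrow> real" and k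
      by (simp add: sum.distrib sum_subtractf sum_distrib_left)
    note this[of "\<lambda>i. ?w * f i" "2 * \<mu>" "\<lambda>i. ?q i - 1/2 * ?p i"]
    then show ?thesis unfolding c_def[symmetric] using c by (simp add: aligned_dist2_def distrib_left)
  qed
  also have "\<dots> \<le> D - 2 * \<mu> * (\<alpha> * sqrt (err2 X) - \<beta> * ((2 * real N + 1) / 4) * D / smax) + \<mu>\<^sup>2 * \<beta>\<^sup>2 * (9 * real N - 5) / 4"
    using mult_left_mono[OF descent_inner, of "2 * \<mu>"] \<mu> by simp
  finally show ?thesis .
qed

end

end

section \<open>Linear convergence\<close>

text \<open>The gap between the two sides is \<open>(u - x) * (u + x - 2 * p * u)\<close>. The
  condition on \<open>p\<close> makes the second factor nonnegative for every \<open>x\<close>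
  between 0 and \<open>u\<close>, even though the step was tuned for \<open>x = u\<close>.\<close>

lemma quadratic_contraction:
  fixes x u p :: real
  assumes "0 \<le> x" "x \<le> u" "0 \<le> p" "p \<le> 1/2"
  shows "x\<^sup>2 - 2 * p * u * x + p * u\<^sup>2 \<le> (1 - p) * u\<^sup>2"
proof -
  have "2 * p * u \<le> 1 * u" using assms by (intro mult_right_mono) auto
  then have "0 \<le> (u - x) * (u + x - 2 * p * u)" using assms by (intro mult_nonneg_nonneg) auto
  then show ?thesis by (simp add: algebra_simps power2_eq_square)
qed

context tt_recovery
begin

lemma tt_dist2_nonneg:
  assumes "tt_factors N d r X"
  shows "0 \<le> tt_dist2 N d r X Xs"
  using N by (intro tt_dist2_greatest[OF assms Xs(1) r0 rN] aligned_dist2_nonneg) auto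

lemma err2_le_dist2:
  assumes X: "tt_factors N d r X" "left_orthogonal N d r X"
  shows "err2 X \<le> real N * tt_dist2 N d r X Xs"
proof -
  have "err2 X / real N \<le> tt_dist2 N d r X Xs"
    using N err2_le_aligned[OF _ X]
    by (intro tt_dist2_greatest[OF X(1) Xs(1) r0 rN]) (auto simp: divide_simps mult.commute)
  then show ?thesis using N by (simp add: divide_simps mult.commute)
qed

definition is_step :: "real \<Rightarrow> factors \<Rightarrow> factors \<Rightarrow> bool" where
  "is_step \<mu> X X' \<longleftrightarrow>
    (\<forall>i\<in>{1..N - 1}. left_unfold d r X' i =
      polar_retr (left_unfold d r X i - (\<mu> / smax\<^sup>2) \<cdot>\<^sub>m
        stiefel_proj (left_unfold d r X i) (left_unfold d r (tt_subgrad N d r m A y X) i))) \<and>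
    left_unfold d r X' N = left_unfold d r X N - \<mu> \<cdot>\<^sub>m left_unfold d r (tt_subgrad N d r m A y X) N"

lemma step_left_orthogonal:
  assumes X: "left_orthogonal N d r X" and step: "is_step \<mu> X X'"
  shows "left_orthogonal N d r X'"
  unfolding left_orthogonal_def
proof
  fix i assume i: "i \<in> {1..N - 1}"
  then have o: "(left_unfold d r X i)\<^sup>T * left_unfold d r X i = 1\<^sub>m (r i)"
    using left_orthogonalD[OF X, of i] by auto
  have "left_unfold d r X' i = polar_retr (left_unfold d r X i - (\<mu> / smax\<^sup>2) \<cdot>\<^sub>m
        stiefel_proj (left_unfold d r X i) (left_unfold d r (tt_subgrad N d r m A y X) i))"
    using step i by (simp add: is_step_def)
  \<comment> \<open>The reference point required by the retraction lemma is taken to be the base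
    point itself.\<close>
  then show "(left_unfold d r X' i)\<^sup>T * left_unfold d r X' i = 1\<^sub>m (r i)"
    by (rule stiefel_retraction_step(2)[OF left_unfold_carrier[of d r X i] o
        left_unfold_carrier[of d r "tt_subgrad N d r m A y X" i] left_unfold_carrier[of d r X i] o])
qed

text \<open>For each alignment the bound is affine in the objective with positive slope
  \<open>k\<close>, so it can be solved for the objective and compared with the infimum over all
  alignments.\<close>

lemma step_dist2:
  assumes X: "tt_factors N d r X" "left_orthogonal N d r X" and X': "tt_factors N d r X'"
    and err: "err2 X \<le> smax\<^sup>2 / 4" and smax: "0 < smax" and \<mu>: "0 \<le> \<mu>" and step: "is_step \<mu> X X'"
  shows "tt_dist2 N d r X' Xs \<le> tt_dist2 N d r X Xs
    - 2 * \<mu> * (\<alpha> * sqrt (err2 X) - \<beta> * ((2 * real N + 1) / 4) * tt_dist2 N d r X Xs / smax)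
    + \<mu>\<^sup>2 * \<beta>\<^sup>2 * (9 * real N - 5) / 4"
proof -
  define k where "k = 1 + 2 * \<mu> * (\<beta> * ((2 * real N + 1) / 4) / smax)"
  define c where "c = - 2 * \<mu> * (\<alpha> * sqrt (err2 X)) + \<mu>\<^sup>2 * \<beta>\<^sup>2 * (9 * real N - 5) / 4"
  have k: "0 < k" unfolding k_def using \<mu> beta_pos smax by (intro add_pos_nonneg mult_nonneg_nonneg divide_nonneg_nonneg) auto
  have split: "D - 2 * \<mu> * (\<alpha> * sqrt (err2 X) - \<beta> * ((2 * real N + 1) / 4) * D / smax)
    + \<mu>\<^sup>2 * \<beta>\<^sup>2 * (9 * real N - 5) / 4 = k * D + c" for D
    by (simp add: k_def c_def algebra_simps)
  have "(tt_dist2 N d r X' Xs - c) / k \<le> tt_dist2 N d r X Xs"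
  proof (rule tt_dist2_greatest[OF X(1) Xs(1) r0 rN])
    fix R assume R: "R \<in> orth_families N r"
    have "tt_dist2 N d r X' Xs \<le> aligned_dist2 N d r (smax\<^sup>2) X' (rotate_factors R Xs)"
      using N by (intro tt_dist2_le[OF X' Xs(1) r0 rN _ R]) auto
    also have "\<dots> \<le> k * aligned_dist2 N d r (smax\<^sup>2) X (rotate_factors R Xs) + c"
      unfolding split[symmetric] using step by (intro step_aligned[OF X err smax R \<mu> X']) (auto simp: is_step_def)
    finally show "(tt_dist2 N d r X' Xs - c) / k \<le> aligned_dist2 N d r (smax\<^sup>2) X (rotate_factors R Xs)"
      using k by (simp add: pos_divide_le_eq mult.commute)
  qed (use N in auto)
  then show ?thesis unfolding split using k by (simp add: pos_divide_le_eq mult.commute)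
qed

text \<open>Needed when \<open>smin\<close> vanishes: neither positivity of \<open>smax\<close> nor
  a basin condition is available there, and the quotients by \<open>smax\<close> must be
  avoided.\<close>

lemma step_dist2_zero:
  assumes X: "tt_factors N d r X" "left_orthogonal N d r X" and X': "tt_factors N d r X'"
    and step: "is_step 0 X X'"
  shows "tt_dist2 N d r X' Xs \<le> tt_dist2 N d r X Xs"
proof (rule tt_dist2_greatest[OF X(1) Xs(1) r0 rN])
  fix R assume R: "R \<in> orth_families N r"
  let ?Z = "rotate_factors R Xs"
  note Z = Z[OF R]
  have le: "fac_inner d r i (fac_diff X' ?Z i) (fac_diff X' ?Z i) \<le> fac_inner d r i (fac_diff X ?Z i) (fac_diff X ?Z i)"
    if i: "i \<in> {1..N}" for i
  proof -
    have i': "1 \<le> i" "i \<le> N" using i by auto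
    have "minner (left_unfold d r X' i - left_unfold d r ?Z i) (left_unfold d r X' i - left_unfold d r ?Z i) \<le>
      minner (left_unfold d r X i - left_unfold d r ?Z i) (left_unfold d r X i - left_unfold d r ?Z i)"
    proof (cases "i = N")
      case True
      have "left_unfold d r X' N = left_unfold d r X N - 0 \<cdot>\<^sub>m left_unfold d r (tt_subgrad N d r m A y X) N"
        using step by (simp add: is_step_def)
      also have "\<dots> = left_unfold d r X N" by (intro eq_matI) (auto simp: left_unfold_def)
      finally show ?thesis using True by simp
    next
      case False
      then have iN: "i < N" and i1: "i \<in> {1..N - 1}" using i by auto
      have "left_unfold d r X' i = polar_retr (left_unfold d r X i - (0 / smax\<^sup>2) \<cdot>\<^sub>m
          stiefel_proj (left_unfold d r X i) (left_unfold d r (tt_subgrad N d r m A y X) i))"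
        using step i1 by (simp add: is_step_def)
      from stiefel_retraction_step(3)[OF left_unfold_carrier left_orthogonalD[OF X(2) i'(1) iN] left_unfold_carrier
          left_unfold_carrier left_orthogonalD[OF Z(2) i'(1) iN] this]
      show ?thesis by simp
    qed
    then show ?thesis
      unfolding left_unfold_diff[OF X' Z(1) i'] left_unfold_diff[OF X(1) Z(1) i'] minner_left_unfold .
  qed
  have "tt_dist2 N d r X' Xs \<le> aligned_dist2 N d r (smax\<^sup>2) X' ?Z"
    using N by (intro tt_dist2_le[OF X' Xs(1) r0 rN _ R]) auto
  also have "\<dots> \<le> aligned_dist2 N d r (smax\<^sup>2) X ?Z"
    unfolding aligned_dist2_def using le N by (intro add_mono sum_mono mult_left_mono) auto
  finally show "tt_dist2 N d r X' Xs \<le> aligned_dist2 N d r (smax\<^sup>2) X ?Z" .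
qed (use N in auto)

context
  fixes S :: real
  assumes S: "S = real N + 1 + (\<Sum>i = 2..N - 1. real (r i))"
    and smin: "0 < smin" and alpha: "0 \<le> \<alpha>"
begin

lemma S_ge: "real N + 1 \<le> S" "3 \<le> S"
proof -
  show "real N + 1 \<le> S" unfolding S by (simp add: sum_nonneg)
  then show "3 \<le> S" using N by simp
qed

lemma error_ge_dist:
  assumes X: "tt_factors N d r X" "left_orthogonal N d r X"
  shows "smin / (sqrt (8 * S) * smax) * sqrt (tt_dist2 N d r X Xs) \<le> sqrt (err2 X)"
proof -
  have sm: "0 < smax" using smin smin_le_smax by simp
  have "smin * sqrt (tt_dist2 N d r X Xs) = sqrt (smin\<^sup>2 * tt_dist2 N d r X Xs)"
    using smin by (simp add: real_sqrt_mult)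
  also have "\<dots> \<le> sqrt (8 * S * (smax\<^sup>2 * err2 X))"
    using tt_dist2_le_err2[OF X] by (simp add: S)
  also have "\<dots> = sqrt (8 * S) * smax * sqrt (err2 X)"
    using sm by (simp add: real_sqrt_mult)
  finally show ?thesis using sm S_ge(2) by (simp add: pos_divide_le_eq mult_ac)
qed

text \<open>Here \<open>e\<close> bounds the squared distance. The first conclusion keeps the tensor
  error in the range where right interfaces are controlled; the second makes the curvature term at
  most half of the sharpness term. The quadratic polynomial in \<open>N\<close> enters through
  \<open>4 * n \<le> 18 * Q * S\<close> and \<open>(2 * n + 1)^2 \<le> 9 * Q\<close>.\<close>

lemma basin_bound:
  assumes "18 * (2 * (real N)\<^sup>2 - 2 * real N + 1) * S * \<beta>\<^sup>2 * e \<le> \<alpha>\<^sup>2 * smin\<^sup>2" and e: "0 \<le> e"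
  shows "real N * e \<le> smax\<^sup>2 / 4"
    and "\<beta> * ((2 * real N + 1) / 4) * sqrt e / smax \<le> \<alpha> * (smin / (sqrt (8 * S) * smax)) / 2"
proof -
  define n where "n = real N"
  define Q where "Q = 2 * n\<^sup>2 - 2 * n + 1"
  have n2: "2 \<le> n" using N by (simp add: n_def)
  have nn: "2 * n \<le> n * n" using n2 by (intro mult_right_mono) auto
  have Q5: "5 \<le> Q" unfolding Q_def power2_eq_square using nn n2 by linarith
  have h: "18 * Q * S * \<beta>\<^sup>2 * e \<le> \<alpha>\<^sup>2 * smin\<^sup>2" using assms(1) by (simp add: Q_def n_def)
  have sm: "0 < smax" using smin smin_le_smax by simp
  have "\<beta>\<^sup>2 * (18 * Q * S * e) \<le> \<beta>\<^sup>2 * smax\<^sup>2"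
  proof -
    have "\<alpha>\<^sup>2 * smin\<^sup>2 \<le> \<beta>\<^sup>2 * smax\<^sup>2"
      using alpha alpha_le_beta smin smin_le_smax by (intro mult_mono power_mono) auto
    then show ?thesis using h by (simp add: mult_ac)
  qed
  then have b: "18 * Q * S * e \<le> smax\<^sup>2" using beta_pos by simp
  have "4 * n \<le> 18 * Q * S"
  proof -
    have "18 * 5 * n \<le> 18 * Q * S" using Q5 S_ge n2 by (intro mult_mono) (auto simp: n_def)
    then show ?thesis using n2 by simp
  qed
  then have "4 * n * e \<le> 18 * Q * S * e" using e by (intro mult_right_mono)
  then have "4 * (n * e) \<le> smax\<^sup>2" using b by linarith
  then show "real N * e \<le> smax\<^sup>2 / 4" by (simp add: n_def)
  have "(\<beta> * ((2 * n + 1) / 4) * sqrt e)\<^sup>2 \<le> (\<alpha> * smin / (2 * sqrt (8 * S)))\<^sup>2"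
  proof -
    have "(2 * n + 1)\<^sup>2 = 4 * (n * n) + 4 * n + 1" by (simp add: power2_eq_square algebra_simps)
    also have "\<dots> \<le> 9 * Q"
    proof -
      have "4 * k + 4 * n + 1 \<le> 9 * (2 * k - 2 * n + 1)" if "2 * n \<le> k" for k :: real
        using that n2 by argo
      then show ?thesis using nn by (simp add: Q_def power2_eq_square)
    qed
    finally have "(2 * n + 1)\<^sup>2 \<le> 9 * Q" .
    then have "2 * S * (\<beta>\<^sup>2 * e) * (2 * n + 1)\<^sup>2 \<le> 2 * S * (\<beta>\<^sup>2 * e) * (9 * Q)"
      using S_ge e by (intro mult_left_mono) auto
    also have "\<dots> \<le> \<alpha>\<^sup>2 * smin\<^sup>2" using h by (simp add: mult_ac)
    finally have "2 * S * (\<beta>\<^sup>2 * e) * (2 * n + 1)\<^sup>2 \<le> \<alpha>\<^sup>2 * smin\<^sup>2" .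
    moreover have "(\<beta> * ((2 * n + 1) / 4) * sqrt e)\<^sup>2 = \<beta>\<^sup>2 * e * (2 * n + 1)\<^sup>2 / 16"
      using e by (simp add: power_mult_distrib power_divide)
    moreover have "(\<alpha> * smin / (2 * sqrt (8 * S)))\<^sup>2 = \<alpha>\<^sup>2 * smin\<^sup>2 / (32 * S)"
      using S_ge by (simp add: power_mult_distrib power_divide)
    ultimately show ?thesis using S_ge e by (simp add: divide_simps mult_ac)
  qed
  then have "\<beta> * ((2 * n + 1) / 4) * sqrt e \<le> \<alpha> * smin / (2 * sqrt (8 * S))"
    by (rule power2_le_imp_le) (use alpha smin S_ge in simp)
  then have "\<beta> * ((2 * n + 1) / 4) * sqrt e / smax \<le> \<alpha> * smin / (2 * sqrt (8 * S)) / smax"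
    using sm by (intro divide_right_mono) auto
  also have "\<dots> = \<alpha> * (smin / (sqrt (8 * S) * smax)) / 2" by simp
  finally show "\<beta> * ((2 * real N + 1) / 4) * sqrt e / smax \<le> \<alpha> * (smin / (sqrt (8 * S) * smax)) / 2"
    by (simp add: n_def)
qed

text \<open>The number \<open>u\<close> is a scheduled upper bound for the distance. The step size
  is the minimiser of the remaining quadratic at distance \<open>u\<close>, where the linear term
  equals \<open>2 * p * u^2\<close> and the quadratic term \<open>p * u^2\<close>, hence the rate
  \<open>1 - p\<close>.\<close>

lemma step_contraction:
  fixes X X' :: factors and u p \<mu> :: real
  defines "p \<equiv> \<alpha>\<^sup>2 * smin\<^sup>2 / (8 * S * (9 * real N - 5) * \<beta>\<^sup>2 * smax\<^sup>2)"
  assumes X: "tt_factors N d r X" "left_orthogonal N d r X" and X': "tt_factors N d r X'"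
    and basin: "18 * (2 * (real N)\<^sup>2 - 2 * real N + 1) * S * \<beta>\<^sup>2 * e \<le> \<alpha>\<^sup>2 * smin\<^sup>2"
    and u: "0 \<le> u" "tt_dist2 N d r X Xs \<le> u\<^sup>2" "u\<^sup>2 \<le> e"
    and \<mu>: "\<mu> = \<alpha> * smin / (sqrt (2 * S) * (9 * real N - 5) * \<beta>\<^sup>2 * smax) * u"
    and step: "is_step \<mu> X X'"
  shows "tt_dist2 N d r X' Xs \<le> (1 - p) * u\<^sup>2"
proof -
  define \<rho> where "\<rho> = 9 * real N - 5"
  define w where "w = smin / (sqrt (8 * S) * smax)"
  define x where "x = sqrt (tt_dist2 N d r X Xs)"
  define c where "c = \<beta> * ((2 * real N + 1) / 4)"
  have x2: "x\<^sup>2 = tt_dist2 N d r X Xs" using tt_dist2_nonneg[OF X(1)] by (simp add: x_def)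
  have x0: "0 \<le> x" using tt_dist2_nonneg[OF X(1)] by (simp add: x_def)
  have xu: "x \<le> u" by (rule power2_le_imp_le[OF _ u(1)], unfold x2, rule u(2))
  have e0: "0 \<le> e" using u(3) zero_le_power2[of u] by linarith
  have ue: "u \<le> sqrt e" using u by (simp add: real_le_rsqrt)
  have sm: "0 < smax" using smin smin_le_smax by simp
  have \<rho>: "13 \<le> \<rho>" using N by (simp add: \<rho>_def)
  have S3: "3 \<le> S" by (rule S_ge)
  note bb = basin_bound[OF basin e0]
  have \<mu>0: "0 \<le> \<mu>" unfolding \<mu> using alpha smin sm u S3 \<rho> beta_pos
    by (intro mult_nonneg_nonneg divide_nonneg_nonneg) (auto simp: \<rho>_def)
  have "err2 X \<le> real N * tt_dist2 N d r X Xs" by (rule err2_le_dist2[OF X])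
  also have "\<dots> \<le> real N * e" using u by (intro mult_left_mono) auto
  finally have err: "err2 X \<le> smax\<^sup>2 / 4" using bb(1) by simp
  have "c * x\<^sup>2 / smax = x * (c * x / smax)" by (simp add: power2_eq_square)
  also have "\<dots> \<le> x * (\<alpha> * w / 2)"
  proof (intro mult_left_mono x0)
    have "c * x / smax \<le> c * sqrt e / smax"
      using xu ue beta_pos sm by (intro divide_right_mono mult_left_mono) (auto simp: c_def)
    also have "\<dots> \<le> \<alpha> * w / 2" using bb(2) by (simp add: c_def w_def)
    finally show "c * x / smax \<le> \<alpha> * w / 2" .
  qed
  \<comment> \<open>Half of the linear gain is spent on the curvature; the other half drives the
    contraction.\<close>
  finally have quad: "c * x\<^sup>2 / smax \<le> \<alpha> * w * x / 2" by (simp add: mult_ac)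
  have lin: "\<alpha> * (w * x) \<le> \<alpha> * sqrt (err2 X)"
    using error_ge_dist[OF X] alpha by (intro mult_left_mono) (auto simp: w_def x_def)
  have "\<alpha> * w * x / 2 \<le> \<alpha> * sqrt (err2 X) - c * x\<^sup>2 / smax" using quad lin by (simp add: mult.assoc)
  then have "2 * \<mu> * (\<alpha> * w * x / 2) \<le> 2 * \<mu> * (\<alpha> * sqrt (err2 X) - c * x\<^sup>2 / smax)"
    using \<mu>0 by (intro mult_left_mono) auto
  then have "tt_dist2 N d r X' Xs \<le> x\<^sup>2 - \<mu> * (\<alpha> * w * x) + \<mu>\<^sup>2 * \<beta>\<^sup>2 * \<rho> / 4"
    using step_dist2[OF X X' err sm \<mu>0 step] by (simp add: x2[symmetric] c_def \<rho>_def)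
  also have "\<mu> * (\<alpha> * w * x) = 2 * p * u * x"
  proof -
    have ss: "sqrt (2 * S) * sqrt (8 * S) = 4 * S"
    proof -
      have "sqrt (2 * S) * sqrt (8 * S) = sqrt ((4 * S)\<^sup>2)"
        by (simp add: real_sqrt_mult[symmetric] power2_eq_square)
      also have "\<dots> = 4 * S" by (subst real_sqrt_abs) (use S3 in simp)
      finally show ?thesis .
    qed
    have "\<mu> * (\<alpha> * w * x) = \<alpha>\<^sup>2 * smin\<^sup>2 / ((sqrt (2 * S) * sqrt (8 * S)) * \<rho> * \<beta>\<^sup>2 * smax\<^sup>2) * u * x"
      by (simp add: \<mu> w_def \<rho>_def power2_eq_square mult_ac)
    then show ?thesis unfolding ss p_def by (simp add: \<rho>_def)
  qed
  also have "\<mu>\<^sup>2 * \<beta>\<^sup>2 * \<rho> / 4 = p * u\<^sup>2"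
  proof -
    have "\<mu>\<^sup>2 = \<alpha>\<^sup>2 * smin\<^sup>2 / (2 * S * \<rho>\<^sup>2 * (\<beta>\<^sup>2)\<^sup>2 * smax\<^sup>2) * u\<^sup>2"
      using S3 by (simp add: \<mu> \<rho>_def power_mult_distrib power_divide)
    then show ?thesis using \<rho> beta_pos S3 sm
      by (simp add: p_def \<rho>_def[symmetric] power2_eq_square divide_simps) (simp add: mult_ac)
  qed
  also have "x\<^sup>2 - 2 * p * u * x + p * u\<^sup>2 \<le> (1 - p) * u\<^sup>2"
  proof (rule quadratic_contraction[OF x0 xu])
    show "0 \<le> p" unfolding p_def using S3 \<rho> by (intro divide_nonneg_nonneg mult_nonneg_nonneg) (auto simp: \<rho>_def)
    have "\<alpha>\<^sup>2 * smin\<^sup>2 \<le> \<beta>\<^sup>2 * smax\<^sup>2"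
      using alpha alpha_le_beta smin smin_le_smax by (intro mult_mono power_mono) auto
    moreover have "1 * (\<beta>\<^sup>2 * smax\<^sup>2) \<le> (4 * S * \<rho>) * (\<beta>\<^sup>2 * smax\<^sup>2)"
    proof (intro mult_right_mono)
      have "3 * 13 \<le> S * \<rho>" using S3 \<rho> by (intro mult_mono) auto
      then show "1 \<le> 4 * S * \<rho>" by simp
    qed auto
    ultimately have "\<alpha>\<^sup>2 * smin\<^sup>2 \<le> 1/2 * (8 * S * \<rho> * \<beta>\<^sup>2 * smax\<^sup>2)" by (simp add: mult_ac)
    moreover have "0 < 8 * S * \<rho> * \<beta>\<^sup>2 * smax\<^sup>2" using S3 \<rho> beta_pos sm by simp
    ultimately show "p \<le> 1/2" unfolding p_def \<rho>_def[symmetric] by (simp add: pos_divide_le_eq)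
  qed
  finally show ?thesis .
qed

end

end

theorem theorem3:
  fixes N m :: nat and d r :: "nat \<Rightarrow> nat" and rbar :: nat
    and Xstar :: tensor and Xs :: factors
    and A :: "nat \<Rightarrow> tensor" and sv y :: "real vec" and ps \<delta> lam q b S :: real
    and \<mu> :: "nat \<Rightarrow> real" and X :: "nat \<Rightarrow> factors"
  assumes "2 \<le> N" and "0 < m"
    and "\<forall>i\<in>{1..N}. 1 \<le> d i" and "\<forall>i\<in>{1..N - 1}. 1 \<le> r i" and "r 0 = 1" and "r N = 1"
    and "rbar = Max (r ` {1..N - 1})"
    and "S = real N + 1 + (\<Sum>i = 2..N - 1. real (r i))"
    and "tt_factors N d r Xs" and "left_orthogonal N d r Xs" and "Xstar = tt_tensor N d Xs"
    and "\<forall>i\<in>{1..N - 1}. tt_rank N d Xstar i = r i"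
    and "sv \<in> carrier_vec m" and "ps = nonzero_frac sv" and "y = measure_op N d m A Xstar + sv"
    and "l1l2_rip N d m A ((N + 1) * rbar) \<delta>" and "sharpness N d r m A Xstar sv \<delta>"
    and "\<delta> \<le> (1 - 2 * ps) * sqrt (2 / pi)"
    and "left_orthogonal N d r (X 0)"
    and "b = sigma_min N d Xstar ^ 4 * ((1 - 2 * ps) * sqrt (2 / pi) - \<delta>)\<^sup>2 /
           (144 * (2 * (real N)\<^sup>2 - 2 * real N + 1) * S\<^sup>2 * (sqrt (2 / pi) + \<delta>)\<^sup>2 *
            (sigma_max N d Xstar)\<^sup>2)"
    and "(tensor_norm N d (\<lambda>s. tt_tensor N d (X 0) s - Xstar s))\<^sup>2 \<le> b"
    and "lam = ((1 - 2 * ps) * sqrt (2 / pi) - \<delta>) /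
           (sqrt (2 * S) * (9 * real N - 5) * (sqrt (2 / pi) + \<delta>)\<^sup>2 * cond_num N d Xstar) *
           tt_dist N d r (X 0) Xs"
    and "q = sqrt (1 - ((1 - 2 * ps) * sqrt (2 / pi) - \<delta>)\<^sup>2 /
           (8 * S * (9 * real N - 5) * (sqrt (2 / pi) + \<delta>)\<^sup>2 * (cond_num N d Xstar)\<^sup>2))"
    and "\<forall>t. \<mu> t = lam * q ^ t"
    and "\<forall>t. tt_factors N d r (X t)"
    and "\<forall>t. \<forall>i\<in>{1..N - 1}. left_unfold d r (X (Suc t)) i =
           polar_retr (left_unfold d r (X t) i - (\<mu> t / (sigma_max N d Xstar)\<^sup>2) \<cdot>\<^sub>m
             stiefel_proj (left_unfold d r (X t) i)
               (left_unfold d r (tt_subgrad N d r m A y (X t)) i))"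
    and "\<forall>t. left_unfold d r (X (Suc t)) N =
           left_unfold d r (X t) N - \<mu> t \<cdot>\<^sub>m left_unfold d r (tt_subgrad N d r m A y (X t)) N"
  shows "\<forall>t. tt_dist2 N d r (X t) Xs \<le> q ^ (2 * t) * tt_dist2 N d r (X 0) Xs"
proof -
  have K: "\<forall>i\<in>{1..N - 1}. r i \<le> (N + 1) * rbar"
  proof
    fix i assume "i \<in> {1..N - 1}"
    then have "r i \<le> rbar" unfolding assms(7) by (intro Max_ge) auto
    also have "rbar \<le> (N + 1) * rbar" by simp
    finally show "r i \<le> (N + 1) * rbar" .
  qed
  interpret tt_recovery N d r Xs m A sv y \<delta> "(N + 1) * rbar"
    using assms(1-6,9,10,12,13,15-17) K unfolding assms(11) by unfold_locales auto
  have al: "(1 - 2 * ps) * sqrt (2 / pi) - \<delta> = \<alpha>" by (simp add: \<alpha>_def assms(14))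
  have be: "sqrt (2 / pi) + \<delta> = \<beta>" by (simp add: \<beta>_def)
  have alpha: "0 \<le> \<alpha>" using assms(18) al by linarith
  have X: "tt_factors N d r (X t)" for t using assms(25) by blast
  have step: "is_step (\<mu> t) (X t) (X (Suc t))" for t
    using assms(26,27) unfolding is_step_def assms(11) by blast
  have orth: "left_orthogonal N d r (X t)" for t
    by (induction t) (use assms(19) step_left_orthogonal[OF _ step] in auto)
  define e where "e = tt_dist2 N d r (X 0) Xs"
  have e0: "0 \<le> e" unfolding e_def by (rule tt_dist2_nonneg[OF X])
  show ?thesis
  proof (cases "smin = 0")
    case True \<comment> \<open>junk case: \<open>cond_num\<close> is \<open>x / 0 = 0\<close>, so that \<open>q = 1\<close> and all step sizes vanish\<close>
    then have cond: "cond_num N d Xstar = 0" by (simp add: cond_num_def assms(11))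
    have \<mu>0: "\<mu> t = 0" for t using assms(22,24) cond by simp
    have q1: "q = 1" using assms(23) cond by simp
    have "tt_dist2 N d r (X t) Xs \<le> e" for t
    proof (induction t)
      case (Suc t)
      have "tt_dist2 N d r (X (Suc t)) Xs \<le> tt_dist2 N d r (X t) Xs"
        using step[of t] unfolding \<mu>0 by (rule step_dist2_zero[OF X orth X])
      then show ?case using Suc by simp
    qed (simp add: e_def)
    then show ?thesis by (simp add: q1 e_def)
  next
    case False
    then have smin: "0 < smin" using smin_nonneg by simp
    then have sm: "0 < smax" using smin_le_smax by simp
    note S = assms(8)
    have S3: "3 \<le> S" by (rule S_ge(2)[OF S smin alpha])
    define Q where "Q = 2 * (real N)\<^sup>2 - 2 * real N + 1"
    have Q: "0 < Q"
    proof -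
      have "2 * real N \<le> real N * real N" using N by (intro mult_right_mono) auto
      then show ?thesis by (simp add: Q_def power2_eq_square)
    qed
    define p where "p = \<alpha>\<^sup>2 * smin\<^sup>2 / (8 * S * (9 * real N - 5) * \<beta>\<^sup>2 * smax\<^sup>2)"
    \<comment> \<open>The radius \<open>b\<close> is converted from tensor error to distance: the
      comparison constant \<open>8 * S\<close> cancels against \<open>144 * S^2\<close> and leaves
      18 and a single \<open>S\<close>, and one factor \<open>smin\<close> squared is divided
      out.\<close>
    have basin: "18 * Q * S * \<beta>\<^sup>2 * e \<le> \<alpha>\<^sup>2 * smin\<^sup>2"
    proof -
      have "err2 (X 0) \<le> smin ^ 4 * \<alpha>\<^sup>2 / (144 * Q * S\<^sup>2 * \<beta>\<^sup>2 * smax\<^sup>2)"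
        using assms(20,21) unfolding err2_def al be assms(11) Q_def by simp
      then have "8 * S * (smax\<^sup>2 * err2 (X 0)) \<le> 8 * S * (smax\<^sup>2 * (smin ^ 4 * \<alpha>\<^sup>2 / (144 * Q * S\<^sup>2 * \<beta>\<^sup>2 * smax\<^sup>2)))"
        using S3 by (intro mult_left_mono) auto
      also have "\<dots> = smin\<^sup>2 * (\<alpha>\<^sup>2 * smin\<^sup>2 / (18 * Q * S * \<beta>\<^sup>2))"
        using S3 Q sm beta_pos by (simp add: power2_eq_square power4_eq_xxxx divide_simps)
      finally have "smin\<^sup>2 * e \<le> smin\<^sup>2 * (\<alpha>\<^sup>2 * smin\<^sup>2 / (18 * Q * S * \<beta>\<^sup>2))"
        using tt_dist2_le_err2[OF X orth, of 0] by (simp add: e_def S)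
      then have "e \<le> \<alpha>\<^sup>2 * smin\<^sup>2 / (18 * Q * S * \<beta>\<^sup>2)"
        by (rule mult_left_le_imp_le) (use smin in simp)
      then show ?thesis using S3 Q beta_pos by (simp add: pos_le_divide_eq mult_ac)
    qed
    have q: "q = sqrt (1 - p)"
      unfolding assms(23) al be p_def cond_num_def assms(11) by (simp add: power_divide)
    have lam: "\<mu> t = \<alpha> * smin / (sqrt (2 * S) * (9 * real N - 5) * \<beta>\<^sup>2 * smax) * (q ^ t * sqrt e)" for t
      using assms(24) unfolding assms(22) al be cond_num_def assms(11) tt_dist_def e_def by simp
    have p0: "0 \<le> p" unfolding p_def using S3 N by (intro divide_nonneg_nonneg mult_nonneg_nonneg) auto
    have "1 - p \<ge> 0"
    proof -
      have "\<alpha>\<^sup>2 * smin\<^sup>2 \<le> \<beta>\<^sup>2 * smax\<^sup>2"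
        using alpha alpha_le_beta smin smin_le_smax by (intro mult_mono power_mono) auto
      also have "\<dots> = 1 * (\<beta>\<^sup>2 * smax\<^sup>2)" by simp
      also have "\<dots> \<le> (8 * S * (9 * real N - 5)) * (\<beta>\<^sup>2 * smax\<^sup>2)"
      proof (intro mult_right_mono)
        have "3 * 13 \<le> S * (9 * real N - 5)" using S3 N by (intro mult_mono) auto
        then show "1 \<le> 8 * S * (9 * real N - 5)" by simp
      qed auto
      finally have "p \<le> 1" unfolding p_def using S3 N beta_pos sm by (simp add: divide_le_eq_1 mult.assoc)
      then show ?thesis by simp
    qed
    then have q2: "q\<^sup>2 = 1 - p" and q0: "0 \<le> q" and q1: "q \<le> 1" using q p0 by auto
    \<comment> \<open>The induction carries the scheduled bound, to which the step sizes are
      proportional. The basin condition is always checked against the initial \<open>e\<close>,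
      since the schedule never exceeds it.\<close>
    have "tt_dist2 N d r (X t) Xs \<le> (q ^ t * sqrt e)\<^sup>2" for t
    proof (induction t)
      case 0
      then show ?case using e0 by (simp add: e_def)
    next
      case (Suc t)
      have "(q ^ t * sqrt e)\<^sup>2 = (q ^ t)\<^sup>2 * e" using e0 by (simp add: power_mult_distrib)
      also have "\<dots> \<le> 1 * e" using q0 q1 e0 by (intro mult_right_mono power_le_one) auto
      finally have "(q ^ t * sqrt e)\<^sup>2 \<le> e" by simp
      then have "tt_dist2 N d r (X (Suc t)) Xs \<le> (1 - p) * (q ^ t * sqrt e)\<^sup>2"
        unfolding p_def using q0 e0 Suc
        by (intro step_contraction[OF S smin alpha X orth X basin[unfolded Q_def] _ _ _ lam step]) auto
      also have "\<dots> = (q ^ Suc t * sqrt e)\<^sup>2" unfolding q2[symmetric] by (simp add: power_mult_distrib mult.assoc)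
      finally show ?case .
    qed
    moreover have "(q ^ t * sqrt e)\<^sup>2 = q ^ (2 * t) * e" for t
      using e0 by (simp add: power_mult_distrib power_mult[symmetric] mult.commute)
    ultimately show ?thesis by (simp add: e_def)
  qed
qed

end
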